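(* Let a vacuum pp-wave with $\alpha\neq0$ be given and suppose that $d\alpha\wedge d\alpha^*=0$ but $d\alpha\wedge d\mu\neq0$. Then it is a $G_2$ solution (its local isometry group has dimension exactly 2) if and only if $$d\alpha\wedge d\mu\wedge d\nu=0.$$
   Context: Setting. Everything is local, on a small connected coordinate domain with coordinates $(\zeta,\zeta^*,u,v)$, $\zeta$ complex, $u,v$ real; $^*$ (or a bar) is complex conjugation. A (non-flat) vacuum pp-wave is a metric $ds^2=2\,d\zeta\,d\bar\zeta-2\,du\,dv-2(f+\bar f)\,du^2$ with $f=f(\zeta,u)$ complex analytic in $\zeta$, smooth in $u$, $f_{\zeta\zeta}\neq0$ everywhere. Conditions "$\ne0$" are meant at every point, conditions "$=0$" identically. Invariants are assumed to have differentials spanning spaces of constant rank. The isometry dimension is that of the Lie algebra of local Killing vector fields. Normalized tetrad and scalars. Let $a=\tfrac14\log f_{\zeta\zeta}$ and $\alpha=e^{a-a^*}(a_\zeta)^*$. If $\alpha\neq0$, write $\zeta=Z(a,u)$, $L=\log Z_a$ (functions of $(a,u)$), and let $\omega^1=(\alpha^* )^{-1}da=e^{a-a^*}(d\zeta-Z_u\,du)$, $\omega^2=(\omega^1)^*$, $\omega^3=e^{a+a^*}du$, $\omega^4=e^{-a-a^*}\big((f+f^*+Z_uZ_u^* )du+dv-Z_u\,d\zeta^*-Z_u^*\,d\zeta\big)$, so the metric is $2\omega^1\omega^2-2\omega^3\omega^4$. Its dual frame $(\delta,\delta^*,\Delta,D)$ is the null tetrad normalized by $\Psi_4=1$, $\gamma=0$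 (Newman–Penrose notation). The remaining spin coefficients are $\mu=e^{-a-a^*}L_u$ and $\nu=e^{-a-3a^*}(Z_{uu}+(f_\zeta)^* )$. *)

theory Defs
  imports "HOL-Analysis.Analysis"
begin

section \<open>Smooth maps and complex-valued differential forms\<close>

primrec C_k_on :: "nat \<Rightarrow> ('a::euclidean_space \<Rightarrow> 'b::real_normed_vector) \<Rightarrow> 'a set \<Rightarrow> bool" where
  "C_k_on 0 F S \<longleftrightarrow> continuous_on S F"
| "C_k_on (Suc k) F S \<longleftrightarrow>
     (\<forall>x\<in>S. F differentiable (at x)) \<and> (\<forall>v. C_k_on k (\<lambda>x. frechet_derivative F (at x) v) S)"

text \<open>Derivatives are taken at points of the ambient space, so the set is meant to be open.\<close>

definition smooth_on :: "('a::euclidean_space \<Rightarrow> 'b::real_normed_vector) \<Rightarrow> 'a set \<Rightarrow> bool" where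
  "smooth_on F S \<longleftrightarrow> (\<forall>k. C_k_on k F S)"

text \<open>A complex 1-form at a point is a real-linear map from tangent vectors to the complex numbers.\<close>

definition differential :: "('a::real_normed_vector \<Rightarrow> complex) \<Rightarrow> 'a \<Rightarrow> 'a \<Rightarrow> complex" where
  "differential h p = frechet_derivative h (at p)"

definition wedge2 :: "('a \<Rightarrow> complex) \<Rightarrow> ('a \<Rightarrow> complex) \<Rightarrow> 'a \<Rightarrow> 'a \<Rightarrow> complex" where
  "wedge2 A B = (\<lambda>X Y. A X * B Y - A Y * B X)"

definition wedge3 ::
  "('a \<Rightarrow> complex) \<Rightarrow> ('a \<Rightarrow> complex) \<Rightarrow> ('a \<Rightarrow> complex) \<Rightarrow> 'a \<Rightarrow> 'a \<Rightarrow> 'a \<Rightarrow> complex" where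
  "wedge3 A B C =
     (\<lambda>X Y W. A X * wedge2 B C Y W - A Y * wedge2 B C X W + A W * wedge2 B C X Y)"

section \<open>Local Killing vector fields\<close>

text \<open>
  A metric on an open subset of a Euclidean space \<open>'a\<close> is given by a bilinear form \<open>g p\<close> at each
  point \<open>p\<close>; tangent vectors are identified with elements of \<open>'a\<close>. The Lie derivative is the
  coordinate expression \<open>X\<^sup>k \<partial>\<^sub>k g\<^sub>i\<^sub>j + g\<^sub>k\<^sub>j \<partial>\<^sub>i X\<^sup>k + g\<^sub>i\<^sub>k \<partial>\<^sub>j X\<^sup>k\<close>, contracted with constant vectors \<open>Y\<close>, \<open>W\<close>.
\<close>

definition lie_derivative_metric ::
  "('a::euclidean_space \<Rightarrow> 'a \<Rightarrow> 'a \<Rightarrow> real) \<Rightarrow> ('a \<Rightarrow> 'a) \<Rightarrow> 'a \<Rightarrow> 'a \<Rightarrow> 'a \<Rightarrow> real" where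
  "lie_derivative_metric g X p Y W =
     frechet_derivative (\<lambda>q. g q Y W) (at p) (X p)
     + g p (frechet_derivative X (at p) Y) W + g p Y (frechet_derivative X (at p) W)"

definition killing_on ::
  "('a::euclidean_space \<Rightarrow> 'a \<Rightarrow> 'a \<Rightarrow> real) \<Rightarrow> 'a set \<Rightarrow> ('a \<Rightarrow> 'a) \<Rightarrow> bool" where
  "killing_on g V X \<longleftrightarrow>
     smooth_on X V \<and> (\<forall>p\<in>V. \<forall>Y W. lie_derivative_metric g X p Y W = 0)"

definition local_killing ::
  "('a::euclidean_space \<Rightarrow> 'a \<Rightarrow> 'a \<Rightarrow> real) \<Rightarrow> 'a set \<Rightarrow> 'a \<Rightarrow> ('a \<Rightarrow> 'a) \<Rightarrow> bool" where
  "local_killing g M p X \<longleftrightarrow> (\<exists>V. open V \<and> p \<in> V \<and> V \<subseteq> M \<and> killing_on g V X)"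

text \<open>
  The germs at \<open>p\<close> of Killing fields form a vector space of dimension \<open>n\<close>: there is a basis
  \<open>K 0, \<dots>, K (n - 1)\<close>, where fields that agree near \<open>p\<close> are identified.
\<close>

definition isometry_dimension ::
  "('a::euclidean_space \<Rightarrow> 'a \<Rightarrow> 'a \<Rightarrow> real) \<Rightarrow> 'a set \<Rightarrow> 'a \<Rightarrow> nat \<Rightarrow> bool" where
  "isometry_dimension g M p n \<longleftrightarrow>
     (\<exists>K :: nat \<Rightarrow> 'a \<Rightarrow> 'a.
        (\<forall>i<n. local_killing g M p (K i)) \<and>
        (\<forall>c. (\<forall>\<^sub>F q in nhds p. (\<Sum>i<n. c i *\<^sub>R K i q) = 0) \<longrightarrow> (\<forall>i<n. c i = 0)) \<and>
        (\<forall>X. local_killing g M p X \<longrightarrow>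
           (\<exists>c. \<forall>\<^sub>F q in nhds p. X q = (\<Sum>i<n. c i *\<^sub>R K i q))))"

section \<open>Vacuum pp-waves\<close>

text \<open>A point (or tangent vector) is \<open>(\<zeta>, u, v)\<close>; the coordinate \<open>\<zeta>\<^sup>*\<close> is the conjugate of \<open>\<zeta>\<close>.\<close>

type_synonym point = "complex \<times> real \<times> real"

definition d_z :: "(complex \<Rightarrow> real \<Rightarrow> complex) \<Rightarrow> complex \<Rightarrow> real \<Rightarrow> complex" where
  "d_z F z u = deriv (\<lambda>w. F w u) z"

definition d_u :: "(complex \<Rightarrow> real \<Rightarrow> complex) \<Rightarrow> complex \<Rightarrow> real \<Rightarrow> complex" where
  "d_u F z u = vector_derivative (\<lambda>t. F z t) (at u)"

definition zu_domain :: "point set \<Rightarrow> (complex \<times> real) set" where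
  "zu_domain M = (\<lambda>(z, u, v). (z, u)) ` M"

text \<open>
  The symmetric bilinear form whose quadratic form is
  \<open>2 d\<zeta> d\<zeta>\<^sup>* - 2 du dv - 2 (f + f\<^sup>*) du\<^sup>2\<close>.
\<close>

fun pp_metric :: "(complex \<Rightarrow> real \<Rightarrow> complex) \<Rightarrow> point \<Rightarrow> point \<Rightarrow> point \<Rightarrow> real" where
  "pp_metric f (z, u, v) (x1, x2, x3) (y1, y2, y3) =
     2 * Re (x1 * cnj y1) - (x2 * y3 + x3 * y2) - 2 * Re (f z u + cnj (f z u)) * x2 * y2"

definition vacuum_pp_wave :: "point set \<Rightarrow> (complex \<Rightarrow> real \<Rightarrow> complex) \<Rightarrow> bool" where
  "vacuum_pp_wave M f \<longleftrightarrow>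
     open M \<and> connected M \<and> M \<noteq> {} \<and>
     smooth_on (\<lambda>(z, u). f z u) (zu_domain M) \<and>
     (\<forall>u. (\<lambda>z. f z u) holomorphic_on {z. (z, u) \<in> zu_domain M}) \<and>
     (\<forall>(z, u)\<in>zu_domain M. d_z (d_z f) z u \<noteq> 0)"

section \<open>Normalized tetrad and spin coefficients\<close>

definition au_domain :: "point set \<Rightarrow> (complex \<Rightarrow> real \<Rightarrow> complex) \<Rightarrow> (complex \<times> real) set" where
  "au_domain M a = (\<lambda>(z, u). (a z u, u)) ` zu_domain M"

fun np_alpha :: "(complex \<Rightarrow> real \<Rightarrow> complex) \<Rightarrow> point \<Rightarrow> complex" where
  "np_alpha a (z, u, v) = exp (a z u - cnj (a z u)) * cnj (d_z a z u)"

text \<open>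
  \<open>a = (1/4) log f\<^sub>\<zeta>\<^sub>\<zeta>\<close> and \<open>L = log Z\<^sub>a\<close> stand for arbitrary smooth branches of the logarithm.
  \<open>Z\<close> inverts \<open>\<zeta> \<mapsto> a \<zeta> u\<close> for each fixed \<open>u\<close>; \<open>Z\<close> and \<open>L\<close> have arguments \<open>(a, u)\<close>, and only their
  values on \<open>au_domain M a\<close> matter.
\<close>

definition normalized_coordinates ::
  "point set \<Rightarrow> (complex \<Rightarrow> real \<Rightarrow> complex) \<Rightarrow> (complex \<Rightarrow> real \<Rightarrow> complex) \<Rightarrow>
   (complex \<Rightarrow> real \<Rightarrow> complex) \<Rightarrow> (complex \<Rightarrow> real \<Rightarrow> complex) \<Rightarrow> bool" where
  "normalized_coordinates M f a Z L \<longleftrightarrow>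
     smooth_on (\<lambda>(z, u). a z u) (zu_domain M) \<and>
     (\<forall>(z, u)\<in>zu_domain M. exp (4 * a z u) = d_z (d_z f) z u) \<and>
     smooth_on (\<lambda>(w, u). Z w u) (au_domain M a) \<and>
     (\<forall>(z, u)\<in>zu_domain M. Z (a z u) u = z) \<and>
     smooth_on (\<lambda>(w, u). L w u) (au_domain M a) \<and>
     (\<forall>(w, u)\<in>au_domain M a. exp (L w u) = d_z Z w u)"

fun np_mu ::
  "(complex \<Rightarrow> real \<Rightarrow> complex) \<Rightarrow> (complex \<Rightarrow> real \<Rightarrow> complex) \<Rightarrow> point \<Rightarrow> complex" where
  "np_mu a L (z, u, v) = exp (- a z u - cnj (a z u)) * d_u L (a z u) u"

fun np_nu ::
  "(complex \<Rightarrow> real \<Rightarrow> complex) \<Rightarrow> (complex \<Rightarrow> real \<Rightarrow> complex) \<Rightarrow> (complex \<Rightarrow> real \<Rightarrow> complex) \<Rightarrow>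
   point \<Rightarrow> complex" where
  "np_nu f a Z (z, u, v) =
     exp (- a z u - 3 * cnj (a z u)) * (d_u (d_u Z) (a z u) u + cnj (d_z f z u))"

fun omega1 ::
  "(complex \<Rightarrow> real \<Rightarrow> complex) \<Rightarrow> (complex \<Rightarrow> real \<Rightarrow> complex) \<Rightarrow> point \<Rightarrow> point \<Rightarrow> complex" where
  "omega1 a Z (z, u, v) (x1, x2, x3) =
     exp (a z u - cnj (a z u)) * (x1 - d_u Z (a z u) u * of_real x2)"

definition omega2 ::
  "(complex \<Rightarrow> real \<Rightarrow> complex) \<Rightarrow> (complex \<Rightarrow> real \<Rightarrow> complex) \<Rightarrow> point \<Rightarrow> point \<Rightarrow> complex" where
  "omega2 a Z p X = cnj (omega1 a Z p X)"

fun omega3 :: "(complex \<Rightarrow> real \<Rightarrow> complex) \<Rightarrow> point \<Rightarrow> point \<Rightarrow> complex" where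
  "omega3 a (z, u, v) (x1, x2, x3) = exp (a z u + cnj (a z u)) * of_real x2"

fun omega4 ::
  "(complex \<Rightarrow> real \<Rightarrow> complex) \<Rightarrow> (complex \<Rightarrow> real \<Rightarrow> complex) \<Rightarrow> (complex \<Rightarrow> real \<Rightarrow> complex) \<Rightarrow>
   point \<Rightarrow> point \<Rightarrow> complex" where
  "omega4 f a Z (z, u, v) (x1, x2, x3) =
     (let q = d_u Z (a z u) u in
      exp (- a z u - cnj (a z u)) *
        ((f z u + cnj (f z u) + q * cnj q) * of_real x2 + of_real x3 - q * cnj x1 - cnj q * x1))"

lemma pp_metric_eq_coframe:
  "complex_of_real (pp_metric f p X Y) =
     omega1 a Z p X * omega2 a Z p Y + omega2 a Z p X * omega1 a Z p Y
     - omega3 a p X * omega4 f a Z p Y - omega4 f a Z p X * omega3 a p Y"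
proof -
  obtain z u v where p: "p = (z, u, v)" by (cases p) auto
  obtain x1 x2 x3 where X: "X = (x1, x2, x3)" by (cases X) auto
  obtain y1 y2 y3 where Y: "Y = (y1, y2, y3)" by (cases Y) auto
  define E where "E = exp (a z u - cnj (a z u))"
  define G where "G = exp (a z u + cnj (a z u))"
  define H where "H = exp (- a z u - cnj (a z u))"
  define q where "q = d_u Z (a z u) u"
  have E: "E * cnj E = 1"
    by (simp add: E_def exp_cnj flip: exp_add)
  have GH: "G * H = 1"
    by (simp add: G_def H_def flip: exp_add)
  have o1: "omega1 a Z p X = E * (x1 - q * of_real x2)" "omega1 a Z p Y = E * (y1 - q * of_real y2)"
    by (simp_all add: p X Y E_def q_def)
  have o3: "omega3 a p X = G * of_real x2" "omega3 a p Y = G * of_real y2"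
    by (simp_all add: p X Y G_def)
  have o4: "omega4 f a Z p X =
      H * ((f z u + cnj (f z u) + q * cnj q) * of_real x2 + of_real x3 - q * cnj x1 - cnj q * x1)"
    "omega4 f a Z p Y =
      H * ((f z u + cnj (f z u) + q * cnj q) * of_real y2 + of_real y3 - q * cnj y1 - cnj q * y1)"
    by (simp_all add: p X Y H_def q_def Let_def)
  have "omega1 a Z p X * omega2 a Z p Y + omega2 a Z p X * omega1 a Z p Y
     - omega3 a p X * omega4 f a Z p Y - omega4 f a Z p X * omega3 a p Y =
     (E * cnj E) * ((x1 - q * of_real x2) * (cnj y1 - cnj q * of_real y2)
        + (cnj x1 - cnj q * of_real x2) * (y1 - q * of_real y2))
     - (G * H) * (of_real x2 *
          ((f z u + cnj (f z u) + q * cnj q) * of_real y2 + of_real y3 - q * cnj y1 - cnj q * y1)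
        + of_real y2 *
          ((f z u + cnj (f z u) + q * cnj q) * of_real x2 + of_real x3 - q * cnj x1 - cnj q * x1))"
    unfolding omega2_def o1 o3 o4 by (simp add: algebra_simps)
  also have "\<dots> = complex_of_real (pp_metric f p X Y)"
    unfolding E GH p X Y by (simp add: complex_eq_iff algebra_simps)
  finally show ?thesis ..
qed

text \<open>
  The scalar invariants generated by the spin coefficients: the set is closed under conjugation and
  under the frame derivatives, which are the coefficients in
  \<open>dh = (\<delta>h) \<omega>\<^sup>1 + (\<delta>\<^sup>*h) \<omega>\<^sup>2 + (\<Delta>h) \<omega>\<^sup>3 + (Dh) \<omega>\<^sup>4\<close>.
\<close>

inductive_set np_invariants ::
  "point set \<Rightarrow> (complex \<Rightarrow> real \<Rightarrow> complex) \<Rightarrow> (complex \<Rightarrow> real \<Rightarrow> complex) \<Rightarrow>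
   (complex \<Rightarrow> real \<Rightarrow> complex) \<Rightarrow> (complex \<Rightarrow> real \<Rightarrow> complex) \<Rightarrow> (point \<Rightarrow> complex) set"
  for M f a Z L where
  alpha: "np_alpha a \<in> np_invariants M f a Z L"
| mu: "np_mu a L \<in> np_invariants M f a Z L"
| nu: "np_nu f a Z \<in> np_invariants M f a Z L"
| conj: "h \<in> np_invariants M f a Z L \<Longrightarrow> (\<lambda>p. cnj (h p)) \<in> np_invariants M f a Z L"
| frame: "h \<in> np_invariants M f a Z L \<Longrightarrow>
    (\<And>p X. p \<in> M \<Longrightarrow> differential h p X =
        h1 p * omega1 a Z p X + h2 p * omega2 a Z p X + h3 p * omega3 a p X + h4 p * omega4 f a Z p X)
    \<Longrightarrow> k \<in> {h1, h2, h3, h4} \<Longrightarrow> k \<in> np_invariants M f a Z L"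

text \<open>
  The rank at \<open>p\<close> is the dimension of the real span of the differentials of the real and imaginary
  parts of all invariants; covectors \<open>\<xi>\<close> are represented by means of the inner product.
\<close>

definition invariant_rank ::
  "point set \<Rightarrow> (complex \<Rightarrow> real \<Rightarrow> complex) \<Rightarrow> (complex \<Rightarrow> real \<Rightarrow> complex) \<Rightarrow>
   (complex \<Rightarrow> real \<Rightarrow> complex) \<Rightarrow> (complex \<Rightarrow> real \<Rightarrow> complex) \<Rightarrow> point \<Rightarrow> nat" where
  "invariant_rank M f a Z L p =
     dim {\<xi> :: point. \<exists>h\<in>np_invariants M f a Z L.
            (\<forall>X. \<xi> \<bullet> X = Re (differential h p X)) \<or> (\<forall>X. \<xi> \<bullet> X = Im (differential h p X))}"

definition constant_invariant_rank ::
  "point set \<Rightarrow> (complex \<Rightarrow> real \<Rightarrow> complex) \<Rightarrow> (complex \<Rightarrow> real \<Rightarrow> complex) \<Rightarrow>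
   (complex \<Rightarrow> real \<Rightarrow> complex) \<Rightarrow> (complex \<Rightarrow> real \<Rightarrow> complex) \<Rightarrow> bool" where
  "constant_invariant_rank M f a Z L \<longleftrightarrow> (\<exists>r. \<forall>p\<in>M. invariant_rank M f a Z L p = r)"

end

theory Submission
  imports Defs
begin

text \<open>
  Put \<open>q = Z\<^sub>u\<close> and \<open>m = Z\<^sub>a\<close>, as functions of \<open>(\<zeta>, u)\<close>; then \<open>L\<^sub>u = q\<^sub>\<zeta>\<close> and \<open>1 + L\<^sub>a = 1 + m\<^sub>\<zeta> = \<kappa>\<close>.
  The condition \<open>d\<alpha> \<and> d\<alpha>\<^sup>* = 0\<close> says that \<open>\<kappa>\<close> is unimodular and \<open>q\<^sub>\<zeta> = - \<kappa> q\<^sub>\<zeta>\<^sup>*\<close>; holomorphy then makes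
  \<open>\<kappa>\<close> locally constant and \<open>q\<^sub>\<zeta> = c(u)\<close> a function of \<open>u\<close> alone.

  Differentiating the Killing equations shows that a Killing field \<open>(A, \<xi>, h)\<close> has
  \<open>A = m \<sigma> + q \<xi>\<close> and \<open>\<xi>' = - 2 Re \<sigma>\<close> with a constant \<open>\<sigma>\<close>, that it annihilates \<open>\<alpha>\<close>, \<open>\<mu>\<close> and \<open>\<nu>\<close>, and that it is a
  multiple of \<open>\<partial>\<^sub>v\<close> as soon as \<open>A\<close> and \<open>\<xi>\<close> vanish at one point. As \<open>d\<alpha> \<and> d\<mu> \<noteq> 0\<close>, the dimension is at most 2,
  and if it is 2 then the three differentials have a common kernel transversal to \<open>\<partial>\<^sub>v\<close>.

  Conversely, if \<open>d\<alpha> \<and> d\<mu> \<and> d\<nu> = 0\<close>, the direction annihilated by \<open>\<alpha>\<close> and \<open>\<mu>\<close> also annihilates \<open>\<nu>\<close>.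
  For \<open>\<kappa> \<noteq> - 1\<close> the \<open>\<zeta>\<close>-derivative of this relation is \<open>c c'' = 2 c'\<^sup>2\<close>, that is, \<open>1 / c\<close> is affine, and this is
  exactly what makes a multiple of that direction have constant \<open>\<sigma>\<close>; for \<open>\<kappa> = - 1\<close> it is the
  rotation \<open>\<sigma> = \<i>\<close>, \<open>\<xi> = 0\<close>. The remaining component \<open>h\<close> is then found by one integration in \<open>u\<close>.
\<close>

section \<open>Smooth maps on open sets\<close>

text \<open>Derivatives are those of the ambient space, and openness of \<open>S\<close> makes them
  depend only on the values on \<open>S\<close>, at every order.\<close>

lemma C_k_on_cong:
  assumes "open S" "\<And>x. x \<in> S \<Longrightarrow> F x = G x"
  shows "C_k_on k F S \<longleftrightarrow> C_k_on k G S"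
  using assms(2)
proof (induction k arbitrary: F G)
  case 0
  then show ?case by (auto cong: continuous_on_cong)
next
  case (Suc k)
  have D: "(F has_derivative D) (at x) \<longleftrightarrow> (G has_derivative D) (at x)" if "x \<in> S" for x D
    using that Suc.prems assms(1) by (intro iffI; elim has_derivative_transform_within_open) auto
  have "F differentiable (at x) \<longleftrightarrow> G differentiable (at x)" if "x \<in> S" for x
    using D[OF that] by (auto simp: differentiable_def)
  moreover have "frechet_derivative F (at x) = frechet_derivative G (at x)" if "x \<in> S" for x
    using D[OF that] by (simp add: frechet_derivative_def)
  moreover from this have "C_k_on k (\<lambda>x. frechet_derivative F (at x) v) S \<longleftrightarrow>
      C_k_on k (\<lambda>x. frechet_derivative G (at x) v) S" for v
    by (intro Suc.IH) simp
  ultimately show ?case by auto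
qed

lemma C_k_on_subset: "C_k_on k F S \<Longrightarrow> T \<subseteq> S \<Longrightarrow> C_k_on k F T"
  by (induction k arbitrary: F) (auto intro: continuous_on_subset)

lemma C_k_on_Suc_D: "C_k_on (Suc k) F S \<Longrightarrow> C_k_on k F S"
proof (induction k arbitrary: F)
  case 0
  then show ?case
    by (auto intro!: continuous_at_imp_continuous_on differentiable_imp_continuous_within)
next
  case (Suc k)
  then show ?case by (metis C_k_on.simps(2))
qed

text \<open>Replaces \<open>frechet_derivative\<close>, which is a choice, by any explicit
  derivative \<open>D\<close>; uniqueness of derivatives identifies the two on
  \<open>S\<close>.\<close>

lemma C_k_on_SucI:
  assumes "open S" "\<And>x. x \<in> S \<Longrightarrow> (F has_derivative D x) (at x)"
    "\<And>v. C_k_on k (\<lambda>x. D x v) S"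
  shows "C_k_on (Suc k) F S"
proof -
  have "frechet_derivative F (at x) = D x" if "x \<in> S" for x
    using assms(2)[OF that] by (metis frechet_derivative_at)
  then have "C_k_on k (\<lambda>x. frechet_derivative F (at x) v) S" for v
    using assms(3)[of v] C_k_on_cong[OF assms(1), of "\<lambda>x. frechet_derivative F (at x) v" "\<lambda>x. D x v" k]
    by simp
  then show ?thesis using assms(2) by (auto simp: differentiable_def)
qed

lemma C_k_on_Suc_has_derivative:
  "C_k_on (Suc k) F S \<Longrightarrow> x \<in> S \<Longrightarrow> (F has_derivative frechet_derivative F (at x)) (at x)"
  by (simp add: frechet_derivative_works[symmetric])

lemma C_k_on_const: "open S \<Longrightarrow> C_k_on k (\<lambda>x. c) S"
proof (induction k arbitrary: c)
  case (Suc k)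
  then show ?case by (intro C_k_on_SucI[where D = "\<lambda>x v. 0"]) auto
qed simp

lemma C_k_on_bounded_linear:
  assumes "bounded_linear h" "open S" "C_k_on k F S"
  shows "C_k_on k (\<lambda>x. h (F x)) S"
  using assms(3)
proof (induction k arbitrary: F)
  case 0
  then show ?case using assms(1) by (auto intro: bounded_linear.continuous_on)
next
  case (Suc k)
  show ?case
    by (rule C_k_on_SucI[OF assms(2), where D = "\<lambda>x v. h (frechet_derivative F (at x) v)"])
      (use Suc in \<open>auto intro!: bounded_linear.has_derivative[OF assms(1)] C_k_on_Suc_has_derivative\<close>)
qed

lemma C_k_on_linear:
  assumes "bounded_linear h" "open S"
  shows "C_k_on k h S"
proof (cases k)
  case 0
  then show ?thesis using assms
    by (auto intro!: continuous_at_imp_continuous_on linear_continuous_at)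
next
  case (Suc k')
  then show ?thesis
    using C_k_on_SucI[OF assms(2) bounded_linear_imp_has_derivative[OF assms(1)]] C_k_on_const[OF assms(2)]
    by blast
qed

lemma C_k_on_add:
  assumes "open S" "C_k_on k F S" "C_k_on k G S"
  shows "C_k_on k (\<lambda>x. F x + G x) S"
  using assms(2,3)
proof (induction k arbitrary: F G)
  case 0
  then show ?case by (auto intro: continuous_intros)
next
  case (Suc k)
  show ?case
    by (rule C_k_on_SucI[OF assms(1),
          where D = "\<lambda>x v. frechet_derivative F (at x) v + frechet_derivative G (at x) v"])
      (use Suc in \<open>auto intro!: has_derivative_add C_k_on_Suc_has_derivative\<close>)
qed

lemma C_k_on_mult:
  fixes F G :: "'a::euclidean_space \<Rightarrow> 'b::real_normed_algebra"
  assumes "open S" "C_k_on k F S" "C_k_on k G S"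
  shows "C_k_on k (\<lambda>x. F x * G x) S"
  using assms(2,3)
proof (induction k arbitrary: F G)
  case 0
  then show ?case by (auto intro: continuous_intros)
next
  case (Suc k)
  show ?case
  proof (rule C_k_on_SucI[OF assms(1)])
    show "((\<lambda>x. F x * G x) has_derivative
        (\<lambda>v. F x * frechet_derivative G (at x) v + frechet_derivative F (at x) v * G x)) (at x)"
      if "x \<in> S" for x
      using that Suc.prems by (intro has_derivative_mult C_k_on_Suc_has_derivative)
    show "C_k_on k (\<lambda>x. F x * frechet_derivative G (at x) v + frechet_derivative F (at x) v * G x) S" for v
      using Suc.prems by (intro C_k_on_add[OF assms(1)] Suc.IH C_k_on_Suc_D[OF Suc.prems(1)] C_k_on_Suc_D[OF Suc.prems(2)]) auto
  qed
qed

lemma C_k_on_inverse: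
  fixes F :: "'a::euclidean_space \<Rightarrow> 'b::real_normed_field"
  assumes "open S" "C_k_on k F S" "\<And>x. x \<in> S \<Longrightarrow> F x \<noteq> 0"
  shows "C_k_on k (\<lambda>x. inverse (F x)) S"
  using assms(2)
proof (induction k)
  case 0
  then show ?case using assms(3) by (auto intro: continuous_intros)
next
  case (Suc k)
  show ?case
  proof (rule C_k_on_SucI[OF assms(1)])
    show "((\<lambda>x. inverse (F x)) has_derivative
        (\<lambda>v. - (inverse (F x) * frechet_derivative F (at x) v * inverse (F x)))) (at x)"
      if "x \<in> S" for x
      using that Suc.prems assms(3) by (intro Deriv.has_derivative_inverse C_k_on_Suc_has_derivative) auto
    have "C_k_on k (\<lambda>x. frechet_derivative F (at x) v) S" for v
      using Suc.prems by simp
    then have "C_k_on k (\<lambda>x. (- 1) * (inverse (F x) * frechet_derivative F (at x) v * inverse (F x))) S" for v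
      using Suc.IH[OF C_k_on_Suc_D[OF Suc.prems]] by (intro C_k_on_mult[OF assms(1)] C_k_on_const[OF assms(1)])
    then show "C_k_on k (\<lambda>x. - (inverse (F x) * frechet_derivative F (at x) v * inverse (F x))) S" for v
      by simp
  qed
qed

text \<open>A linear inner map has constant derivative, so the derivative along \<open>v\<close> is
  the derivative of \<open>F\<close> along \<open>h v\<close>, again composed with \<open>h\<close>,
  and the induction closes.\<close>

lemma C_k_on_compose_linear:
  assumes "bounded_linear h" "open S" "open T" "C_k_on k F T" "\<And>x. x \<in> S \<Longrightarrow> h x \<in> T"
  shows "C_k_on k (\<lambda>x. F (h x)) S"
  using assms(4)
proof (induction k arbitrary: F)
  case 0
  then have "continuous_on (h ` S) F" using assms(5) by (auto intro: continuous_on_subset)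
  then show ?case
    using continuous_on_compose2[of "h ` S" F S h] linear_continuous_on[OF assms(1)] by simp
next
  case (Suc k)
  show ?case
  proof (rule C_k_on_SucI[OF assms(2)])
    show "((\<lambda>x. F (h x)) has_derivative (\<lambda>v. frechet_derivative F (at (h x)) (h v))) (at x)"
      if "x \<in> S" for x
      using that Suc.prems assms(5)
      by (intro has_derivative_compose[OF bounded_linear_imp_has_derivative[OF assms(1)]]
          C_k_on_Suc_has_derivative)
    show "C_k_on k (\<lambda>x. frechet_derivative F (at (h x)) (h v)) S" for v
      using Suc.prems by (intro Suc.IH) simp
  qed
qed

lemma C_k_on_Pair:
  assumes "open S" "C_k_on k F S" "C_k_on k G S"
  shows "C_k_on k (\<lambda>x. (F x, G x)) S"
proof -
  have "C_k_on k (\<lambda>x. (F x, 0) + (0, G x)) S"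
    using assms
    by (intro C_k_on_add C_k_on_bounded_linear[where h = "\<lambda>y. (y, 0)"] C_k_on_bounded_linear[where h = "\<lambda>y. (0, y)"]
        bounded_linear_Pair bounded_linear_ident bounded_linear_zero)
  then show ?thesis by simp
qed

lemma smooth_on_cong: "open S \<Longrightarrow> (\<And>x. x \<in> S \<Longrightarrow> F x = G x) \<Longrightarrow> smooth_on F S \<longleftrightarrow> smooth_on G S"
  unfolding smooth_on_def using C_k_on_cong[of S F G] by auto

lemma smooth_on_subset: "smooth_on F S \<Longrightarrow> T \<subseteq> S \<Longrightarrow> smooth_on F T"
  by (auto simp: smooth_on_def intro: C_k_on_subset)

lemma smooth_on_has_derivative:
  "smooth_on F S \<Longrightarrow> x \<in> S \<Longrightarrow> (F has_derivative frechet_derivative F (at x)) (at x)"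
  unfolding smooth_on_def using C_k_on_Suc_has_derivative by blast

lemma smooth_on_frechet_derivative:
  "smooth_on F S \<Longrightarrow> smooth_on (\<lambda>x. frechet_derivative F (at x) v) S"
  unfolding smooth_on_def by (metis C_k_on.simps(2))

lemma smooth_on_imp_continuous_on: "smooth_on F S \<Longrightarrow> continuous_on S F"
  unfolding smooth_on_def by (metis C_k_on.simps(1))

text \<open>For functions known only through their differential, such as an antiderivative.\<close>

lemma smooth_onI:
  assumes "open S" "\<And>x. x \<in> S \<Longrightarrow> (F has_derivative D x) (at x)" "\<And>v. smooth_on (\<lambda>x. D x v) S"
  shows "smooth_on F S"
  unfolding smooth_on_def
proof
  fix k
  have "C_k_on (Suc k) F S"
    using assms by (intro C_k_on_SucI) (auto simp: smooth_on_def)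
  then show "C_k_on k F S" by (rule C_k_on_Suc_D)
qed

lemma smooth_on_const: "open S \<Longrightarrow> smooth_on (\<lambda>x. c) S"
  by (simp add: smooth_on_def C_k_on_const)

lemma smooth_on_bounded_linear:
  "bounded_linear h \<Longrightarrow> open S \<Longrightarrow> smooth_on F S \<Longrightarrow> smooth_on (\<lambda>x. h (F x)) S"
  by (simp add: smooth_on_def C_k_on_bounded_linear)

lemma smooth_on_linear: "bounded_linear h \<Longrightarrow> open S \<Longrightarrow> smooth_on h S"
  by (simp add: smooth_on_def C_k_on_linear)

lemma smooth_on_add:
  "open S \<Longrightarrow> smooth_on F S \<Longrightarrow> smooth_on G S \<Longrightarrow> smooth_on (\<lambda>x. F x + G x) S"
  by (simp add: smooth_on_def C_k_on_add)

lemma smooth_on_mult: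
  fixes F G :: "'a::euclidean_space \<Rightarrow> 'b::real_normed_algebra"
  shows "open S \<Longrightarrow> smooth_on F S \<Longrightarrow> smooth_on G S \<Longrightarrow> smooth_on (\<lambda>x. F x * G x) S"
  by (simp add: smooth_on_def C_k_on_mult)

lemma smooth_on_inverse:
  fixes F :: "'a::euclidean_space \<Rightarrow> 'b::real_normed_field"
  shows "open S \<Longrightarrow> smooth_on F S \<Longrightarrow> (\<And>x. x \<in> S \<Longrightarrow> F x \<noteq> 0) \<Longrightarrow> smooth_on (\<lambda>x. inverse (F x)) S"
  by (simp add: smooth_on_def C_k_on_inverse)

lemma smooth_on_compose_linear:
  "bounded_linear h \<Longrightarrow> open S \<Longrightarrow> open T \<Longrightarrow> smooth_on F T \<Longrightarrow> (\<And>x. x \<in> S \<Longrightarrow> h x \<in> T) \<Longrightarrow>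
    smooth_on (\<lambda>x. F (h x)) S"
  by (simp add: smooth_on_def C_k_on_compose_linear[of h S T])

lemma smooth_on_Pair:
  "open S \<Longrightarrow> smooth_on F S \<Longrightarrow> smooth_on G S \<Longrightarrow> smooth_on (\<lambda>x. (F x, G x)) S"
  by (simp add: smooth_on_def C_k_on_Pair)

section \<open>Symmetry of second derivatives\<close>

lemma second_difference_mvt:
  fixes F :: "'a::euclidean_space \<Rightarrow> real"
  assumes F: "smooth_on F S" and s: "0 < s"
    and inS: "\<And>t r. 0 \<le> t \<Longrightarrow> t \<le> s \<Longrightarrow> 0 \<le> r \<Longrightarrow> r \<le> s \<Longrightarrow> x + t *\<^sub>R v + r *\<^sub>R w \<in> S"
  obtains t r where "0 < t" "t < s" "0 < r" "r < s"
    "F (x + s *\<^sub>R v + s *\<^sub>R w) - F (x + s *\<^sub>R v) - F (x + s *\<^sub>R w) + F x =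
       s * s * frechet_derivative (\<lambda>y. frechet_derivative F (at y) v) (at (x + t *\<^sub>R v + r *\<^sub>R w)) w"
proof -
  define G where "G = (\<lambda>y. frechet_derivative F (at y) v)"
  have G: "smooth_on G S"
    unfolding G_def by (rule smooth_on_frechet_derivative[OF F])
  have 1: "((\<lambda>t. F (x + t *\<^sub>R v + r *\<^sub>R w)) has_real_derivative G (x + t *\<^sub>R v + r *\<^sub>R w)) (at t)"
    if "0 \<le> t" "t \<le> s" "0 \<le> r" "r \<le> s" for t r
  proof -
    let ?D = "frechet_derivative F (at (x + t *\<^sub>R v + r *\<^sub>R w))"
    have D: "(F has_derivative ?D) (at (x + t *\<^sub>R v + r *\<^sub>R w))"
      by (rule smooth_on_has_derivative[OF F inS[OF that]])
    have "((\<lambda>t. F (x + t *\<^sub>R v + r *\<^sub>R w)) has_derivative (\<lambda>h. ?D (h *\<^sub>R v))) (at t)"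
      by (rule has_derivative_compose[of "\<lambda>t. x + t *\<^sub>R v + r *\<^sub>R w" _ t UNIV F, OF _ D]) (auto intro!: derivative_eq_intros)
    moreover have "?D (h *\<^sub>R v) = G (x + t *\<^sub>R v + r *\<^sub>R w) * h" for h
      unfolding G_def using linear_scale[OF has_derivative_linear[OF D]] by simp
    ultimately show ?thesis by (simp add: has_field_derivative_def)
  qed
  have 2: "((\<lambda>r. G (x + t *\<^sub>R v + r *\<^sub>R w)) has_real_derivative
      frechet_derivative G (at (x + t *\<^sub>R v + r *\<^sub>R w)) w) (at r)"
    if "0 \<le> t" "t \<le> s" "0 \<le> r" "r \<le> s" for t r
  proof -
    let ?D = "frechet_derivative G (at (x + t *\<^sub>R v + r *\<^sub>R w))"
    have D: "(G has_derivative ?D) (at (x + t *\<^sub>R v + r *\<^sub>R w))"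
      by (rule smooth_on_has_derivative[OF G inS[OF that]])
    have "((\<lambda>r. G (x + t *\<^sub>R v + r *\<^sub>R w)) has_derivative (\<lambda>h. ?D (h *\<^sub>R w))) (at r)"
      by (rule has_derivative_compose[of "\<lambda>r. x + t *\<^sub>R v + r *\<^sub>R w" _ r UNIV G, OF _ D]) (auto intro!: derivative_eq_intros)
    moreover have "?D (h *\<^sub>R w) = ?D w * h" for h
      using linear_scale[OF has_derivative_linear[OF D]] by simp
    ultimately show ?thesis by (simp add: has_field_derivative_def)
  qed
  \<comment> \<open>The mean value theorem is used twice: here the difference in direction
    \<open>w\<close> is differentiated along \<open>v\<close>, below \<open>G\<close> is
    differentiated along \<open>w\<close>.\<close>
  have "\<exists>t>0. t < s \<and> (F (x + s *\<^sub>R v + s *\<^sub>R w) - F (x + s *\<^sub>R v + 0 *\<^sub>R w))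
      - (F (x + 0 *\<^sub>R v + s *\<^sub>R w) - F (x + 0 *\<^sub>R v + 0 *\<^sub>R w)) =
      (s - 0) * (G (x + t *\<^sub>R v + s *\<^sub>R w) - G (x + t *\<^sub>R v + 0 *\<^sub>R w))"
    by (rule MVT2[OF s, of "\<lambda>t. F (x + t *\<^sub>R v + s *\<^sub>R w) - F (x + t *\<^sub>R v + 0 *\<^sub>R w)"])
      (intro DERIV_diff 1; use s in simp)
  then obtain t where t: "0 < t" "t < s"
    "F (x + s *\<^sub>R v + s *\<^sub>R w) - F (x + s *\<^sub>R v) - F (x + s *\<^sub>R w) + F x =
      s * (G (x + t *\<^sub>R v + s *\<^sub>R w) - G (x + t *\<^sub>R v + 0 *\<^sub>R w))"
    by auto
  have "\<exists>r>0. r < s \<and> G (x + t *\<^sub>R v + s *\<^sub>R w) - G (x + t *\<^sub>R v + 0 *\<^sub>R w) =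
      (s - 0) * frechet_derivative G (at (x + t *\<^sub>R v + r *\<^sub>R w)) w"
    by (rule MVT2[OF s, of "\<lambda>r. G (x + t *\<^sub>R v + r *\<^sub>R w)"])
      (intro 2; use s t in simp)
  then show ?thesis using t that by (auto simp: G_def)
qed

text \<open>Schwarz's theorem. The second difference is symmetric in \<open>v\<close> and
  \<open>w\<close>, so it equals \<open>s * s\<close> times either mixed derivative at points close
  to \<open>x\<close>; if these differed at \<open>x\<close>, continuity would keep them apart
  nearby.\<close>

lemma second_derivative_commute_real:
  fixes F :: "'a::euclidean_space \<Rightarrow> real"
  assumes F: "smooth_on F S" and S: "open S" "x \<in> S"
  shows "frechet_derivative (\<lambda>y. frechet_derivative F (at y) v) (at x) w =
         frechet_derivative (\<lambda>y. frechet_derivative F (at y) w) (at x) v"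
proof (rule ccontr)
  define A where "A = (\<lambda>x. frechet_derivative (\<lambda>y. frechet_derivative F (at y) v) (at x) w)"
  define B where "B = (\<lambda>x. frechet_derivative (\<lambda>y. frechet_derivative F (at y) w) (at x) v)"
  assume "\<not> ?thesis"
  then have ne: "\<bar>A x - B x\<bar> / 2 > 0" by (simp add: A_def B_def)
  have "continuous_on S A" "continuous_on S B"
    unfolding A_def B_def
    by (intro smooth_on_imp_continuous_on smooth_on_frechet_derivative F)+
  then have c: "continuous (at x) A" "continuous (at x) B"
    using S continuous_on_eq_continuous_at by auto
  obtain d1 where d1: "d1 > 0" "\<And>y. dist y x < d1 \<Longrightarrow> dist (A y) (A x) < \<bar>A x - B x\<bar> / 2"
    using c(1) ne unfolding continuous_at_eps_delta by (metis dist_norm)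
  obtain d2 where d2: "d2 > 0" "\<And>y. dist y x < d2 \<Longrightarrow> dist (B y) (B x) < \<bar>A x - B x\<bar> / 2"
    using c(2) ne unfolding continuous_at_eps_delta by (metis dist_norm)
  obtain d3 where d3: "d3 > 0" "ball x d3 \<subseteq> S"
    using S openE by blast
  define d where "d = min d1 (min d2 d3)"
  \<comment> \<open>Small enough that the parallelogram spanned by \<open>s *\<^sub>R v\<close> and
    \<open>s *\<^sub>R w\<close> at \<open>x\<close> lies in the ball of radius \<open>d\<close>;
    the summand 1 guards against \<open>v = w = 0\<close>.\<close>
  define s where "s = d / 2 / (1 + norm v + norm w)"
  have d: "d > 0" using d1 d2 d3 by (simp add: d_def)
  have N: "1 + norm v + norm w > 0"
    by (smt (verit) norm_ge_zero)
  have s: "s > 0" unfolding s_def using d N by simp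
  have near: "dist (x + t *\<^sub>R v + r *\<^sub>R w) x < d" if "0 \<le> t" "t \<le> s" "0 \<le> r" "r \<le> s" for t r
  proof -
    have "dist (x + t *\<^sub>R v + r *\<^sub>R w) x = norm (t *\<^sub>R v + r *\<^sub>R w)"
      by (simp add: dist_norm algebra_simps)
    also have "\<dots> \<le> t * norm v + r * norm w"
      using that norm_triangle_ineq[of "t *\<^sub>R v" "r *\<^sub>R w"] by simp
    also have "\<dots> \<le> s * norm v + s * norm w"
      using that by (intro add_mono mult_right_mono) auto
    also have "\<dots> < 2 * (s * (1 + norm v + norm w))"
      using s by (auto simp: algebra_simps intro!: add_nonneg_pos)
    also have "s * (1 + norm v + norm w) = d / 2"
      unfolding s_def by (rule nonzero_eq_divide_eq[THEN iffD1, OF _ refl]) (use N in simp)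
    finally show ?thesis by simp
  qed
  have inS: "x + t *\<^sub>R v + r *\<^sub>R w \<in> S" if "0 \<le> t" "t \<le> s" "0 \<le> r" "r \<le> s" for t r
    using near[OF that] d3 by (auto simp: d_def dist_commute subset_iff)
  obtain t r where 1: "0 < t" "t < s" "0 < r" "r < s"
    "F (x + s *\<^sub>R v + s *\<^sub>R w) - F (x + s *\<^sub>R v) - F (x + s *\<^sub>R w) + F x =
       s * s * A (x + t *\<^sub>R v + r *\<^sub>R w)"
    using second_difference_mvt[OF F s inS] unfolding A_def by blast
  have inS': "x + r *\<^sub>R w + t *\<^sub>R v \<in> S" if "0 \<le> r" "r \<le> s" "0 \<le> t" "t \<le> s" for t r
    using inS[of t r] that by (simp add: algebra_simps)
  obtain t' r' where 2: "0 < t'" "t' < s" "0 < r'" "r' < s"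
    "F (x + s *\<^sub>R w + s *\<^sub>R v) - F (x + s *\<^sub>R w) - F (x + s *\<^sub>R v) + F x =
       s * s * B (x + t' *\<^sub>R w + r' *\<^sub>R v)"
    using second_difference_mvt[OF F s inS'] unfolding B_def by blast
  have "s * s * A (x + t *\<^sub>R v + r *\<^sub>R w) = s * s * B (x + r' *\<^sub>R v + t' *\<^sub>R w)"
    using 1(5) 2(5) by (simp add: algebra_simps)
  then have AB: "A (x + t *\<^sub>R v + r *\<^sub>R w) = B (x + r' *\<^sub>R v + t' *\<^sub>R w)"
    using s by simp
  have "dist (A (x + t *\<^sub>R v + r *\<^sub>R w)) (A x) < \<bar>A x - B x\<bar> / 2"
    using near[of t r] 1 by (intro d1(2)) (auto simp: d_def)
  moreover have "dist (B (x + r' *\<^sub>R v + t' *\<^sub>R w)) (B x) < \<bar>A x - B x\<bar> / 2"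
    using near[of r' t'] 2 by (intro d2(2)) (auto simp: d_def)
  ultimately show False
    unfolding AB dist_real_def by (simp add: abs_if split: if_splits)
qed

lemma frechet_derivative_bounded_linear:
  assumes "bounded_linear h" "F differentiable (at x)"
  shows "frechet_derivative (\<lambda>y. h (F y)) (at x) = (\<lambda>v. h (frechet_derivative F (at x) v))"
  using bounded_linear.has_derivative[OF assms(1) assms(2)[unfolded frechet_derivative_works]]
  by (metis frechet_derivative_at)

lemma smooth_on_differentiable: "smooth_on F S \<Longrightarrow> x \<in> S \<Longrightarrow> F differentiable (at x)"
  using smooth_on_has_derivative differentiable_def by blast

lemma second_derivative_commute:
  fixes F :: "'a::euclidean_space \<Rightarrow> 'b::euclidean_space"
  assumes F: "smooth_on F S" and S: "open S" "x \<in> S"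
  shows "frechet_derivative (\<lambda>y. frechet_derivative F (at y) v) (at x) w =
         frechet_derivative (\<lambda>y. frechet_derivative F (at y) w) (at x) v"
proof (rule euclidean_eqI)
  fix b :: 'b
  let ?h = "\<lambda>y. y \<bullet> b"
  have h: "bounded_linear ?h" by (rule bounded_linear_inner_left)
  have hF: "smooth_on (\<lambda>y. ?h (F y)) S"
    by (rule smooth_on_bounded_linear[OF h S(1) F])
  have *: "frechet_derivative (\<lambda>y. frechet_derivative (\<lambda>y. ?h (F y)) (at y) v) (at x) w =
      frechet_derivative (\<lambda>y. frechet_derivative F (at y) v) (at x) w \<bullet> b" for v w
  proof -
    have 1: "frechet_derivative (\<lambda>y. ?h (F y)) (at y) v = ?h (frechet_derivative F (at y) v)" if "y \<in> S" for y
      using frechet_derivative_bounded_linear[OF h smooth_on_differentiable[OF F that]] by simp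
    have 2: "((\<lambda>y. ?h (frechet_derivative F (at y) v)) has_derivative
        (\<lambda>w. ?h (frechet_derivative (\<lambda>y. frechet_derivative F (at y) v) (at x) w))) (at x)"
      by (intro bounded_linear.has_derivative[OF h] smooth_on_has_derivative[OF _ S(2)]
          smooth_on_frechet_derivative[OF F])
    have "((\<lambda>y. frechet_derivative (\<lambda>y. ?h (F y)) (at y) v) has_derivative
        (\<lambda>w. ?h (frechet_derivative (\<lambda>y. frechet_derivative F (at y) v) (at x) w))) (at x)"
      by (rule has_derivative_transform_within_open[OF 2 S]) (simp add: 1)
    then show ?thesis using frechet_derivative_at by metis
  qed
  show "frechet_derivative (\<lambda>y. frechet_derivative F (at y) v) (at x) w \<bullet> b =
      frechet_derivative (\<lambda>y. frechet_derivative F (at y) w) (at x) v \<bullet> b"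
    using second_derivative_commute_real[OF hF S, of v w] unfolding * .
qed

section \<open>Functions holomorphic in \<open>\<zeta>\<close> and independent of \<open>v\<close>\<close>

text \<open>Complex linearity in the first component is the Cauchy-Riemann equation in \<zeta>; the
  absence of the third component is independence of \<open>v\<close> to first order.
  \<open>P\<close> and \<open>Q\<close> are then the partial derivatives in \<zeta> and
  \<open>u\<close>.\<close>

definition has_zu_derivative :: "(point \<Rightarrow> complex) \<Rightarrow> complex \<Rightarrow> complex \<Rightarrow> point \<Rightarrow> bool" where
  "has_zu_derivative F P Q p \<longleftrightarrow>
     (F has_derivative (\<lambda>X. P * fst X + Q * of_real (fst (snd X)))) (at p)"

text \<open>The derivative in the real \<zeta>-direction; under \<open>zu_diff\<close> it is the
  complex derivative.\<close>

definition pz :: "(point \<Rightarrow> complex) \<Rightarrow> point \<Rightarrow> complex" where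
  "pz F p = frechet_derivative F (at p) (1, 0, 0)"

definition pu :: "(point \<Rightarrow> complex) \<Rightarrow> point \<Rightarrow> complex" where
  "pu F p = frechet_derivative F (at p) (0, 1, 0)"

definition zu_diff :: "(point \<Rightarrow> complex) \<Rightarrow> point \<Rightarrow> bool" where
  "zu_diff F p \<longleftrightarrow> has_zu_derivative F (pz F p) (pu F p) p"

definition hol_smooth_on :: "(point \<Rightarrow> complex) \<Rightarrow> point set \<Rightarrow> bool" where
  "hol_smooth_on F S \<longleftrightarrow> smooth_on F S \<and> (\<forall>p\<in>S. zu_diff F p)"

lemma has_zu_derivative_frechet:
  "has_zu_derivative F P Q p \<Longrightarrow>
    frechet_derivative F (at p) = (\<lambda>X. P * fst X + Q * of_real (fst (snd X)))"
  unfolding has_zu_derivative_def by (metis frechet_derivative_at)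

lemma has_zu_derivativeD:
  assumes "has_zu_derivative F P Q p"
  shows "pz F p = P" "pu F p = Q" "zu_diff F p"
  using has_zu_derivative_frechet[OF assms] assms by (simp_all add: pz_def pu_def zu_diff_def)

lemma zu_diff_frechet:
  "zu_diff F p \<Longrightarrow> frechet_derivative F (at p) X = pz F p * fst X + pu F p * of_real (fst (snd X))"
  by (simp add: zu_diff_def has_zu_derivative_frechet)

lemma zu_diff_has_derivative:
  "zu_diff F p \<Longrightarrow> (F has_derivative (\<lambda>X. pz F p * fst X + pu F p * of_real (fst (snd X)))) (at p)"
  by (simp add: zu_diff_def has_zu_derivative_def)

lemma has_zu_derivative_const: "has_zu_derivative (\<lambda>p. c) 0 0 p"
  by (simp add: has_zu_derivative_def)

lemma has_zu_derivative_fst: "has_zu_derivative (\<lambda>p. fst p) 1 0 p"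
  by (auto simp: has_zu_derivative_def intro!: derivative_eq_intros)

lemma has_zu_derivative_add:
  "has_zu_derivative F P Q p \<Longrightarrow> has_zu_derivative G P' Q' p \<Longrightarrow>
    has_zu_derivative (\<lambda>p. F p + G p) (P + P') (Q + Q') p"
  unfolding has_zu_derivative_def
  by (rule has_derivative_eq_rhs, erule (1) has_derivative_add) (auto simp: algebra_simps)

lemma has_zu_derivative_mult:
  "has_zu_derivative F P Q p \<Longrightarrow> has_zu_derivative G P' Q' p \<Longrightarrow>
    has_zu_derivative (\<lambda>p. F p * G p) (P * G p + F p * P') (Q * G p + F p * Q') p"
  unfolding has_zu_derivative_def
  by (rule has_derivative_eq_rhs, erule (1) has_derivative_mult) (auto simp: algebra_simps)

lemma has_zu_derivative_minus:
  "has_zu_derivative F P Q p \<Longrightarrow> has_zu_derivative (\<lambda>p. - F p) (- P) (- Q) p"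
  unfolding has_zu_derivative_def
  by (rule has_derivative_eq_rhs, erule has_derivative_minus) (auto simp: algebra_simps)

lemma has_zu_derivative_inverse:
  "has_zu_derivative F P Q p \<Longrightarrow> F p \<noteq> 0 \<Longrightarrow>
    has_zu_derivative (\<lambda>p. inverse (F p)) (- P / (F p)\<^sup>2) (- Q / (F p)\<^sup>2) p"
  unfolding has_zu_derivative_def
  by (rule has_derivative_eq_rhs, erule (1) Deriv.has_derivative_inverse)
    (auto simp: field_simps power2_eq_square)

lemma has_zu_derivative_exp:
  "has_zu_derivative F P Q p \<Longrightarrow>
    has_zu_derivative (\<lambda>p. exp (F p)) (exp (F p) * P) (exp (F p) * Q) p"
  unfolding has_zu_derivative_def
  by (rule has_derivative_eq_rhs,
      erule has_derivative_compose[OF _ DERIV_exp[unfolded has_field_derivative_def]])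
    (auto simp: algebra_simps)

lemma has_zu_derivative_cong:
  assumes "has_zu_derivative F P Q p" "open S" "p \<in> S" "\<And>q. q \<in> S \<Longrightarrow> F q = G q"
  shows "has_zu_derivative G P Q p"
  using assms has_derivative_transform_within_open unfolding has_zu_derivative_def by blast

lemma zu_diff_has_zu: "zu_diff F p \<Longrightarrow> has_zu_derivative F (pz F p) (pu F p) p"
  by (simp add: zu_diff_def)

lemmas zu_const = has_zu_derivativeD[OF has_zu_derivative_const]
lemmas zu_fst = has_zu_derivativeD[OF has_zu_derivative_fst]
lemmas zu_add = has_zu_derivativeD[OF has_zu_derivative_add[OF zu_diff_has_zu zu_diff_has_zu]]
lemmas zu_mult = has_zu_derivativeD[OF has_zu_derivative_mult[OF zu_diff_has_zu zu_diff_has_zu]]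
lemmas zu_minus = has_zu_derivativeD[OF has_zu_derivative_minus[OF zu_diff_has_zu]]
lemmas zu_exp = has_zu_derivativeD[OF has_zu_derivative_exp[OF zu_diff_has_zu]]
lemmas zu_inverse = has_zu_derivativeD[OF has_zu_derivative_inverse[OF zu_diff_has_zu]]

lemma zu_subtract:
  assumes "zu_diff F p" "zu_diff G p"
  shows "pz (\<lambda>p. F p - G p) p = pz F p - pz G p" "pu (\<lambda>p. F p - G p) p = pu F p - pu G p"
    "zu_diff (\<lambda>p. F p - G p) p"
  using zu_add[OF assms(1) zu_minus(3)[OF assms(2)]] zu_minus[OF assms(2)] by simp_all

lemma zu_divide:
  assumes "zu_diff F p" "zu_diff G p" "G p \<noteq> 0"
  shows "pz (\<lambda>p. F p / G p) p = (pz F p * G p - F p * pz G p) / (G p)\<^sup>2"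
    "pu (\<lambda>p. F p / G p) p = (pu F p * G p - F p * pu G p) / (G p)\<^sup>2"
    "zu_diff (\<lambda>p. F p / G p) p"
  using zu_mult[OF assms(1) zu_inverse(3)[OF assms(2,3)]] zu_inverse[OF assms(2,3)] assms(3)
  by (simp_all add: divide_inverse[symmetric] field_simps power2_eq_square)

lemmas zu_simps = zu_const zu_fst zu_add zu_mult zu_minus zu_exp zu_inverse zu_subtract zu_divide

lemma hol_smooth_on_zu_diff: "hol_smooth_on F S \<Longrightarrow> p \<in> S \<Longrightarrow> zu_diff F p"
  by (simp add: hol_smooth_on_def)

lemma hol_smooth_on_smooth: "hol_smooth_on F S \<Longrightarrow> smooth_on F S"
  by (simp add: hol_smooth_on_def)

lemma hol_smooth_on_subset: "hol_smooth_on F S \<Longrightarrow> T \<subseteq> S \<Longrightarrow> hol_smooth_on F T"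
  by (auto simp: hol_smooth_on_def intro: smooth_on_subset)

lemma hol_smooth_on_cong:
  assumes "hol_smooth_on F S" "open S" "\<And>q. q \<in> S \<Longrightarrow> F q = G q"
  shows "hol_smooth_on G S"
  using assms has_zu_derivativeD(3)[OF has_zu_derivative_cong[OF zu_diff_has_zu assms(2) _ assms(3)]]
  by (auto simp: hol_smooth_on_def smooth_on_cong[of S F G])

lemma partials_cong:
  assumes "hol_smooth_on F S" "open S" "\<And>q. q \<in> S \<Longrightarrow> F q = G q" "p \<in> S"
  shows "pz F p = pz G p" "pu F p = pu G p"
  using has_zu_derivativeD[OF has_zu_derivative_cong[OF zu_diff_has_zu assms(2,4,3)]] assms
  by (auto simp: hol_smooth_on_def)

lemma hol_smooth_on_const: "open S \<Longrightarrow> hol_smooth_on (\<lambda>p. c) S"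
  by (simp add: hol_smooth_on_def smooth_on_const zu_simps)

lemma hol_smooth_on_fst: "open S \<Longrightarrow> hol_smooth_on (\<lambda>p. fst p) S"
  by (simp add: hol_smooth_on_def smooth_on_linear bounded_linear_fst zu_simps)

lemma hol_smooth_on_add:
  "open S \<Longrightarrow> hol_smooth_on F S \<Longrightarrow> hol_smooth_on G S \<Longrightarrow> hol_smooth_on (\<lambda>p. F p + G p) S"
  by (simp add: hol_smooth_on_def smooth_on_add zu_simps)

lemma hol_smooth_on_mult:
  "open S \<Longrightarrow> hol_smooth_on F S \<Longrightarrow> hol_smooth_on G S \<Longrightarrow> hol_smooth_on (\<lambda>p. F p * G p) S"
  by (simp add: hol_smooth_on_def smooth_on_mult zu_simps)

lemma hol_smooth_on_minus:
  "open S \<Longrightarrow> hol_smooth_on F S \<Longrightarrow> hol_smooth_on (\<lambda>p. - F p) S"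
  using hol_smooth_on_mult[OF _ hol_smooth_on_const, of S F "- 1"] by simp

lemma hol_smooth_on_diff:
  "open S \<Longrightarrow> hol_smooth_on F S \<Longrightarrow> hol_smooth_on G S \<Longrightarrow> hol_smooth_on (\<lambda>p. F p - G p) S"
  using hol_smooth_on_add[OF _ _ hol_smooth_on_minus, of S F G] by simp

lemma hol_smooth_on_inverse:
  "open S \<Longrightarrow> hol_smooth_on F S \<Longrightarrow> (\<And>p. p \<in> S \<Longrightarrow> F p \<noteq> 0) \<Longrightarrow> hol_smooth_on (\<lambda>p. inverse (F p)) S"
  by (simp add: hol_smooth_on_def smooth_on_inverse zu_simps)

lemma hol_smooth_on_divide:
  "open S \<Longrightarrow> hol_smooth_on F S \<Longrightarrow> hol_smooth_on G S \<Longrightarrow> (\<And>p. p \<in> S \<Longrightarrow> G p \<noteq> 0) \<Longrightarrow>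
    hol_smooth_on (\<lambda>p. F p / G p) S"
  unfolding divide_inverse by (intro hol_smooth_on_mult hol_smooth_on_inverse)

text \<open>By symmetry of second derivatives, differentiating \<open>pz F\<close> along
  \<open>X\<close> is the same as differentiating the \<open>X\<close>-derivative of
  \<open>F\<close> in the real \<zeta>-direction. The latter is explicit in \<open>X\<close>, which
  shows that \<open>pz F\<close> is again holomorphic in \<zeta> and free of \<open>v\<close>;
  likewise \<open>pu F\<close>.\<close>

lemma hol_smooth_on_partials:
  assumes F: "hol_smooth_on F S" and S: "open S"
  shows "hol_smooth_on (pz F) S" "hol_smooth_on (pu F) S"
    "\<And>p. p \<in> S \<Longrightarrow> pz (pu F) p = pu (pz F) p"
proof -
  have sm: "smooth_on (pz F) S" "smooth_on (pu F) S"
    using smooth_on_frechet_derivative[OF hol_smooth_on_smooth[OF F]] by (simp_all add: pz_def[abs_def] pu_def[abs_def])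
  have *: "frechet_derivative (\<lambda>y. frechet_derivative F (at y) v) (at p) X =
      frechet_derivative (pz F) (at p) v * fst X + frechet_derivative (pu F) (at p) v * of_real (fst (snd X))"
    if p: "p \<in> S" for p v X
  proof -
    have "((\<lambda>y. pz F y * fst X + pu F y * of_real (fst (snd X))) has_derivative
        (\<lambda>v. frechet_derivative (pz F) (at p) v * fst X
            + frechet_derivative (pu F) (at p) v * of_real (fst (snd X)))) (at p)"
      by (intro has_derivative_add has_derivative_mult_left smooth_on_has_derivative[OF _ p] sm)
    then have "((\<lambda>y. frechet_derivative F (at y) X) has_derivative
        (\<lambda>v. frechet_derivative (pz F) (at p) v * fst X
            + frechet_derivative (pu F) (at p) v * of_real (fst (snd X)))) (at p)"
      by (rule has_derivative_transform_within_open[OF _ S p])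
        (simp add: zu_diff_frechet[OF hol_smooth_on_zu_diff[OF F]])
    note D = frechet_derivative_at[OF this, symmetric]
    show ?thesis
      unfolding second_derivative_commute[OF hol_smooth_on_smooth[OF F] S p, of v X] D ..
  qed
  have z: "frechet_derivative (pz F) (at p) X = pz (pz F) p * fst X + pz (pu F) p * of_real (fst (snd X))"
    if "p \<in> S" for p X
    using *[OF that, of "(1, 0, 0)" X] unfolding pz_def[symmetric] pu_def[symmetric] .
  have u: "frechet_derivative (pu F) (at p) X = pu (pz F) p * fst X + pu (pu F) p * of_real (fst (snd X))"
    if "p \<in> S" for p X
    using *[OF that, of "(0, 1, 0)" X] unfolding pz_def[symmetric] pu_def[symmetric] .
  show c: "pz (pu F) p = pu (pz F) p" if "p \<in> S" for p
    using u[OF that, of "(1, 0, 0)"] by (simp add: pz_def[of "pu F"])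
  have "has_zu_derivative (pz F) (pz (pz F) p) (pu (pz F) p) p"
    "has_zu_derivative (pu F) (pz (pu F) p) (pu (pu F) p) p" if "p \<in> S" for p
    unfolding has_zu_derivative_def c[OF that, symmetric]
    by (rule has_derivative_eq_rhs[OF smooth_on_has_derivative[OF sm(1) that]],
        intro ext, simp only: z[OF that])
      (rule has_derivative_eq_rhs[OF smooth_on_has_derivative[OF sm(2) that]],
        intro ext, simp only: u[OF that] c[OF that])
  then show "hol_smooth_on (pz F) S" "hol_smooth_on (pu F) S"
    using sm by (simp_all add: hol_smooth_on_def zu_diff_def)
qed

lemmas hol_smooth_intros = hol_smooth_on_const hol_smooth_on_fst hol_smooth_on_add
  hol_smooth_on_mult hol_smooth_on_minus hol_smooth_on_diff hol_smooth_on_divide hol_smooth_on_partials(1,2)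

text \<open>A function that is both holomorphic and antiholomorphic in \<open>\<zeta>\<close> does not depend on \<open>\<zeta>\<close>.\<close>

lemma pz_zero_if_add_cnj_zero:
  assumes "open S" "p \<in> S" "\<And>p. p \<in> S \<Longrightarrow> G p + cnj (H p) = 0" "zu_diff G p" "zu_diff H p"
  shows "pz G p = 0" "pz H p = 0"
proof -
  have 1: "((\<lambda>p. G p + cnj (H p)) has_derivative
      (\<lambda>X. (pz G p * fst X + pu G p * of_real (fst (snd X)))
         + cnj (pz H p * fst X + pu H p * of_real (fst (snd X))))) (at p)"
    by (intro has_derivative_add has_derivative_cnj zu_diff_has_derivative assms)
  have 2: "((\<lambda>p. G p + cnj (H p)) has_derivative (\<lambda>X. 0)) (at p)"
    by (rule has_derivative_transform_within_open[OF _ assms(1,2), of "\<lambda>p. 0"]) (simp_all add: assms(3))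
  have "(\<lambda>X::point. (pz G p * fst X + pu G p * of_real (fst (snd X)))
         + cnj (pz H p * fst X + pu H p * of_real (fst (snd X)))) = (\<lambda>X. 0)"
    using frechet_derivative_at[OF 1] frechet_derivative_at[OF 2] by (rule trans[OF _ sym])
  from fun_cong[OF this, of "(1, 0, 0)"] fun_cong[OF this, of "(\<i>, 0, 0)"]
  show "pz G p = 0" "pz H p = 0"
    by (auto simp: complex_eq_iff)
qed

lemma zero_partials_const:
  assumes "open S" "connected S" "\<And>p. p \<in> S \<Longrightarrow> zu_diff F p"
    "\<And>p. p \<in> S \<Longrightarrow> pz F p = 0" "\<And>p. p \<in> S \<Longrightarrow> pu F p = 0" "p \<in> S" "q \<in> S"
  shows "F p = F q"
proof -
  have "(F has_derivative (\<lambda>X. 0)) (at x)" if "x \<in> S" for x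
    using zu_diff_has_derivative[OF assms(3)[OF that]] assms(4,5)[OF that] by simp
  then show ?thesis
    by (rule has_derivative_zero_unique_connected[OF assms(1,2) _ assms(6,7)])
qed

section \<open>Functions of (\<zeta>, u) read as functions on points\<close>

abbreviation lift :: "(complex \<Rightarrow> real \<Rightarrow> complex) \<Rightarrow> point \<Rightarrow> complex" where
  "lift F \<equiv> (\<lambda>p. F (fst p) (fst (snd p)))"

lemma lift_field_derivatives:
  assumes "zu_diff (lift F) (z, u, v)"
  shows "((\<lambda>w. F w u) has_field_derivative pz (lift F) (z, u, v)) (at z)"
    "((\<lambda>t. F z t) has_vector_derivative pu (lift F) (z, u, v)) (at u)"
    "d_z F z u = pz (lift F) (z, u, v)" "d_u F z u = pu (lift F) (z, u, v)"
proof -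
  let ?P = "pz (lift F) (z, u, v)" let ?Q = "pu (lift F) (z, u, v)"
  have D: "(lift F has_derivative (\<lambda>X. ?P * fst X + ?Q * of_real (fst (snd X)))) (at (z, u, v))"
    by (rule zu_diff_has_derivative[OF assms])
  have "((\<lambda>w. lift F (w, u, v)) has_derivative
      (\<lambda>x. ?P * fst (x, 0::real, 0::real) + ?Q * of_real (fst (snd (x, 0::real, 0::real))))) (at z)"
    by (rule has_derivative_compose[of "\<lambda>w. (w, u, v)" "\<lambda>x. (x, 0, 0)" z UNIV "lift F", OF _ D])
      (auto intro!: derivative_eq_intros simp: zero_prod_def)
  then show 1: "((\<lambda>w. F w u) has_field_derivative ?P) (at z)"
    by (simp add: has_field_derivative_def)
  have "((\<lambda>t. lift F (z, t, v)) has_derivative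
      (\<lambda>x. ?P * fst (0::complex, x::real, 0::real) + ?Q * of_real (fst (snd (0::complex, x, 0::real))))) (at u)"
    by (rule has_derivative_compose[of "\<lambda>t. (z, t, v)" "\<lambda>x. (0, x, 0)" u UNIV "lift F", OF _ D])
      (auto intro!: derivative_eq_intros)
  then show 2: "((\<lambda>t. F z t) has_vector_derivative ?Q) (at u)"
    by (simp add: has_vector_derivative_def scaleR_conv_of_real mult.commute)
  show "d_z F z u = ?P" "d_u F z u = ?Q"
    using DERIV_imp_deriv[OF 1] vector_derivative_at[OF 2] by (simp_all add: d_z_def d_u_def)
qed

text \<open>The slice of \<open>M\<close> at a fixed \<open>v\<close> is open in (\<zeta>, u) and
  contained in the projection.\<close>

lemma open_zu_domain:
  assumes "open M" shows "open (zu_domain M)"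
proof (rule openI)
  fix x assume "x \<in> zu_domain M"
  then obtain z u v where x: "x = (z, u)" and p: "(z, u, v) \<in> M"
    by (auto simp: zu_domain_def)
  have "open ((\<lambda>y. (fst y, snd y, v)) -` M)"
    by (rule open_vimage[OF assms]) (intro continuous_intros)
  then obtain e where "e > 0" "ball x e \<subseteq> (\<lambda>y. (fst y, snd y, v)) -` M"
    using p x by (metis (no_types, lifting) fst_conv openE snd_conv vimageI)
  moreover have "(\<lambda>y. (fst y, snd y, v)) -` M \<subseteq> zu_domain M"
    by (force simp: zu_domain_def image_iff)
  ultimately show "\<exists>e>0. ball x e \<subseteq> zu_domain M" by blast
qed

lemma zu_domainI: "p \<in> M \<Longrightarrow> (fst p, fst (snd p)) \<in> zu_domain M"
  by (cases p) (force simp: zu_domain_def image_iff)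

lemma has_derivative_lift:
  assumes "((\<lambda>(z, u). F z u) has_derivative D) (at (fst p, fst (snd p)))"
  shows "(lift F has_derivative (\<lambda>X. D (fst X, fst (snd X)))) (at p)"
proof -
  have "((\<lambda>p. (\<lambda>(z, u). F z u) (fst p, fst (snd p))) has_derivative (\<lambda>X. D (fst X, fst (snd X)))) (at p)"
    by (rule has_derivative_compose[of "\<lambda>p. (fst p, fst (snd p))" _ p UNIV, OF _ assms])
      (auto intro!: derivative_eq_intros)
  then show ?thesis by simp
qed

lemma smooth_on_lift:
  assumes "open M" "smooth_on (\<lambda>(z, u). F z u) (zu_domain M)"
  shows "smooth_on (lift F) M"
proof -
  have "bounded_linear (\<lambda>p::point. (fst p, fst (snd p)))"
    by (intro bounded_linear_Pair bounded_linear_fst bounded_linear_compose[OF bounded_linear_fst bounded_linear_snd])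
  from smooth_on_compose_linear[OF this assms(1) open_zu_domain[OF assms(1)] assms(2) zu_domainI]
  show ?thesis by simp
qed

lemma hol_smooth_on_lift:
  assumes M: "open M" and F: "smooth_on (\<lambda>(z, u). F z u) (zu_domain M)"
    and lin: "\<And>z u. (z, u) \<in> zu_domain M \<Longrightarrow>
      \<exists>c. \<forall>x. frechet_derivative (\<lambda>(z, u). F z u) (at (z, u)) (x, 0) = c * x"
  shows "hol_smooth_on (lift F) M"
  unfolding hol_smooth_on_def
proof (intro conjI ballI)
  show "smooth_on (lift F) M" by (rule smooth_on_lift[OF M F])
  fix p assume p: "p \<in> M"
  define D where "D = frechet_derivative (\<lambda>(z, u). F z u) (at (fst p, fst (snd p)))"
  have D: "((\<lambda>(z, u). F z u) has_derivative D) (at (fst p, fst (snd p)))"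
    unfolding D_def by (rule smooth_on_has_derivative[OF F zu_domainI[OF p]])
  obtain c where c: "\<And>x. D (x, 0) = c * x"
    using lin[OF zu_domainI[OF p]] unfolding D_def by blast
  have lin: "D (x, t) = c * x + D (0, 1) * of_real t" for x t
  proof -
    have "D (x, t) = D ((x, 0) + t *\<^sub>R (0, 1))" by simp
    also have "\<dots> = D (x, 0) + t *\<^sub>R D (0, 1)"
      using has_derivative_linear[OF D] by (simp only: linear_add linear_scale)
    finally show ?thesis by (simp add: c scaleR_conv_of_real)
  qed
  have "has_zu_derivative (lift F) c (D (0, 1)) p"
    unfolding has_zu_derivative_def
    by (rule has_derivative_eq_rhs[OF has_derivative_lift[OF D]]) (intro ext lin)
  then show "zu_diff (lift F) p" by (rule has_zu_derivativeD)
qed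

section \<open>The invariants in the coordinates \<open>(\<zeta>, u, v)\<close>\<close>

text \<open>The chart functions \<open>Z\<close> and \<open>L\<close> are eliminated here:
  \<open>a\<close> is one fourth of a logarithm of \<open>pz (pz f)\<close>, \<open>az\<close>
  expresses that \<alpha> does not vanish, and every other quantity is built from \<open>a\<close>
  and \<open>f\<close> in the coordinates (\<zeta>, u, v).\<close>

locale pp_frame =
  fixes M :: "point set" and F :: "complex \<Rightarrow> real \<Rightarrow> complex" and a :: "point \<Rightarrow> complex"
  assumes open_M: "open M" and f_hs: "hol_smooth_on (lift F) M" and a_hs: "hol_smooth_on a M"
    and fzz: "\<And>p. p \<in> M \<Longrightarrow> pz (pz (lift F)) p = exp (4 * a p)"
    and az: "\<And>p. p \<in> M \<Longrightarrow> pz a p \<noteq> 0"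
begin

abbreviation f :: "point \<Rightarrow> complex" where "f \<equiv> lift F"

text \<open>Differentiating Z(a(\<zeta>, u), u) = \<zeta> in \<zeta> and in \<open>u\<close> gives
  \<open>1 / pz a\<close> for \<open>Z_a\<close> and \<open>- pu a / pz a\<close> for
  \<open>Z_u\<close>; these are \<open>m\<close> and, below, \<open>q\<close>.\<close>

definition m :: "point \<Rightarrow> complex" where "m p = 1 / pz a p"

definition q :: "point \<Rightarrow> complex" where "q p = - pu a p / pz a p"

definition \<kappa> :: "point \<Rightarrow> complex" where "\<kappa> p = 1 + pz m p"

text \<open>This is \<open>Z_uu\<close>: at fixed \<open>a\<close> the \<open>u\<close>-derivative
  is \<open>pu\<close> plus \<open>q\<close> times \<open>pz\<close>.\<close>

definition n0 :: "point \<Rightarrow> complex" where "n0 p = pu q p + q p * pz q p"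

text \<open>\<open>al\<close>, \<open>mu\<close> and \<open>nu\<close> are the spin coefficients
  \<alpha>, \<mu> and \<nu> as functions of the point; \<open>np_eq\<close> makes the
  identification.\<close>

definition al :: "point \<Rightarrow> complex" where "al p = exp (a p - cnj (a p)) * cnj (pz a p)"

definition mu :: "point \<Rightarrow> complex" where "mu p = exp (- a p - cnj (a p)) * pz q p"

definition nu :: "point \<Rightarrow> complex" where
  "nu p = exp (- a p - 3 * cnj (a p)) * (n0 p + cnj (pz f p))"

text \<open>The 1-form da, by \<open>a_differential\<close>; it is the multiple
  \<open>cnj (al p)\<close> of \<open>omega1\<close>.\<close>

definition \<theta> :: "point \<Rightarrow> point \<Rightarrow> complex" where
  "\<theta> p X = pz a p * (fst X - q p * of_real (fst (snd X)))"

lemma m_hs: "hol_smooth_on m M"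
  unfolding m_def[abs_def] by (intro hol_smooth_intros open_M a_hs az)

lemma q_hs: "hol_smooth_on q M"
  unfolding q_def[abs_def] by (intro hol_smooth_intros open_M a_hs az)

lemma n0_hs: "hol_smooth_on n0 M"
  unfolding n0_def[abs_def] by (intro hol_smooth_intros open_M q_hs)

lemma \<kappa>_hs: "hol_smooth_on \<kappa> M"
  unfolding \<kappa>_def[abs_def] by (intro hol_smooth_intros open_M m_hs)

text \<open>The order matters: entries 1 to 6 are the functions, 7 to 16 their first partial
  derivatives, and later proofs pick entries of \<open>hs\<close> and \<open>zd\<close> by
  position.\<close>

lemmas hs = m_hs q_hs n0_hs \<kappa>_hs f_hs a_hs
  m_hs[THEN hol_smooth_on_partials(1)[OF _ open_M]] m_hs[THEN hol_smooth_on_partials(2)[OF _ open_M]]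
  q_hs[THEN hol_smooth_on_partials(1)[OF _ open_M]] q_hs[THEN hol_smooth_on_partials(2)[OF _ open_M]]
  n0_hs[THEN hol_smooth_on_partials(1)[OF _ open_M]] n0_hs[THEN hol_smooth_on_partials(2)[OF _ open_M]]
  a_hs[THEN hol_smooth_on_partials(1)[OF _ open_M]] a_hs[THEN hol_smooth_on_partials(2)[OF _ open_M]]
  f_hs[THEN hol_smooth_on_partials(1)[OF _ open_M]] f_hs[THEN hol_smooth_on_partials(2)[OF _ open_M]]

lemmas hs2 = hs hs(7-)[THEN hol_smooth_on_partials(1)[OF _ open_M]]
  hs(7-)[THEN hol_smooth_on_partials(2)[OF _ open_M]]

lemmas zd = hs2[THEN hol_smooth_on_zu_diff]

lemma pu_a: "p \<in> M \<Longrightarrow> pu a p = - q p * pz a p"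
  using az by (simp add: q_def)

lemma pz_m: "p \<in> M \<Longrightarrow> pz m p = - pz (pz a) p / (pz a p)\<^sup>2"
  unfolding m_def[abs_def] by (subst zu_divide) (simp_all add: zu_simps zd az)

lemma pu_m': "p \<in> M \<Longrightarrow> pu m p = - pu (pz a) p / (pz a p)\<^sup>2"
  unfolding m_def[abs_def] by (subst zu_divide) (simp_all add: zu_simps zd az)

lemma pu_pz_a:
  assumes p: "p \<in> M"
  shows "pu (pz a) p = - pz q p * pz a p - q p * pz (pz a) p"
proof -
  have "pu (pz a) p = pz (pu a) p"
    using hol_smooth_on_partials(3)[OF a_hs open_M p] by simp
  also have "\<dots> = pz (\<lambda>p. - q p * pz a p) p"
    by (rule partials_cong[OF _ open_M _ p]) (simp_all add: hs pu_a)
  also have "\<dots> = - pz q p * pz a p - q p * pz (pz a) p"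
    by (simp add: zu_simps zd p)
  finally show ?thesis .
qed

text \<open>Says that the coordinate fields \<open>m \<partial>\<^sub>\<zeta>\<close> and
  \<open>\<partial>\<^sub>u + q \<partial>\<^sub>\<zeta>\<close> of the chart (a, u)
  commute.\<close>

lemma pu_m: "p \<in> M \<Longrightarrow> pu m p = pz q p * m p - q p * pz m p"
  using az[of p] by (simp add: pu_m' pz_m pu_pz_a m_def field_simps power2_eq_square)

lemma pz_\<kappa>: "p \<in> M \<Longrightarrow> pz \<kappa> p = pz (pz m) p"
  unfolding \<kappa>_def[abs_def] by (simp add: zu_simps zd)

lemma pu_pz_m:
  assumes p: "p \<in> M"
  shows "pu (pz m) p = pz (pz q) p * m p - q p * pz (pz m) p"
proof -
  have "pu (pz m) p = pz (pu m) p"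
    using hol_smooth_on_partials(3)[OF m_hs open_M p] by simp
  also have "\<dots> = pz (\<lambda>p. pz q p * m p - q p * pz m p) p"
    by (rule partials_cong[OF _ open_M _ p]) (simp_all add: hs pu_m)
  also have "\<dots> = pz (pz q) p * m p - q p * pz (pz m) p"
    by (simp add: zu_simps zd p)
  finally show ?thesis .
qed

text \<open>The equality of the mixed derivatives of \<open>L\<close> in the chart (a, u), as
  \<kappa> is \<open>1 + L_a\<close> and \<open>pz q\<close> is \<open>L_u\<close>.\<close>

lemma pu_\<kappa>: "p \<in> M \<Longrightarrow> pu \<kappa> p = pz (pz q) p * m p - q p * pz \<kappa> p"
  using pu_pz_m[of p] pz_\<kappa>[of p] unfolding \<kappa>_def[abs_def] by (simp add: zu_simps zd)

lemma fzzz: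
  assumes p: "p \<in> M"
  shows "pz (pz (pz f)) p = 4 * pz a p * pz (pz f) p" "pu (pz (pz f)) p = 4 * pu a p * pz (pz f) p"
proof -
  have "pz (pz (pz f)) p = pz (\<lambda>p. exp (4 * a p)) p" "pu (pz (pz f)) p = pu (\<lambda>p. exp (4 * a p)) p"
    by (rule partials_cong[OF _ open_M _ p]; simp add: hs2 fzz)+
  then show "pz (pz (pz f)) p = 4 * pz a p * pz (pz f) p" "pu (pz (pz f)) p = 4 * pu a p * pz (pz f) p"
    by (simp_all add: zu_simps zd p fzz)
qed

section \<open>The differentials of a, \<alpha>, \<mu> and \<nu>\<close>

lemma a_differential:
  assumes "p \<in> M"
  shows "pz a p * fst X + pu a p * of_real (fst (snd X)) = \<theta> p X"
  using assms by (simp add: \<theta>_def pu_a algebra_simps)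

text \<open>\<open>pz a\<close> is \<open>exp (- L)\<close>, so its logarithmic differential is -dL,
  where \<open>L_a\<close> is \<open>\<kappa> - 1\<close> and \<open>L_u\<close> is
  \<open>pz q\<close>.\<close>

lemma pz_a_differential:
  assumes p: "p \<in> M"
  shows "pz (pz a) p * fst X + pu (pz a) p * of_real (fst (snd X)) =
    pz a p * ((1 - \<kappa> p) * \<theta> p X - pz q p * of_real (fst (snd X)))"
  using az[OF p] by (simp add: \<theta>_def \<kappa>_def pz_m pu_pz_a p field_simps power2_eq_square)

text \<open>Logarithmic differentiation: minus the conjugate of da, from the exponential, cancels
  against a term in the differential of \<open>cnj (pz a)\<close>, and only the part with \<kappa>
  is left.\<close>

lemma al_differential:
  assumes p: "p \<in> M"
  shows "(al has_derivative (\<lambda>X. al p * (\<theta> p X - cnj (\<kappa> p * \<theta> p X) - cnj (pz q p) * of_real (fst (snd X))))) (at p)"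
proof -
  have "(al has_derivative (\<lambda>X. exp (a p - cnj (a p)) *
      cnj (pz (pz a) p * fst X + pu (pz a) p * of_real (fst (snd X)))
      + (exp (a p - cnj (a p)) * ((pz a p * fst X + pu a p * of_real (fst (snd X)))
         - cnj (pz a p * fst X + pu a p * of_real (fst (snd X))))) * cnj (pz a p))) (at p)"
    unfolding al_def[abs_def]
    by (intro has_derivative_mult has_derivative_cnj has_derivative_diff zu_diff_has_derivative zd p
        has_derivative_compose[OF _ DERIV_exp[unfolded has_field_derivative_def]])
  then show ?thesis
    unfolding a_differential[OF p] pz_a_differential[OF p]
    by (rule has_derivative_eq_rhs) (simp add: fun_eq_iff al_def algebra_simps)
qed

lemma mu_differential:
  assumes p: "p \<in> M"
  shows "(mu has_derivative (\<lambda>X. exp (- a p - cnj (a p)) *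
     (- pz q p * (\<theta> p X + cnj (\<theta> p X)) + pz (pz q) p * fst X + pu (pz q) p * of_real (fst (snd X))))) (at p)"
proof -
  have "(mu has_derivative (\<lambda>X. exp (- a p - cnj (a p)) *
      (pz (pz q) p * fst X + pu (pz q) p * of_real (fst (snd X)))
      + (exp (- a p - cnj (a p)) * (- (pz a p * fst X + pu a p * of_real (fst (snd X)))
         - cnj (pz a p * fst X + pu a p * of_real (fst (snd X))))) * pz q p)) (at p)"
    unfolding mu_def[abs_def]
    by (intro has_derivative_mult has_derivative_cnj has_derivative_diff has_derivative_minus
        zu_diff_has_derivative zd p
        has_derivative_compose[OF _ DERIV_exp[unfolded has_field_derivative_def]])
  then show ?thesis
    unfolding a_differential[OF p]
    by (rule has_derivative_eq_rhs) (simp add: fun_eq_iff algebra_simps)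
qed

lemma nu_differential:
  assumes p: "p \<in> M"
  shows "(nu has_derivative (\<lambda>X. exp (- a p - 3 * cnj (a p)) *
     (- (\<theta> p X + 3 * cnj (\<theta> p X)) * (n0 p + cnj (pz f p))
      + (pz n0 p * fst X + pu n0 p * of_real (fst (snd X)))
      + cnj (pz (pz f) p * fst X + pu (pz f) p * of_real (fst (snd X)))))) (at p)"
proof -
  have "(nu has_derivative (\<lambda>X. exp (- a p - 3 * cnj (a p)) *
      ((pz n0 p * fst X + pu n0 p * of_real (fst (snd X)))
        + cnj (pz (pz f) p * fst X + pu (pz f) p * of_real (fst (snd X))))
      + (exp (- a p - 3 * cnj (a p)) * (- (pz a p * fst X + pu a p * of_real (fst (snd X)))
         - 3 * cnj (pz a p * fst X + pu a p * of_real (fst (snd X))))) * (n0 p + cnj (pz f p)))) (at p)"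
    unfolding nu_def[abs_def]
    by (intro has_derivative_mult has_derivative_mult_right has_derivative_cnj has_derivative_diff
        has_derivative_minus has_derivative_add zu_diff_has_derivative zd p
        has_derivative_compose[OF _ DERIV_exp[unfolded has_field_derivative_def]])
  then show ?thesis
    unfolding a_differential[OF p]
    by (rule has_derivative_eq_rhs) (simp add: fun_eq_iff algebra_simps)
qed

lemma differentials:
  assumes p: "p \<in> M"
  shows "differential al p X = al p * (\<theta> p X - cnj (\<kappa> p * \<theta> p X) - cnj (pz q p) * of_real (fst (snd X)))"
    "differential mu p X = exp (- a p - cnj (a p)) *
     (- pz q p * (\<theta> p X + cnj (\<theta> p X)) + pz (pz q) p * fst X + pu (pz q) p * of_real (fst (snd X)))"
    "differential nu p X = exp (- a p - 3 * cnj (a p)) *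
     (- (\<theta> p X + 3 * cnj (\<theta> p X)) * (n0 p + cnj (pz f p))
      + (pz n0 p * fst X + pu n0 p * of_real (fst (snd X)))
      + cnj (pz (pz f) p * fst X + pu (pz f) p * of_real (fst (snd X))))"
    "differential (\<lambda>p. cnj (al p)) p X = cnj (differential al p X)"
proof -
  note d = frechet_derivative_at[OF al_differential[OF p], symmetric]
    frechet_derivative_at[OF mu_differential[OF p], symmetric]
    frechet_derivative_at[OF nu_differential[OF p], symmetric]
    frechet_derivative_at[OF has_derivative_cnj[OF al_differential[OF p]], symmetric]
  show "differential al p X = al p * (\<theta> p X - cnj (\<kappa> p * \<theta> p X) - cnj (pz q p) * of_real (fst (snd X)))"
    "differential mu p X = exp (- a p - cnj (a p)) *
     (- pz q p * (\<theta> p X + cnj (\<theta> p X)) + pz (pz q) p * fst X + pu (pz q) p * of_real (fst (snd X)))"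
    "differential nu p X = exp (- a p - 3 * cnj (a p)) *
     (- (\<theta> p X + 3 * cnj (\<theta> p X)) * (n0 p + cnj (pz f p))
      + (pz n0 p * fst X + pu n0 p * of_real (fst (snd X)))
      + cnj (pz (pz f) p * fst X + pu (pz f) p * of_real (fst (snd X))))"
    "differential (\<lambda>p. cnj (al p)) p X = cnj (differential al p X)"
    unfolding differential_def d by (rule refl)+
qed

lemma al_nonzero: "p \<in> M \<Longrightarrow> al p \<noteq> 0"
  using az by (simp add: al_def)

end

section \<open>Consequences of \<open>d\<alpha> \<and> d\<alpha>\<^sup>* = 0\<close>\<close>

lemma mult_eqI: "(k::'a::idom) \<noteq> 0 \<Longrightarrow> k * x = k * y \<Longrightarrow> x = y" by simp

locale pp_dependent = pp_frame +
  assumes dep: "\<And>p. p \<in> M \<Longrightarrow>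
      wedge2 (differential al p) (differential (\<lambda>q. cnj (al q)) p) = (\<lambda>X Y. 0)"
begin

text \<open>\<open>P\<close> is the logarithmic differential of \<alpha>. The 2-form built from
  \<open>P\<close> and its conjugate vanishes, and it is evaluated on the pairs of three test
  vectors.\<close>

lemma \<kappa>_c_constraints:
  assumes p: "p \<in> M"
  shows "\<kappa> p * cnj (\<kappa> p) = 1" "cnj (pz q p) = - cnj (\<kappa> p) * pz q p"
proof -
  define P where "P X = \<theta> p X - cnj (\<kappa> p * \<theta> p X) - cnj (pz q p) * of_real (fst (snd X))" for X
  have "P X * cnj (P Y) - P Y * cnj (P X) = 0" for X Y
  proof -
    have "(al p * cnj (al p)) * (P X * cnj (P Y) - P Y * cnj (P X)) = 0"
      using fun_cong[OF fun_cong[OF dep[OF p], of X], of Y]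
      by (simp add: wedge2_def differentials[OF p] P_def algebra_simps)
    then show ?thesis using al_nonzero[OF p] by simp
  qed
  note W = this
  \<comment> \<open>On these vectors \<open>\<theta> p\<close> takes the values 1, \<i>, 0 and du
    the values 0, 0, 1.\<close>
  have P: "P (m p, 0, 0) = 1 - cnj (\<kappa> p)" "P (\<i> * m p, 0, 0) = \<i> * (1 + cnj (\<kappa> p))"
    "P (q p, 1, 0) = - cnj (pz q p)"
    using az[OF p] by (simp_all add: P_def \<theta>_def m_def algebra_simps)
  from W[of "(m p, 0, 0)" "(\<i> * m p, 0, 0)"]
  have "(- 2 * \<i>) * (\<kappa> p * cnj (\<kappa> p)) = (- 2 * \<i>) * 1"
    unfolding P by (simp add: algebra_simps)
  then show "\<kappa> p * cnj (\<kappa> p) = 1" by (rule mult_eqI[rotated]) simp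
  from W[of "(m p, 0, 0)" "(q p, 1, 0)"]
  have 1: "(1 - \<kappa> p) * cnj (pz q p) = (1 - cnj (\<kappa> p)) * pz q p"
    unfolding P by (simp add: algebra_simps)
  from W[of "(\<i> * m p, 0, 0)" "(q p, 1, 0)"]
  have "\<i> * ((1 + \<kappa> p) * cnj (pz q p)) = \<i> * (- (1 + cnj (\<kappa> p)) * pz q p)"
    unfolding P by (simp add: algebra_simps add_eq_0_iff)
  then have 2: "(1 + \<kappa> p) * cnj (pz q p) = - (1 + cnj (\<kappa> p)) * pz q p"
    by (rule mult_eqI[rotated]) simp
  \<comment> \<open>The sum of both relations eliminates \<kappa> on the left and 1 on the
    right.\<close>
  have "2 * cnj (pz q p) = 2 * (- cnj (\<kappa> p) * pz q p)"
    using 1 2 by algebra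
  then show "cnj (pz q p) = - cnj (\<kappa> p) * pz q p" by (rule mult_eqI[rotated]) simp
qed

lemma \<kappa>_nonzero: "p \<in> M \<Longrightarrow> \<kappa> p \<noteq> 0"
  using \<kappa>_c_constraints(1)[of p] by auto

lemma cnj_\<kappa>: "p \<in> M \<Longrightarrow> cnj (\<kappa> p) = 1 / \<kappa> p"
  using \<kappa>_c_constraints(1)[of p] \<kappa>_nonzero[of p] by (simp add: field_simps)

text \<open>Both constraints express the conjugate of a holomorphic function by holomorphic ones, so
  \<open>pz_zero_if_add_cnj_zero\<close> applies to \<kappa> and to \<open>pz q\<close>. The
  \<open>u\<close>-derivative of \<kappa> then vanishes by the compatibility relation
  \<open>pu_\<kappa>\<close>.\<close>

lemma partials_zero:
  assumes p: "p \<in> M"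
  shows "pz \<kappa> p = 0" "pu \<kappa> p = 0" "pz (pz q) p = 0" "pz (pz m) p = 0" "pu (pz m) p = 0"
    "pz (pu (pz q)) p = 0"
proof -
  show \<kappa>: "pz \<kappa> p = 0"
    by (rule pz_zero_if_add_cnj_zero(2)[OF open_M p, of "\<lambda>p. - (1 / \<kappa> p)"])
      (simp_all add: cnj_\<kappa> zu_simps zd p \<kappa>_nonzero)
  have c: "pz (pz q) p = 0" if "p \<in> M" for p
    by (rule pz_zero_if_add_cnj_zero(2)[OF open_M that, of "\<lambda>p. pz q p / \<kappa> p"])
      (simp_all add: \<kappa>_c_constraints(2) cnj_\<kappa> zu_simps zd that \<kappa>_nonzero)
  show "pz (pz q) p = 0" by (rule c[OF p])
  show "pu \<kappa> p = 0" using \<kappa> c[OF p] pu_\<kappa>[OF p] by simp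
  show "pz (pz m) p = 0" using \<kappa> pz_\<kappa>[OF p] by simp
  then show "pu (pz m) p = 0" using c[OF p] pu_pz_m[OF p] by simp
  have "pz (pu (pz q)) p = pu (pz (pz q)) p"
    by (rule hol_smooth_on_partials(3)[OF _ open_M p]) (simp add: hs)
  also have "\<dots> = pu (\<lambda>p. 0) p"
    by (rule partials_cong[OF _ open_M _ p]) (simp_all add: hs2 c)
  finally show "pz (pu (pz q)) p = 0" by (simp add: zu_simps)
qed

lemma pz_pu_q: "p \<in> M \<Longrightarrow> pz (pu q) p = pu (pz q) p"
  by (rule hol_smooth_on_partials(3)[OF q_hs open_M])

lemma n0_partials:
  assumes p: "p \<in> M"
  shows "pz n0 p = pu (pz q) p + pz q p * pz q p"
    "pu n0 p = pu (pu q) p + pu q p * pz q p + q p * pu (pz q) p"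
  unfolding n0_def[abs_def] by (simp_all add: zu_simps zd p partials_zero pz_pu_q)

lemma n0_second_partials:
  assumes p: "p \<in> M"
  shows "pz (pz n0) p = 0" "pz (pu n0) p = pu (pu (pz q)) p + 2 * pz q p * pu (pz q) p"
proof -
  have *: "pz (pz n0) p = pz (\<lambda>p. pu (pz q) p + pz q p * pz q p) p"
    "pu (pz n0) p = pu (\<lambda>p. pu (pz q) p + pz q p * pz q p) p"
    by (rule partials_cong[OF _ open_M _ p]; simp add: hs n0_partials)+
  show "pz (pz n0) p = 0" unfolding * by (simp add: zu_simps zd p partials_zero)
  have "pz (pu n0) p = pu (pz n0) p"
    by (rule hol_smooth_on_partials(3)[OF n0_hs open_M p])
  also have "\<dots> = pu (pu (pz q)) p + 2 * pz q p * pu (pz q) p"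
    unfolding * by (simp add: zu_simps zd p)
  finally show "pz (pu n0) p = pu (pu (pz q)) p + 2 * pz q p * pu (pz q) p" .
qed

end

text \<open>The form of a Killing field \<open>(A, \<xi>, h)\<close>; \<open>\<sigma>\<close> is the derivative of \<open>a\<close> along it.\<close>

locale killing_data = pp_dependent +
  fixes B :: "point set" and A \<xi> :: "point \<Rightarrow> complex" and \<sigma> :: complex
  assumes B: "open B" "B \<subseteq> M" and A_hs: "hol_smooth_on A B" and \<xi>_hs: "hol_smooth_on \<xi> B"
    and \<xi>_real: "\<And>p. p \<in> B \<Longrightarrow> cnj (\<xi> p) = \<xi> p"
    and A_eq: "\<And>p. p \<in> B \<Longrightarrow> A p = m p * \<sigma> + q p * \<xi> p"
    and pz_A: "\<And>p. p \<in> B \<Longrightarrow> pz A p = cnj \<sigma> - \<sigma>"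
    and pz_\<xi>: "\<And>p. p \<in> B \<Longrightarrow> pz \<xi> p = 0"
    and pu_\<xi>: "\<And>p. p \<in> B \<Longrightarrow> pu \<xi> p = - (\<sigma> + cnj \<sigma>)"
begin

lemma BM: "p \<in> B \<Longrightarrow> p \<in> M" using B by blast

lemmas zdB = zd[OF BM] hol_smooth_on_zu_diff[OF A_hs] hol_smooth_on_zu_diff[OF \<xi>_hs]
  hol_smooth_on_zu_diff[OF hol_smooth_on_partials(1)[OF A_hs B(1)]]
  hol_smooth_on_zu_diff[OF hol_smooth_on_partials(2)[OF A_hs B(1)]]

lemma hsB: "hol_smooth_on G M \<Longrightarrow> hol_smooth_on G B"
  using B hol_smooth_on_subset by blast

text \<open>Compares \<open>pz_A\<close> with the derivative of \<open>A_eq\<close>. Its conjugate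
  says that the field annihilates \<alpha>.\<close>

lemma \<kappa>_equation:
  assumes p: "p \<in> B"
  shows "\<kappa> p * \<sigma> + pz q p * \<xi> p = cnj \<sigma>"
proof -
  have "pz A p = pz (\<lambda>p. m p * \<sigma> + q p * \<xi> p) p"
    by (rule partials_cong[OF A_hs B(1) _ p]) (simp add: A_eq)
  also have "\<dots> = pz m p * \<sigma> + pz q p * \<xi> p"
    by (simp add: zu_simps zdB p pz_\<xi>)
  finally show ?thesis using pz_A[OF p] by (simp add: \<kappa>_def algebra_simps)
qed

text \<open>The \<open>u\<close>-derivative of \<open>\<kappa>_equation\<close>, in which \<kappa>
  and \<sigma> are constant; it says that the field annihilates \<mu>.\<close>

lemma c_equation:
  assumes p: "p \<in> B"
  shows "pu (pz q) p * \<xi> p = pz q p * (\<sigma> + cnj \<sigma>)"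
proof -
  have "pu (\<lambda>p. \<kappa> p * \<sigma> + pz q p * \<xi> p) p = pu (\<lambda>p. cnj \<sigma>) p"
    by (rule partials_cong[OF _ B(1) _ p])
      (simp_all add: \<kappa>_equation hol_smooth_intros B hsB hs \<xi>_hs)
  then show ?thesis
    by (simp add: zu_simps zdB p pu_\<xi> partials_zero BM algebra_simps)
qed

lemma pu_A:
  assumes p: "p \<in> B"
  shows "pu A p = (pz q p * m p - q p * pz m p) * \<sigma> + pu q p * \<xi> p - q p * (\<sigma> + cnj \<sigma>)"
proof -
  have "pu A p = pu (\<lambda>p. m p * \<sigma> + q p * \<xi> p) p"
    by (rule partials_cong[OF A_hs B(1) _ p]) (simp add: A_eq)
  then show ?thesis
    by (simp add: zu_simps zdB p pu_\<xi> pu_m BM algebra_simps)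
qed

text \<open>Brings the second derivative into the form in which \<open>n0\<close> enters the
  differential of \<nu>, so that \<open>invariants_killed\<close> can express that differential
  through \<open>pu (pu A)\<close>.\<close>

lemma pu_pu_A:
  assumes p: "p \<in> B"
  shows "pu (pu A) p = pz n0 p * A p + pu n0 p * \<xi> p - (\<sigma> + 3 * cnj \<sigma>) * n0 p"
proof -
  have "pu (pu A) p = pu (\<lambda>p. (pz q p * m p - q p * pz m p) * \<sigma> + pu q p * \<xi> p - q p * (\<sigma> + cnj \<sigma>)) p"
    by (rule partials_cong[OF hol_smooth_on_partials(2)[OF A_hs B(1)] B(1) _ p]) (simp add: pu_A)
  also have "\<dots> = (pu (pz q) p * m p + pz q p * (pz q p * m p - q p * pz m p) - pu q p * pz m p) * \<sigma>
      + pu (pu q) p * \<xi> p - 2 * pu q p * (\<sigma> + cnj \<sigma>)"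
    by (simp add: zu_simps zdB p pu_\<xi> pu_m BM partials_zero algebra_simps)
  also have "\<dots> = pz n0 p * A p + pu n0 p * \<xi> p - (\<sigma> + 3 * cnj \<sigma>) * n0 p"
  proof -
    have k: "pz m p = \<kappa> p - 1" by (simp add: \<kappa>_def)
    \<comment> \<open>The two sides, with all functions abbreviated by complex numbers, differ by a
      combination of \<open>\<kappa>_equation\<close> and \<open>c_equation\<close>.\<close>
    have "(c1 * m + c * (c * m - q * (k - 1)) - q1 * (k - 1)) * s + q2 * x - 2 * q1 * (s + s')
        = (c1 + c * c) * (m * s + q * x) + (q2 + q1 * c + q * c1) * x - (s + 3 * s') * (q1 + q * c)"
      (is "?L = ?R")
      if "k * s + c * x = s'" "c1 * x = c * (s + s')" for c c1 q q1 q2 m k s s' x :: complex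
    proof -
      have "?L - ?R = - (c * q + q1) * (k * s + c * x - s') - 2 * q * (c1 * x - c * (s + s'))"
        by (simp add: algebra_simps)
      then show ?thesis by (simp add: that)
    qed
    from this[OF \<kappa>_equation[OF p] c_equation[OF p]] show ?thesis
      unfolding n0_partials[OF BM[OF p]] A_eq[OF p] k n0_def .
  qed
  finally show ?thesis .
qed

lemma of_real_\<xi>: "p \<in> B \<Longrightarrow> of_real (Re (\<xi> p)) = \<xi> p"
  using \<xi>_real[of p] by (simp add: complex_eq_iff)

lemma \<theta>_A: "p \<in> B \<Longrightarrow> \<theta> p (A p, Re (\<xi> p), h) = \<sigma>"
  using az[OF BM, of p] by (simp add: \<theta>_def A_eq m_def of_real_\<xi>)

text \<open>For \<alpha> and \<mu> these are the two equations above. For \<nu> the remaining factor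
  is the integrability condition for the component \<open>h\<close>, the equation required in
  \<open>exists_killing\<close>.\<close>

lemma invariants_killed:
  assumes p: "p \<in> B"
  shows "differential al p (A p, Re (\<xi> p), h) = 0" "differential mu p (A p, Re (\<xi> p), h) = 0"
    "differential nu p (A p, Re (\<xi> p), h) = exp (- a p - 3 * cnj (a p)) *
       cnj (pz (pz f) p * A p + pu (pz f) p * \<xi> p - (cnj \<sigma> + 3 * \<sigma>) * pz f p + cnj (pu (pu A) p))"
proof -
  have "cnj (\<kappa> p * \<sigma>) + cnj (pz q p) * \<xi> p = \<sigma>"
    using arg_cong[OF \<kappa>_equation[OF p], of cnj] \<xi>_real[OF p] by simp
  then have "\<sigma> - cnj (\<kappa> p * \<sigma>) - cnj (pz q p) * \<xi> p = 0"
    by (simp add: algebra_simps)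
  then show "differential al p (A p, Re (\<xi> p), h) = 0"
    by (simp add: differentials BM p \<theta>_A of_real_\<xi>)
  show "differential mu p (A p, Re (\<xi> p), h) = 0"
    using c_equation[OF p]
    by (simp add: differentials BM p \<theta>_A of_real_\<xi> partials_zero algebra_simps)
  show "differential nu p (A p, Re (\<xi> p), h) = exp (- a p - 3 * cnj (a p)) *
       cnj (pz (pz f) p * A p + pu (pz f) p * \<xi> p - (cnj \<sigma> + 3 * \<sigma>) * pz f p + cnj (pu (pu A) p))"
    by (simp add: differentials BM p \<theta>_A of_real_\<xi> pu_pu_A algebra_simps)
qed

end

section \<open>Killing fields of a pp-wave\<close>

text \<open>Directional derivatives of real functions, because the Killing equations are real;
  \<open>e1\<close> and \<open>e2\<close> below are the real and imaginary directions of
  \<zeta>.\<close>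

definition dd :: "point \<Rightarrow> (point \<Rightarrow> real) \<Rightarrow> point \<Rightarrow> real" where
  "dd v G p = frechet_derivative G (at p) v"

abbreviation e1 :: point where "e1 \<equiv> (1, 0, 0)"
abbreviation e2 :: point where "e2 \<equiv> (\<i>, 0, 0)"
abbreviation e3 :: point where "e3 \<equiv> (0, 1, 0)"
abbreviation e4 :: point where "e4 \<equiv> (0, 0, 1)"

lemma has_derivative_dd: "(G has_derivative D) (at p) \<Longrightarrow> dd v G p = D v"
  unfolding dd_def by (metis frechet_derivative_at)

lemma smooth_on_dd: "smooth_on G S \<Longrightarrow> smooth_on (dd v G) S"
  unfolding dd_def[abs_def] by (rule smooth_on_frechet_derivative)

lemma dd_commute: "smooth_on G S \<Longrightarrow> open S \<Longrightarrow> p \<in> S \<Longrightarrow> dd v (dd w G) p = dd w (dd v G) p"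
  unfolding dd_def[abs_def] by (rule second_derivative_commute)

lemma dd_cong:
  assumes "open S" "smooth_on G S" "\<And>q. q \<in> S \<Longrightarrow> G q = H q" "p \<in> S"
  shows "dd v G p = dd v H p"
proof -
  have "(H has_derivative frechet_derivative G (at p)) (at p)"
    by (rule has_derivative_transform_within_open[OF smooth_on_has_derivative[OF assms(2,4)] assms(1,4,3)])
  from has_derivative_dd[OF this] show ?thesis by (simp add: dd_def)
qed

lemma dd_const: "dd v (\<lambda>p. c) p = 0"
  by (simp add: dd_def frechet_derivative_const)

lemma dd_arith:
  assumes "F differentiable (at p)" "G differentiable (at p)"
  shows "dd v (\<lambda>p. F p + G p) p = dd v F p + dd v G p"
    "dd v (\<lambda>p. F p - G p) p = dd v F p - dd v G p"
    "dd v (\<lambda>p. F p * G p) p = F p * dd v G p + dd v F p * G p"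
  using assms[unfolded frechet_derivative_works]
  by (auto simp: dd_def[of v F] dd_def[of v G] intro!: has_derivative_dd derivative_eq_intros)

lemma dd_minus: "F differentiable (at p) \<Longrightarrow> dd v (\<lambda>p. - F p) p = - dd v F p"
  unfolding frechet_derivative_works
  by (auto simp: dd_def[of v F] intro!: has_derivative_dd derivative_eq_intros)

lemma dd_cmult: "F differentiable (at p) \<Longrightarrow> dd v (\<lambda>p. c * F p) p = c * dd v F p"
  unfolding frechet_derivative_works
  by (auto simp: dd_def[of v F] intro!: has_derivative_dd derivative_eq_intros)

lemma dd_basis:
  assumes "G differentiable (at p)"
  shows "frechet_derivative G (at p) (x, t, s) =
    Re x * dd e1 G p + Im x * dd e2 G p + t * dd e3 G p + s * dd e4 G p"
proof -
  have "linear (frechet_derivative G (at p))"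
    by (rule linear_frechet_derivative[OF assms])
  moreover have "(x, t, s) = Re x *\<^sub>R e1 + Im x *\<^sub>R e2 + t *\<^sub>R e3 + s *\<^sub>R e4"
    by (simp add: complex_eq_iff)
  ultimately show ?thesis
    by (simp only: linear_add linear_scale dd_def real_scaleR_def)
qed

lemma dd_zu:
  assumes "zu_diff g p"
  shows "dd v (\<lambda>p. Re (g p)) p = Re (pz g p * fst v + pu g p * of_real (fst (snd v)))"
    "dd v (\<lambda>p. Im (g p)) p = Im (pz g p * fst v + pu g p * of_real (fst (snd v)))"
    "(\<lambda>p. Re (g p)) differentiable (at p)" "(\<lambda>p. Im (g p)) differentiable (at p)"
proof -
  note D = bounded_linear.has_derivative[OF bounded_linear_Re zu_diff_has_derivative[OF assms]]
    bounded_linear.has_derivative[OF bounded_linear_Im zu_diff_has_derivative[OF assms]]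
  show "dd v (\<lambda>p. Re (g p)) p = Re (pz g p * fst v + pu g p * of_real (fst (snd v)))"
    "dd v (\<lambda>p. Im (g p)) p = Im (pz g p * fst v + pu g p * of_real (fst (snd v)))"
    by (rule has_derivative_dd[OF D(1)] has_derivative_dd[OF D(2)])+
  show "(\<lambda>p. Re (g p)) differentiable (at p)" "(\<lambda>p. Im (g p)) differentiable (at p)"
    using D differentiable_def by blast+
qed

lemma zero_dd_const:
  fixes G :: "point \<Rightarrow> real"
  assumes "open S" "connected S" "smooth_on G S" "p \<in> S" "q \<in> S"
    "\<And>p. p \<in> S \<Longrightarrow> dd e1 G p = 0 \<and> dd e2 G p = 0 \<and> dd e3 G p = 0 \<and> dd e4 G p = 0"
  shows "G p = G q"
proof -
  have "(G has_derivative (\<lambda>X. 0)) (at x)" if "x \<in> S" for x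
  proof (rule has_derivative_eq_rhs[OF smooth_on_has_derivative[OF assms(3) that]], intro ext)
    fix X :: point
    show "frechet_derivative G (at x) X = 0"
      using dd_basis[OF smooth_on_differentiable[OF assms(3) that], of "fst X" "fst (snd X)" "snd (snd X)"]
        assms(6)[OF that] by simp
  qed
  then show ?thesis
    by (rule has_derivative_zero_unique_connected[OF assms(1,2) _ assms(4,5)])
qed

lemma lie_derivative_pp_metric:
  assumes F: "zu_diff (lift F) p"
    and X: "(A has_derivative DA) (at p)" "(\<xi> has_derivative D\<xi>) (at p)" "(h has_derivative Dh) (at p)"
  shows "lie_derivative_metric (pp_metric F) (\<lambda>p. (A p, \<xi> p, h p)) p (y1, y2, y3) (w1, w2, w3) =
     - 4 * Re (pz (lift F) p * A p + pu (lift F) p * of_real (\<xi> p)) * y2 * w2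
     + (2 * Re (DA (y1, y2, y3) * cnj w1) - (D\<xi> (y1, y2, y3) * w3 + Dh (y1, y2, y3) * w2)
        - 4 * Re (lift F p) * D\<xi> (y1, y2, y3) * w2)
     + (2 * Re (y1 * cnj (DA (w1, w2, w3))) - (y2 * Dh (w1, w2, w3) + y3 * D\<xi> (w1, w2, w3))
        - 4 * Re (lift F p) * y2 * D\<xi> (w1, w2, w3))"
proof -
  have g: "pp_metric F q (x1, x2, x3) (z1, z2, z3) =
      (2 * Re (x1 * cnj z1) - (x2 * z3 + x3 * z2)) + (- 4 * x2 * z2) * Re (lift F q)" for q x1 x2 x3 z1 z2 z3
    by (cases q) simp
  have "((\<lambda>q. pp_metric F q (y1, y2, y3) (w1, w2, w3)) has_derivative
      (\<lambda>V. - 4 * Re (pz (lift F) p * fst V + pu (lift F) p * of_real (fst (snd V))) * y2 * w2)) (at p)"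
    unfolding g
    by (rule has_derivative_eq_rhs[OF has_derivative_add[OF has_derivative_const has_derivative_mult_right[OF
          bounded_linear.has_derivative[OF bounded_linear_Re zu_diff_has_derivative[OF F]]]]])
      (simp add: fun_eq_iff algebra_simps)
  note 1 = frechet_derivative_at[OF this, symmetric]
  have "((\<lambda>p. (A p, \<xi> p, h p)) has_derivative (\<lambda>V. (DA V, D\<xi> V, Dh V))) (at p)"
    by (intro has_derivative_Pair X)
  note 2 = frechet_derivative_at[OF this, symmetric]
  show ?thesis
    unfolding lie_derivative_metric_def 1 2 unfolding g by (simp add: algebra_simps)
qed

section \<open>The Killing equations and their integrability conditions\<close>

context pp_frame
begin

text \<open>The Killing equation is symmetric in its two vectors, so the ten pairs of basis vectors
  \<open>e1\<close>, \<open>e2\<close>, \<open>e3\<close>, \<open>e4\<close> exhaust it.\<close>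

lemma killing_components:
  assumes K: "killing_on (pp_metric F) B (\<lambda>p. (Complex (P p) (Q p), x p, h p))"
    and B: "B \<subseteq> M" and p: "p \<in> B"
    and sm: "smooth_on P B" "smooth_on Q B" "smooth_on x B" "smooth_on h B"
  shows "dd e4 x p = 0" "2 * dd e4 P p = dd e1 x p" "2 * dd e4 Q p = dd e2 x p"
    "dd e4 h p = - dd e3 x p"
    "dd e1 P p = 0" "dd e2 Q p = 0" "dd e2 P p = - dd e1 Q p"
    "dd e1 h p = 2 * dd e3 P p - 4 * Re (f p) * dd e1 x p"
    "dd e2 h p = 2 * dd e3 Q p - 4 * Re (f p) * dd e2 x p"
    "dd e3 h p = - 2 * (Re (pz f p) * P p - Im (pz f p) * Q p + Re (pu f p) * x p)
       - 4 * Re (f p) * dd e3 x p"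
proof -
  note D = smooth_on_has_derivative[OF sm(1) p] smooth_on_has_derivative[OF sm(2) p]
    smooth_on_has_derivative[OF sm(3) p] smooth_on_has_derivative[OF sm(4) p]
  have A: "((\<lambda>p. Complex (P p) (Q p)) has_derivative
      (\<lambda>V. Complex (frechet_derivative P (at p) V) (frechet_derivative Q (at p) V))) (at p)"
    unfolding Complex_eq
    by (intro has_derivative_add has_derivative_mult_right has_derivative_of_real D)
  have L: "lie_derivative_metric (pp_metric F) (\<lambda>p. (Complex (P p) (Q p), x p, h p)) p (y1, y2, y3) (w1, w2, w3) = 0"
    for y1 y2 y3 w1 w2 w3
    using K p by (simp add: killing_on_def)
  note E = lie_derivative_pp_metric[OF zd(5)[OF subsetD[OF B p]] A D(3,4)]
  have 1: "dd e4 x p = 0" using L[of 0 0 1 0 0 1] by (simp add: E dd_def)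
  then show "dd e4 x p = 0" .
  show "2 * dd e4 P p = dd e1 x p" using L[of 1 0 0 0 0 1] by (simp add: E dd_def)
  show "2 * dd e4 Q p = dd e2 x p" using L[of \<i> 0 0 0 0 1] by (simp add: E dd_def)
  show "dd e4 h p = - dd e3 x p" using L[of 0 1 0 0 0 1] 1 by (simp add: E dd_def)
  show "dd e1 P p = 0" using L[of 1 0 0 1 0 0] by (simp add: E dd_def)
  show "dd e2 Q p = 0" using L[of \<i> 0 0 \<i> 0 0] by (simp add: E dd_def)
  show "dd e2 P p = - dd e1 Q p" using L[of 1 0 0 \<i> 0 0] by (simp add: E dd_def)
  show "dd e1 h p = 2 * dd e3 P p - 4 * Re (f p) * dd e1 x p"
    using L[of 1 0 0 0 1 0] by (simp add: E dd_def algebra_simps)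
  show "dd e2 h p = 2 * dd e3 Q p - 4 * Re (f p) * dd e2 x p"
    using L[of \<i> 0 0 0 1 0] by (simp add: E dd_def algebra_simps)
  show "dd e3 h p = - 2 * (Re (pz f p) * P p - Im (pz f p) * Q p + Re (pu f p) * x p)
       - 4 * Re (f p) * dd e3 x p"
    using L[of 0 1 0 0 1 0] by (simp add: E dd_def algebra_simps)
qed

text \<open>The relations arise by computing mixed second derivatives of a component in two orders
  and inserting \<open>killing_components\<close>. That \<open>pz (pz f)\<close> has no zeros enters
  once, to make \<open>x\<close> independent of \<zeta>.\<close>

lemma killing_structure_real:
  assumes K: "killing_on (pp_metric F) B (\<lambda>p. (Complex (P p) (Q p), x p, h p))"
    and B: "open B" "B \<subseteq> M" and p: "p \<in> B"
    and sm: "smooth_on P B" "smooth_on Q B" "smooth_on x B" "smooth_on h B"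
  shows "dd e1 x p = 0" "dd e2 x p = 0" "dd v (dd e3 x) p = 0"
    "dd v (dd e1 Q) p = 0"
    "pz (pz f) p * Complex (P p) (Q p) + pu (pz f) p * of_real (x p) + \<i> * of_real (dd e1 Q p) * pz f p
       + 2 * of_real (dd e3 x p) * pz f p + cnj (Complex (dd e3 (dd e3 P) p) (dd e3 (dd e3 Q) p)) = 0"
    "dd e4 P p = 0" "dd e4 Q p = 0"
proof -
  note k = killing_components[OF K B(2) _ sm]
  note sm1 = sm sm[THEN smooth_on_dd]
  note sm2 = sm1 sm1[THEN smooth_on_dd]
  note df = sm2[THEN smooth_on_differentiable]
  note cm = dd_commute[OF _ B(1)]
  note cg = dd_cong[OF B(1)]
  note fd = zd(5,15,16)[OF subsetD[OF B(2)]]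
  note fR = fd[THEN dd_zu(1)] fd[THEN dd_zu(2)]
  note ar = dd_arith dd_cmult dd_minus dd_const fR df fd[THEN dd_zu(3)] fd[THEN dd_zu(4)]
  \<comment> \<open>\<open>dd e1 x\<close> is twice \<open>dd e4 P\<close>, and \<open>P\<close>
    does not vary along \<open>e1\<close>.\<close>
  have x11: "dd e1 (dd e1 x) p = 0" if p: "p \<in> B" for p
  proof -
    have "dd e1 (dd e1 x) p = dd e1 (\<lambda>p. 2 * dd e4 P p) p"
      by (rule cg) (simp_all add: k sm2 p)
    also have "\<dots> = 2 * dd e4 (dd e1 P) p"
      by (simp add: ar p cm[of P, OF sm(1) p])
    also have "dd e4 (dd e1 P) p = dd e4 (\<lambda>p. 0) p"
      by (rule cg) (simp_all add: k sm2 p)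
    finally show ?thesis by (simp add: dd_const)
  qed
  have x22: "dd e2 (dd e2 x) p = 0" if p: "p \<in> B" for p
  proof -
    have "dd e2 (dd e2 x) p = dd e2 (\<lambda>p. 2 * dd e4 Q p) p"
      by (rule cg) (simp_all add: k sm2 p)
    also have "\<dots> = 2 * dd e4 (dd e2 Q) p"
      by (simp add: ar p cm[of Q, OF sm(2) p])
    also have "dd e4 (dd e2 Q) p = dd e4 (\<lambda>p. 0) p"
      by (rule cg) (simp_all add: k sm2 p)
    finally show ?thesis by (simp add: dd_const)
  qed
  \<comment> \<open>As \<open>dd e2 P = - dd e1 Q\<close>, the two orders of differentiation give
    values of opposite sign.\<close>
  have x21: "dd e2 (dd e1 x) p = 0" if p: "p \<in> B" for p
  proof -
    have "dd e2 (dd e1 x) p = dd e2 (\<lambda>p. 2 * dd e4 P p) p"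
      by (rule cg) (simp_all add: k sm2 p)
    also have "\<dots> = 2 * dd e4 (dd e2 P) p"
      by (simp add: ar p cm[of P, OF sm(1) p])
    also have "dd e4 (dd e2 P) p = dd e4 (\<lambda>p. - dd e1 Q p) p"
      by (rule cg) (simp_all add: k sm2 p)
    finally have 1: "dd e2 (dd e1 x) p = - 2 * dd e4 (dd e1 Q) p"
      by (simp add: ar p)
    have "dd e1 (dd e2 x) p = dd e1 (\<lambda>p. 2 * dd e4 Q p) p"
      by (rule cg) (simp_all add: k sm2 p)
    also have "\<dots> = 2 * dd e4 (dd e1 Q) p"
      by (simp add: ar p cm[of Q, OF sm(2) p])
    finally show ?thesis using 1 cm[OF sm(3) p, of e1 e2] by simp
  qed
  have x4: "dd e4 (dd v x) p = 0" if p: "p \<in> B" for p v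
  proof -
    have "dd v (dd e4 x) p = dd v (\<lambda>p. 0) p"
      by (rule cg) (simp_all add: k sm2 p)
    then show ?thesis using cm[OF sm(3) p, of e4 v] by (simp add: dd_const)
  qed
  \<comment> \<open>Again two values of opposite sign, now for the mixed derivative of
    \<open>h\<close> along \<open>e1\<close> and \<open>e4\<close>.\<close>
  have x31: "dd e3 (dd e1 x) p = 0" if p: "p \<in> B" for p
  proof -
    have "dd e4 (dd e1 h) p = dd e4 (\<lambda>p. 2 * dd e3 P p - 4 * Re (f p) * dd e1 x p) p"
      by (rule cg) (simp_all add: k sm2 p)
    also have "\<dots> = 2 * dd e3 (dd e4 P) p"
      by (simp add: ar p x4 cm[of P, OF sm(1) p, of e4])
    also have "\<dots> = dd e3 (\<lambda>p. 2 * dd e4 P p) p"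
      by (simp add: ar p)
    also have "\<dots> = dd e3 (dd e1 x) p"
      by (rule cg[symmetric]) (simp_all add: k sm2 p)
    finally have 1: "dd e4 (dd e1 h) p = dd e3 (dd e1 x) p" .
    have "dd e1 (dd e4 h) p = dd e1 (\<lambda>p. - dd e3 x p) p"
      by (rule cg) (simp_all add: k sm2 p)
    then have "dd e4 (dd e1 h) p = - dd e3 (dd e1 x) p"
      by (simp add: ar p cm[OF sm(3) p, of e1 e3] cm[OF sm(4) p, of e1 e4])
    then show ?thesis using 1 by simp
  qed
  have x32: "dd e3 (dd e2 x) p = 0" if p: "p \<in> B" for p
  proof -
    have "dd e4 (dd e2 h) p = dd e4 (\<lambda>p. 2 * dd e3 Q p - 4 * Re (f p) * dd e2 x p) p"
      by (rule cg) (simp_all add: k sm2 p)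
    also have "\<dots> = 2 * dd e3 (dd e4 Q) p"
      by (simp add: ar p x4 cm[of Q, OF sm(2) p, of e4])
    also have "\<dots> = dd e3 (\<lambda>p. 2 * dd e4 Q p) p"
      by (simp add: ar p)
    also have "\<dots> = dd e3 (dd e2 x) p"
      by (rule cg[symmetric]) (simp_all add: k sm2 p)
    finally have 1: "dd e4 (dd e2 h) p = dd e3 (dd e2 x) p" .
    have "dd e2 (dd e4 h) p = dd e2 (\<lambda>p. - dd e3 x p) p"
      by (rule cg) (simp_all add: k sm2 p)
    then have "dd e4 (dd e2 h) p = - dd e3 (dd e2 x) p"
      by (simp add: ar p cm[OF sm(3) p, of e2 e3] cm[OF sm(4) p, of e2 e4])
    then show ?thesis using 1 by simp
  qed
  \<comment> \<open>The mixed derivative of \<open>h\<close> along \<open>e3\<close> and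
    \<open>e4\<close> is minus the second \<open>e3\<close>-derivative of \<open>x\<close>, and
    \<open>f\<close> does not depend on \<open>v\<close>.\<close>
  have x33: "dd e3 (dd e3 x) p = Re (pz f p) * dd e1 x p - Im (pz f p) * dd e2 x p" if p: "p \<in> B" for p
  proof -
    have "dd e4 (dd e3 h) p = dd e4 (\<lambda>p. - 2 * (Re (pz f p) * P p - Im (pz f p) * Q p + Re (pu f p) * x p)
       - 4 * Re (f p) * dd e3 x p) p"
      by (rule cg) (simp_all add: k sm2 p)
    also have "\<dots> = - (Re (pz f p) * (2 * dd e4 P p) - Im (pz f p) * (2 * dd e4 Q p))"
      by (simp add: ar p x4 k(1))
    also have "\<dots> = - (Re (pz f p) * dd e1 x p - Im (pz f p) * dd e2 x p)"
      by (simp only: k p)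
    finally have 1: "dd e4 (dd e3 h) p = - (Re (pz f p) * dd e1 x p - Im (pz f p) * dd e2 x p)" .
    have "dd e3 (dd e4 h) p = dd e3 (\<lambda>p. - dd e3 x p) p"
      by (rule cg) (simp_all add: k sm2 p)
    then show ?thesis using 1 cm[OF sm(4) p, of e4 e3] by (simp add: ar p)
  qed
  \<comment> \<open>By \<open>x31\<close> and \<open>x32\<close> the left side of \<open>x33\<close>
    does not vary with \<zeta>. Differentiating its right side along \<open>e1\<close> and
    \<open>e2\<close> gives, up to sign, the real and imaginary parts of \<open>pz (pz f)\<close>
    times the \<zeta>-gradient of \<open>x\<close>, read as a complex number; so that gradient is
    zero.\<close>
  have g: "dd e1 x p = 0 \<and> dd e2 x p = 0" if p: "p \<in> B" for p
  proof -
    have z: "dd v (dd e3 (dd e3 x)) p = 0" if "v = e1 \<or> v = e2" for v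
    proof -
      have "dd v (dd e3 x) r = 0" if "r \<in> B" for r
        using x31[OF that] x32[OF that] cm[OF sm(3) that, of v e3] \<open>v = e1 \<or> v = e2\<close> by auto
      then have "dd e3 (dd v (dd e3 x)) p = dd e3 (\<lambda>p. 0) p"
        by (intro cg) (simp_all add: sm2 p)
      then show ?thesis using cm[OF sm1(7) p, of v e3 e3] by (simp add: dd_const)
    qed
    have r: "dd v (dd e3 (dd e3 x)) p = dd v (\<lambda>p. Re (pz f p) * dd e1 x p - Im (pz f p) * dd e2 x p) p" for v
      by (rule cg) (simp_all add: x33 sm2 p)
    have "pz (pz f) p * Complex (dd e1 x p) (dd e2 x p) = 0"
      using r[of e1] r[of e2] z[of e1] z[of e2] cm[OF sm(3) p, of e1 e2]
      by (simp add: ar p x11 x22 x21 complex_eq_iff algebra_simps)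
    then have "Complex (dd e1 x p) (dd e2 x p) = 0"
      using fzz[OF subsetD[OF B(2) p]] by simp
    then show ?thesis by (simp add: complex_eq_iff)
  qed
  show "dd e1 x p = 0" "dd e2 x p = 0" using g[OF p] by auto
  have P4: "dd e4 P p = 0" "dd e4 Q p = 0" if p: "p \<in> B" for p
    using k(2,3)[OF p] g[OF p] by simp_all
  then show "dd e4 P p = 0" "dd e4 Q p = 0" using p by auto
  have vanish: "frechet_derivative G (at p) v = 0"
    if "smooth_on G B" "p \<in> B" "dd e1 G p = 0" "dd e2 G p = 0" "dd e3 G p = 0" "dd e4 G p = 0" for G v p
    using dd_basis[OF smooth_on_differentiable[OF that(1,2)], of "fst v" "fst (snd v)" "snd (snd v)"] that
    by simp
  have "dd e3 (dd e3 x) p = 0" "dd e1 (dd e3 x) p = 0" "dd e2 (dd e3 x) p = 0"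
    using x33[OF p] g[OF p] x31[OF p] x32[OF p] cm[OF sm(3) p, of e1 e3] cm[OF sm(3) p, of e2 e3] by simp_all
  then show "dd v (dd e3 x) p = 0"
    unfolding dd_def[of v] by (intro vanish) (simp_all add: sm2 x4 p)
  \<comment> \<open>\<open>dd e1 Q\<close> is the rotation rate of the field in the \<zeta>-plane.
    That it does not vary with \<open>u\<close> comes from the two orders of the mixed derivative of
    \<open>h\<close> along \<open>e1\<close> and \<open>e2\<close>.\<close>
  have Q: "dd v (dd e1 Q) p = 0" if "p \<in> B" for p v
    unfolding dd_def[of v]
  proof (rule vanish)
    have "dd e1 (dd e2 Q) p = dd e1 (\<lambda>p. 0) p"
      by (rule cg) (simp_all add: k sm2 that)
    then show "dd e2 (dd e1 Q) p = 0" using cm[OF sm(2) that, of e2 e1] by (simp add: dd_const)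
    have "dd e1 (dd e1 Q) p = dd e1 (\<lambda>p. - dd e2 P p) p"
      by (rule cg) (simp_all add: k sm2 that)
    also have "\<dots> = - dd e2 (dd e1 P) p"
      by (simp add: ar that cm[OF sm(1) that, of e1])
    also have "dd e2 (dd e1 P) p = dd e2 (\<lambda>p. 0) p"
      by (rule cg) (simp_all add: k sm2 that)
    finally show "dd e1 (dd e1 Q) p = 0" by (simp add: dd_const)
    have "dd e1 (dd e4 Q) p = dd e1 (\<lambda>p. 0) p"
      by (rule cg) (simp_all add: P4 sm2 that)
    then show "dd e4 (dd e1 Q) p = 0" using cm[OF sm(2) that, of e4 e1] by (simp add: dd_const)
    have "dd e2 (dd e1 h) p = dd e2 (\<lambda>p. 2 * dd e3 P p) p"
      by (rule cg) (simp_all add: k sm2 that g)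
    also have "\<dots> = 2 * dd e3 (dd e2 P) p"
      by (simp add: ar that cm[OF sm(1) that, of e2])
    also have "dd e3 (dd e2 P) p = dd e3 (\<lambda>p. - dd e1 Q p) p"
      by (rule cg) (simp_all add: k sm2 that)
    finally have 1: "dd e2 (dd e1 h) p = - 2 * dd e3 (dd e1 Q) p"
      by (simp add: ar that)
    have "dd e1 (dd e2 h) p = dd e1 (\<lambda>p. 2 * dd e3 Q p) p"
      by (rule cg) (simp_all add: k sm2 that g)
    also have "\<dots> = 2 * dd e3 (dd e1 Q) p"
      by (simp add: ar that cm[OF sm(2) that, of e1])
    finally show "dd e3 (dd e1 Q) p = 0"
      using 1 cm[OF sm(4) that, of e1 e2] by simp
  qed (simp_all add: that sm2)
  show "dd v (dd e1 Q) p = 0" by (rule Q[OF p])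
  have fzu: "pz (pu f) p = pu (pz f) p"
    using hol_smooth_on_partials(3)[OF f_hs open_M subsetD[OF B(2) p]] .
  \<comment> \<open>The \<open>e1\<close>- and \<open>e2\<close>-derivatives of the last Killing
    equation are, up to real factors, the real and imaginary parts of the complex equation claimed
    below.\<close>
  have h: "dd v (dd e3 h) p = dd v (\<lambda>p. - 2 * (Re (pz f p) * P p - Im (pz f p) * Q p + Re (pu f p) * x p)
       - 4 * Re (f p) * dd e3 x p) p" for v
    by (rule cg) (simp_all add: k sm2 p)
  have "dd e3 (dd e1 h) p = dd e3 (\<lambda>p. 2 * dd e3 P p) p" "dd e3 (dd e2 h) p = dd e3 (\<lambda>p. 2 * dd e3 Q p) p"
    by (rule cg; simp add: k sm2 p g)+
  then have 1: "dd e1 (dd e3 h) p = 2 * dd e3 (dd e3 P) p" "dd e2 (dd e3 h) p = 2 * dd e3 (dd e3 Q) p"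
    using cm[OF sm(4) p, of e1 e3] cm[OF sm(4) p, of e2 e3] by (simp_all add: ar p)
  show "pz (pz f) p * Complex (P p) (Q p) + pu (pz f) p * of_real (x p) + \<i> * of_real (dd e1 Q p) * pz f p
       + 2 * of_real (dd e3 x p) * pz f p + cnj (Complex (dd e3 (dd e3 P) p) (dd e3 (dd e3 Q) p)) = 0"
    using h[of e1] h[of e2] cm[OF sm(3) p, of e1 e3] cm[OF sm(3) p, of e2 e3] x31[OF p] x32[OF p] unfolding 1
    by (simp add: ar p g k(5-7) fzu complex_eq_iff algebra_simps)
qed

end

lemma partials_Complex:
  assumes "smooth_on G S" "smooth_on H S" "p \<in> S"
  shows "((\<lambda>p. Complex (G p) (H p)) has_derivative
      (\<lambda>V. Complex (frechet_derivative G (at p) V) (frechet_derivative H (at p) V))) (at p)"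
    "pu (\<lambda>p. Complex (G p) (H p)) p = Complex (dd e3 G p) (dd e3 H p)"
proof -
  show D: "((\<lambda>p. Complex (G p) (H p)) has_derivative
      (\<lambda>V. Complex (frechet_derivative G (at p) V) (frechet_derivative H (at p) V))) (at p)"
    unfolding Complex_eq
    by (intro has_derivative_add has_derivative_mult_right has_derivative_of_real
        smooth_on_has_derivative[OF assms(1,3)] smooth_on_has_derivative[OF assms(2,3)])
  show "pu (\<lambda>p. Complex (G p) (H p)) p = Complex (dd e3 G p) (dd e3 H p)"
    unfolding pu_def frechet_derivative_at[OF D, symmetric] by (simp add: dd_def)
qed

lemma smooth_on_Complex:
  assumes "open S" "smooth_on G S" "smooth_on H S"
  shows "smooth_on (\<lambda>p. Complex (G p) (H p)) S"
  unfolding Complex_eq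
  by (intro smooth_on_add smooth_on_mult smooth_on_const smooth_on_bounded_linear[OF bounded_linear_of_real] assms)

lemmas smooth_intros = smooth_on_const smooth_on_add smooth_on_mult
  smooth_on_bounded_linear[OF bounded_linear_Re] smooth_on_bounded_linear[OF bounded_linear_Im]
  smooth_on_bounded_linear[OF bounded_linear_cnj] smooth_on_bounded_linear[OF bounded_linear_of_real]
  smooth_on_bounded_linear[OF bounded_linear_fst] smooth_on_bounded_linear[OF bounded_linear_snd]
  smooth_on_linear[OF bounded_linear_fst] smooth_on_linear[OF bounded_linear_snd]

lemma killing_on_subset: "killing_on g V X \<Longrightarrow> W \<subseteq> V \<Longrightarrow> killing_on g W X"
  by (auto simp: killing_on_def intro: smooth_on_subset)

section \<open>Killing fields yield \<open>killing_data\<close>\<close>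

context pp_dependent
begin

text \<open>\<open>A\<close> is holomorphic in \<zeta> with constant derivative
  \<open>\<i> * of_real w\<close>, and \<xi> has constant slope \<open>t\<close> in
  \<open>u\<close>. One term of the complex integrability condition is antiholomorphic in \<zeta>;
  the \<zeta>-derivative removes it and fixes the value of da on the field.\<close>

lemma killing_data_of_killing:
  assumes K: "killing_on (pp_metric F) B X" and B: "open B" "connected B" "B \<subseteq> M" "p0 \<in> B"
  obtains \<sigma> where "killing_data M F a B (\<lambda>p. fst (X p)) (\<lambda>p. of_real (fst (snd (X p)))) \<sigma>"
    "\<forall>p\<in>B. pz (pz f) p * fst (X p) + pu (pz f) p * of_real (fst (snd (X p)))
       - (cnj \<sigma> + 3 * \<sigma>) * pz f p + cnj (pu (pu (\<lambda>p. fst (X p))) p) = 0"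
proof -
  define P where "P = (\<lambda>p. Re (fst (X p)))"
  define Q where "Q = (\<lambda>p. Im (fst (X p)))"
  define x where "x = (\<lambda>p. fst (snd (X p)))"
  define h where "h = (\<lambda>p. snd (snd (X p)))"
  define A where "A = (\<lambda>p. fst (X p))"
  define \<xi> where "\<xi> = (\<lambda>p. complex_of_real (x p))"
  have AC: "A = (\<lambda>p. Complex (P p) (Q p))" by (simp add: A_def P_def Q_def)
  have X: "X = (\<lambda>p. (Complex (P p) (Q p), x p, h p))"
    by (simp add: P_def Q_def x_def h_def)
  have smX: "smooth_on X B" using K by (simp add: killing_on_def)
  have sm: "smooth_on P B" "smooth_on Q B" "smooth_on x B" "smooth_on h B"
    unfolding P_def Q_def x_def h_def by (intro smooth_intros B smX)+
  note k = killing_components[OF K[unfolded X] B(3) _ sm]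
  note s = killing_structure_real[OF K[unfolded X] B(1,3) _ sm]
  define w where "w = dd e1 Q p0"
  define t where "t = dd e3 x p0"
  have w: "dd e1 Q p = w" if "p \<in> B" for p
    unfolding w_def
    by (rule zero_dd_const[OF B(1,2) smooth_on_dd[OF sm(2)] that B(4)]) (simp add: s)
  have t: "dd e3 x p = t" if "p \<in> B" for p
    unfolding t_def
    by (rule zero_dd_const[OF B(1,2) smooth_on_dd[OF sm(3)] that B(4)]) (simp add: s)
  have zuA: "has_zu_derivative A (\<i> * of_real w) (Complex (dd e3 P p) (dd e3 Q p)) p" if p: "p \<in> B" for p
    unfolding has_zu_derivative_def AC
  proof (rule has_derivative_eq_rhs[OF partials_Complex(1)[OF sm(1,2) p]], intro ext)
    fix V :: point
    show "Complex (frechet_derivative P (at p) V) (frechet_derivative Q (at p) V) =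
      \<i> * of_real w * fst V + Complex (dd e3 P p) (dd e3 Q p) * of_real (fst (snd V))"
      using dd_basis[OF smooth_on_differentiable[OF sm(1) p], of "fst V" "fst (snd V)" "snd (snd V)"]
        dd_basis[OF smooth_on_differentiable[OF sm(2) p], of "fst V" "fst (snd V)" "snd (snd V)"]
        k(5-7)[OF p] s(6,7)[OF p] w[OF p]
      by (simp add: complex_eq_iff algebra_simps)
  qed
  have zux: "has_zu_derivative \<xi> 0 (of_real t) p" if p: "p \<in> B" for p
    unfolding has_zu_derivative_def \<xi>_def
  proof (rule has_derivative_eq_rhs[OF has_derivative_of_real[OF smooth_on_has_derivative[OF sm(3) p]]], intro ext)
    fix V :: point
    show "of_real (frechet_derivative x (at p) V) = 0 * fst V + of_real t * complex_of_real (fst (snd V))"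
      using dd_basis[OF smooth_on_differentiable[OF sm(3) p], of "fst V" "fst (snd V)" "snd (snd V)"]
        k(1)[OF p] s(1,2)[OF p] t[OF p]
      by (simp add: algebra_simps)
  qed
  note pA = has_zu_derivativeD[OF zuA] and px = has_zu_derivativeD[OF zux]
  have A_hs: "hol_smooth_on A B"
    unfolding hol_smooth_on_def using pA(3) smooth_on_Complex[OF B(1) sm(1,2)] by (simp add: AC)
  have \<xi>_hs: "hol_smooth_on \<xi> B"
    unfolding hol_smooth_on_def using px(3) smooth_on_bounded_linear[OF bounded_linear_of_real B(1) sm(3)]
    by (simp add: \<xi>_def)
  have puA: "pu (pu A) p = Complex (dd e3 (dd e3 P) p) (dd e3 (dd e3 Q) p)" if p: "p \<in> B" for p
  proof -
    have "pu (pu A) p = pu (\<lambda>p. Complex (dd e3 P p) (dd e3 Q p)) p"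
      by (rule partials_cong[OF hol_smooth_on_partials(2)[OF A_hs B(1)] B(1) _ p]) (simp add: pA)
    then show ?thesis using partials_Complex(2)[OF sm(1,2)[THEN smooth_on_dd] p] by simp
  qed
  have eq: "pz (pz f) p * A p + pu (pz f) p * \<xi> p + (\<i> * of_real w + 2 * of_real t) * pz f p
      + cnj (pu (pu A) p) = 0" if p: "p \<in> B" for p
    using s(5)[OF p] unfolding puA[OF p] w[OF p] t[OF p] by (simp add: AC \<xi>_def algebra_simps)
  \<comment> \<open>Anticipates the next step: this is the value of da on the field.\<close>
  define \<sigma> where "\<sigma> = - (\<i> * of_real w + of_real t) / 2"
  have \<sigma>: "pz a p * A p + pu a p * \<xi> p = \<sigma>" if p: "p \<in> B" for p
  proof -
    have pM: "p \<in> M" using p B by blast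
    note zd' = zd[OF pM] hol_smooth_on_zu_diff[OF A_hs p] hol_smooth_on_zu_diff[OF \<xi>_hs p]
      hol_smooth_on_zu_diff[OF hol_smooth_on_partials(2)[OF hol_smooth_on_partials(2)[OF A_hs B(1)] B(1)] p]
    have "pz (\<lambda>p. pz (pz f) p * A p + pu (pz f) p * \<xi> p + (\<i> * of_real w + 2 * of_real t) * pz f p) p = 0"
      by (rule pz_zero_if_add_cnj_zero(1)[OF B(1) p eq]) (simp_all add: zu_simps zd')
    moreover have "pz (pu (pz f)) p = pu (pz (pz f)) p"
      by (rule hol_smooth_on_partials(3)[OF _ open_M pM]) (simp add: hs)
    \<comment> \<open>\<open>fzzz\<close> turns the third derivatives of \<open>f\<close> into
      multiples of \<open>pz (pz f)\<close>, which can then be cancelled.\<close>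
    ultimately have "2 * pz (pz f) p * (2 * (pz a p * A p + pu a p * \<xi> p) + (\<i> * of_real w + of_real t)) = 0"
      by (simp add: zu_simps zd' pA px p fzzz pM algebra_simps)
    then have "2 * (pz a p * A p + pu a p * \<xi> p) + (\<i> * of_real w + of_real t) = 0"
      by (rule disjE[OF mult_eq_0_iff[THEN iffD1]]) (use fzz[OF pM] in simp_all)
    then have "2 * (pz a p * A p + pu a p * \<xi> p) = - (\<i> * of_real w + of_real t)"
      by (simp only: eq_neg_iff_add_eq_0)
    then show ?thesis unfolding \<sigma>_def by (metis nonzero_mult_div_cancel_left zero_neq_numeral)
  qed
  have \<sigma>': "cnj \<sigma> - \<sigma> = \<i> * of_real w" "\<sigma> + cnj \<sigma> = - of_real t"
    "cnj \<sigma> + 3 * \<sigma> = - (\<i> * of_real w + 2 * of_real t)"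
    by (simp_all add: \<sigma>_def complex_eq_iff)
  have "killing_data M F a B A \<xi> \<sigma>"
  proof
    fix p assume p: "p \<in> B"
    then have pM: "p \<in> M" using B by blast
    show "A p = m p * \<sigma> + q p * \<xi> p"
      using az[OF pM] unfolding \<sigma>[OF p, symmetric] by (simp add: m_def q_def field_simps)
    show "cnj (\<xi> p) = \<xi> p" by (simp add: \<xi>_def)
    show "pz A p = cnj \<sigma> - \<sigma>" "pz \<xi> p = 0" "pu \<xi> p = - (\<sigma> + cnj \<sigma>)"
      unfolding \<sigma>' using pA[OF p] px[OF p] by simp_all
  qed (use B A_hs \<xi>_hs in simp_all)
  then show ?thesis
    using that[of \<sigma>] eq unfolding \<sigma>'(3) by (simp add: A_def \<xi>_def x_def algebra_simps)
qed

text \<open>If \<open>A\<close> and \<xi> vanish at one point then \<sigma> = 0, as \<open>m\<close>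
  has no zeros. So \<xi> is constant, hence zero, \<open>A\<close> is zero by \<open>A_eq\<close>,
  and the Killing equations leave only a constant \<open>h\<close>. By linearity a Killing field is
  determined up to a multiple of \<open>e4\<close> by its projection at one point.\<close>

lemma killing_zero_projection:
  assumes K: "killing_on (pp_metric F) B X" and B: "open B" "connected B" "B \<subseteq> M" "p0 \<in> B"
    and z: "fst (X p0) = 0" "fst (snd (X p0)) = 0"
  shows "\<exists>c. \<forall>p\<in>B. X p = c *\<^sub>R e4"
proof -
  obtain \<sigma> where "killing_data M F a B (\<lambda>p. fst (X p)) (\<lambda>p. of_real (fst (snd (X p)))) \<sigma>"
    by (rule killing_data_of_killing[OF K B])
  then interpret kd: killing_data M F a B "\<lambda>p. fst (X p)" "\<lambda>p. of_real (fst (snd (X p)))" \<sigma> .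
  have \<sigma>: "\<sigma> = 0"
    using kd.A_eq[OF B(4)] z az[OF kd.BM[OF B(4)]] by (simp add: m_def)
  have x: "fst (snd (X p)) = 0" if "p \<in> B" for p
    using zero_partials_const[OF B(1,2) hol_smooth_on_zu_diff[OF kd.\<xi>_hs] kd.pz_\<xi> _ that B(4)]
      kd.pu_\<xi> z \<sigma> by simp
  have A: "fst (X p) = 0" if "p \<in> B" for p
    using kd.A_eq[OF that] x[OF that] \<sigma> by simp
  define h where "h = (\<lambda>p. snd (snd (X p)))"
  define x where "x = (\<lambda>p. fst (snd (X p)))"
  define P where "P = (\<lambda>p. Re (fst (X p)))"
  define Q where "Q = (\<lambda>p. Im (fst (X p)))"
  have X: "X = (\<lambda>p. (Complex (P p) (Q p), x p, h p))"
    by (simp add: h_def P_def Q_def x_def)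
  have smX: "smooth_on X B" using K by (simp add: killing_on_def)
  have sm: "smooth_on P B" "smooth_on Q B" "smooth_on x B" "smooth_on h B"
    unfolding P_def Q_def x_def h_def by (intro smooth_intros B smX)+
  note k = killing_components[OF K[unfolded X] B(3) _ sm]
  have zero: "dd v G p = 0" if "p \<in> B" "smooth_on G B" "\<And>p. p \<in> B \<Longrightarrow> G p = 0" for v G p
    using dd_cong[OF B(1) that(2), of "\<lambda>p. 0" p v] that by (simp add: dd_const)
  have 0: "P p = 0" "Q p = 0" "x p = 0" if "p \<in> B" for p
    using A[OF that] \<open>p \<in> B \<Longrightarrow> fst (snd (X p)) = 0\<close> that by (simp_all add: P_def Q_def x_def)
  have "h p = h p0" if "p \<in> B" for p
    by (rule zero_dd_const[OF B(1,2) sm(4) that B(4)]) (simp add: k 0 zero sm)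
  then have "\<forall>p\<in>B. X p = h p0 *\<^sub>R e4"
    using 0 by (auto simp: X complex_eq_iff zero_prod_def)
  then show ?thesis ..
qed

end

section \<open>\<open>killing_data\<close> with the integrability condition yield Killing
  fields\<close>

context killing_data
begin

lemma pz_pu_A: "p \<in> B \<Longrightarrow> pz (pu A) p = 0" "p \<in> B \<Longrightarrow> pz (pu (pu A)) p = 0"
proof -
  note A1 = hol_smooth_on_partials[OF A_hs B(1)]
  note A2 = hol_smooth_on_partials[OF A1(2) B(1)]
  have 1: "pz (pu A) p = 0" if p: "p \<in> B" for p
  proof -
    have "pu (pz A) p = pu (\<lambda>p. cnj \<sigma> - \<sigma>) p"
      by (rule partials_cong[OF A1(1) B(1) _ p]) (simp add: pz_A)
    then show ?thesis using A1(3)[OF p] by (simp add: zu_const)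
  qed
  show "p \<in> B \<Longrightarrow> pz (pu A) p = 0" by (rule 1)
  assume p: "p \<in> B"
  have "pu (pz (pu A)) p = pu (\<lambda>p. 0) p"
    by (rule partials_cong[OF A2(1) B(1) _ p]) (simp add: 1)
  then show "pz (pu (pu A)) p = 0" using A2(3)[OF p] by (simp add: zu_const)
qed

text \<open>The Killing equations prescribe all derivatives of \<open>h\<close>: the
  \<open>v\<close>-derivative is \<open>2 * Re \<sigma>\<close>, the \<zeta>-part is given by
  \<open>pu A\<close>, and \<open>eq\<close> makes the \<open>u\<close>-derivative compatible with
  them. The radius is halved so that an antiderivative is needed on a compact interval only.\<close>

lemma exists_killing:
  assumes ball: "B = ball p0 r" "r > 0"
    and eq: "\<And>p. p \<in> B \<Longrightarrow> pz (pz f) p * A p + pu (pz f) p * \<xi> p - (cnj \<sigma> + 3 * \<sigma>) * pz f p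
      + cnj (pu (pu A) p) = 0"
  shows "\<exists>h. killing_on (pp_metric F) (ball p0 (r / 2)) (\<lambda>p. (A p, Re (\<xi> p), h p))"
proof -
  obtain z0 u0 v0 where p0: "p0 = (z0, u0, v0)" by (cases p0)
  define S where "S = 2 * Re \<sigma>"
  have S: "complex_of_real S = \<sigma> + cnj \<sigma>" by (simp add: S_def complex_eq_iff)
  \<comment> \<open>\<open>- 2 * Re (G p)\<close> is the prescribed \<open>u\<close>-derivative of
    \<open>h\<close>; \<rho> is what remains of it after the \<zeta>-dependent term of
    \<open>h\<close> is accounted for.\<close>
  define G where "G = (\<lambda>p. pz f p * A p + pu f p * \<xi> p + (- 2 * of_real S) * f p)"
  define H where "H = pu (pu A)"
  define \<rho> where "\<rho> = (\<lambda>p. - 2 * Re (G p + cnj (H p) * fst p))"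
  have H_hs: "hol_smooth_on H B"
    unfolding H_def by (intro hol_smooth_on_partials A_hs B)
  have G_hs: "hol_smooth_on G B"
    unfolding G_def by (intro hol_smooth_intros B A_hs \<xi>_hs hsB hs)
  have \<rho>_smooth: "smooth_on \<rho> B"
    unfolding \<rho>_def by (intro smooth_intros hol_smooth_on_smooth G_hs H_hs B)
  \<comment> \<open>This is \<open>eq\<close>, and it cancels the \<zeta>-derivative of
    \<rho>.\<close>
  have pzG: "pz G p = - cnj (H p)" if p: "p \<in> B" for p
  proof -
    have fzu: "pz (pu f) p = pu (pz f) p"
      using hol_smooth_on_partials(3)[OF f_hs open_M BM[OF p]] .
    have "pz G p = pz (pz f) p * A p + pu (pz f) p * \<xi> p - (cnj \<sigma> + 3 * \<sigma>) * pz f p"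
      unfolding G_def by (simp add: zu_simps zdB p pz_A pz_\<xi> S fzu algebra_simps)
    then show ?thesis using eq[OF p] unfolding H_def by (simp add: eq_neg_iff_add_eq_0)
  qed
  have \<rho>_deriv: "\<exists>d. (\<rho> has_derivative (\<lambda>V. d * fst (snd V))) (at p)" if p: "p \<in> B" for p
  proof -
    have "((\<lambda>p. G p + cnj (H p) * fst p) has_derivative
        (\<lambda>V. (pz G p * fst V + pu G p * of_real (fst (snd V)))
          + (cnj (H p) * fst V + cnj (pz H p * fst V + pu H p * of_real (fst (snd V))) * fst p))) (at p)"
      by (intro has_derivative_add has_derivative_mult has_derivative_cnj has_derivative_fst
          has_derivative_ident zu_diff_has_derivative hol_smooth_on_zu_diff[OF G_hs p]
          hol_smooth_on_zu_diff[OF H_hs p])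
    from has_derivative_mult_right[OF bounded_linear.has_derivative[OF bounded_linear_Re this], of "- 2"]
    have "(\<rho> has_derivative (\<lambda>V. (- 2 * Re (pu G p + cnj (pu H p) * fst p)) * fst (snd V))) (at p)"
      unfolding \<rho>_def
      by (rule has_derivative_eq_rhs)
        (use pzG[OF p] pz_pu_A(2)[OF p] in \<open>auto simp: fun_eq_iff H_def algebra_simps\<close>)
    then show ?thesis ..
  qed
  \<comment> \<open>The segment at fixed \<open>u\<close> from (z0, u, v0) to the given point stays
    in the ball, since its start is no farther from the centre than its end.\<close>
  have in_ball: "(z0 + s *\<^sub>R (z - z0), u, v0 + s *\<^sub>R (v - v0)) \<in> B"
    if "(z, u, v) \<in> B" "0 \<le> s" "s \<le> 1" for z u v s
  proof -
    have "dist u0 u \<le> dist p0 (z, u, v)"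
      unfolding p0 dist_Pair_Pair
      by (rule order_trans[OF _ real_sqrt_sum_squares_ge2]) (rule real_sqrt_sum_squares_ge1)
    then have "(z0, u, v0) \<in> B"
      using that(1) by (simp add: ball p0 dist_Pair_Pair)
    then have "(1 - s) *\<^sub>R (z0, u, v0) + s *\<^sub>R (z, u, v) \<in> B"
      using that unfolding ball by (intro convexD[OF convex_ball]) auto
    then show ?thesis by (simp add: algebra_simps)
  qed
  have \<rho>_indep: "\<rho> (z, u, v) = \<rho> (z0, u, v0)" if zuv: "(z, u, v) \<in> B" for z u v
  proof -
    let ?c = "\<lambda>s. (z0 + s *\<^sub>R (z - z0), u, v0 + s *\<^sub>R (v - v0))"
    have "((\<lambda>s. \<rho> (?c s)) has_derivative (\<lambda>s. 0)) (at s within {0..1})" if s: "s \<in> {0..1}" for s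
    proof -
      obtain d where d: "(\<rho> has_derivative (\<lambda>V. d * fst (snd V))) (at (?c s))"
        using \<rho>_deriv[OF in_ball[OF zuv]] s by auto
      have "((\<lambda>s. \<rho> (?c s)) has_derivative
          (\<lambda>x. d * fst (snd (x *\<^sub>R (z - z0), 0::real, x *\<^sub>R (v - v0))))) (at s)"
        by (rule has_derivative_compose[of ?c _ s UNIV \<rho>, OF _ d]) (auto intro!: derivative_eq_intros)
      then show ?thesis by (simp add: has_derivative_at_withinI)
    qed
    from has_derivative_zero_unique[OF _ this, of "1" "0"] show ?thesis by simp
  qed
  define I where "I = {u0 - r / 2..u0 + r / 2}"
  have "continuous_on I (\<lambda>u. \<rho> (z0, u, v0))"
  proof (rule continuous_on_compose2[OF smooth_on_imp_continuous_on[OF \<rho>_smooth]])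
    show "(\<lambda>u. (z0, u, v0)) ` I \<subseteq> B"
      using ball by (auto simp: I_def p0 dist_Pair_Pair dist_real_def)
  qed (intro continuous_intros)
  then obtain N where N: "\<And>u. u \<in> I \<Longrightarrow> (N has_vector_derivative \<rho> (z0, u, v0)) (at u within I)"
    using antiderivative_continuous unfolding I_def by blast
  define B' where "B' = ball p0 (r / 2)"
  have B': "open B'" "B' \<subseteq> B" "B' \<subseteq> M"
    using ball B by (auto simp: B'_def)
  have N': "((\<lambda>p. N (fst (snd p))) has_derivative (\<lambda>V. \<rho> p * fst (snd V))) (at p)" if p: "p \<in> B'" for p
  proof -
    obtain z u v where zuv: "p = (z, u, v)" by (cases p)
    have "dist u u0 \<le> dist p p0"
      unfolding zuv p0 dist_Pair_Pair by (rule order_trans[OF _ real_sqrt_sum_squares_ge2])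
        (rule real_sqrt_sum_squares_ge1)
    then have "u \<in> {u0 - r / 2<..<u0 + r / 2}"
      using p by (auto simp: B'_def dist_commute dist_real_def)
    then have u: "u \<in> interior I" "u \<in> I" by (auto simp: I_def)
    have "(N has_vector_derivative \<rho> (z0, u, v0)) (at u)"
      using N[OF u(2)] at_within_interior[OF u(1)] by simp
    then have Nd: "(N has_derivative (\<lambda>t. t *\<^sub>R \<rho> p)) (at (fst (snd p)))"
      using \<rho>_indep[of z u v] p B' unfolding zuv has_vector_derivative_def by auto
    have "((\<lambda>p. N (fst (snd p))) has_derivative (\<lambda>V. fst (snd V) *\<^sub>R \<rho> p)) (at p)"
      by (rule has_derivative_compose[of "\<lambda>p. fst (snd p)" "\<lambda>V. fst (snd V)" p UNIV N, OF _ Nd])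
        (auto intro!: derivative_eq_intros)
    then show ?thesis by (simp add: mult.commute)
  qed
  \<comment> \<open>The three terms integrate the \<open>v\<close>-derivative, the
    \<zeta>-derivatives and the remaining \<open>u\<close>-derivative in turn.\<close>
  define h where "h = (\<lambda>p. S * snd (snd p) + 2 * Re (cnj (pu A p) * fst p) + N (fst (snd p)))"
  define Dh where "Dh = (\<lambda>p V. S * snd (snd V) + 2 * Re (cnj (H p * of_real (fst (snd V))) * fst p
      + cnj (pu A p) * fst V) + \<rho> p * fst (snd V))"
  have h: "(h has_derivative Dh p) (at p)" if p: "p \<in> B'" for p
  proof -
    have pB: "p \<in> B" using p B' by blast
    have "(h has_derivative (\<lambda>V. S * snd (snd V) + 2 * Re (cnj (pu A p) * fst V
        + cnj (pz (pu A) p * fst V + pu (pu A) p * of_real (fst (snd V))) * fst p) + \<rho> p * fst (snd V))) (at p)"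
      unfolding h_def
      by (intro has_derivative_add N'[OF p] has_derivative_mult has_derivative_mult_right has_derivative_cnj
          has_derivative_fst has_derivative_snd has_derivative_ident zu_diff_has_derivative zdB pB
          bounded_linear.has_derivative[OF bounded_linear_Re])
    then show ?thesis
      by (rule has_derivative_eq_rhs) (simp add: fun_eq_iff Dh_def H_def pz_pu_A[OF pB] algebra_simps)
  qed
  \<comment> \<open>\<open>N\<close> is known only through its derivative \<rho>, so smoothness is
    read off from the explicit differential \<open>Dh\<close>.\<close>
  have h_smooth: "smooth_on h B'"
  proof (rule smooth_onI[OF B'(1) h])
    show "smooth_on (\<lambda>p. Dh p V) B'" for V
      unfolding Dh_def
      by (rule smooth_on_subset[OF _ B'(2)])
        (intro smooth_intros \<rho>_smooth B hol_smooth_on_smooth[OF H_hs]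
          hol_smooth_on_smooth[OF hol_smooth_on_partials(2)[OF A_hs B(1)]])
  qed
  have "killing_on (pp_metric F) B' (\<lambda>p. (A p, Re (\<xi> p), h p))"
    unfolding killing_on_def
  proof (intro conjI ballI allI)
    show "smooth_on (\<lambda>p. (A p, Re (\<xi> p), h p)) B'"
      by (intro smooth_on_Pair h_smooth smooth_on_subset[OF _ B'(2)] smooth_intros
          hol_smooth_on_smooth A_hs \<xi>_hs B B')
    fix p Y W :: point assume p: "p \<in> B'"
    then have pB: "p \<in> B" using B' by blast
    obtain y1 y2 y3 where Y: "Y = (y1, y2, y3)" by (cases Y)
    obtain w1 w2 w3 where W: "W = (w1, w2, w3)" by (cases W)
    note E = lie_derivative_pp_metric[OF zd(5)[OF BM[OF pB]]
        zu_diff_has_derivative[OF hol_smooth_on_zu_diff[OF A_hs pB]]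
        bounded_linear.has_derivative[OF bounded_linear_Re
          zu_diff_has_derivative[OF hol_smooth_on_zu_diff[OF \<xi>_hs pB]]] h[OF p]]
    show "lie_derivative_metric (pp_metric F) (\<lambda>p. (A p, Re (\<xi> p), h p)) p Y W = 0"
      unfolding Y W E Dh_def \<rho>_def G_def pz_A[OF pB] pz_\<xi>[OF pB] pu_\<xi>[OF pB] of_real_\<xi>[OF pB]
      by (simp add: S_def \<xi>_real[OF pB, THEN arg_cong[of _ _ Im]] algebra_simps)
  qed
  then show ?thesis unfolding B'_def by blast
qed

end

section \<open>Common kernels of 1-forms\<close>

lemma linear_form_expand:
  fixes P :: "point \<Rightarrow> complex"
  assumes "linear P" "P e4 = 0"
  shows "P X = of_real (Re (fst X)) * P e1 + of_real (Im (fst X)) * P e2 + of_real (fst (snd X)) * P e3"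
proof -
  have "X = Re (fst X) *\<^sub>R e1 + Im (fst X) *\<^sub>R e2 + fst (snd X) *\<^sub>R e3 + snd (snd X) *\<^sub>R e4"
    by (cases X) (simp add: complex_eq_iff)
  then have "P X = P (Re (fst X) *\<^sub>R e1 + Im (fst X) *\<^sub>R e2 + fst (snd X) *\<^sub>R e3 + snd (snd X) *\<^sub>R e4)"
    by simp
  also have "\<dots> = Re (fst X) *\<^sub>R P e1 + Im (fst X) *\<^sub>R P e2 + fst (snd X) *\<^sub>R P e3 + snd (snd X) *\<^sub>R P e4"
    by (simp only: linear_add[OF assms(1)] linear_scale[OF assms(1)])
  finally show ?thesis using assms(2) by (simp add: scaleR_conv_of_real)
qed

text \<open>With \<open>Y\<close> in the third slot only \<open>R Y\<close> times a nonzero value of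
  the 2-form survives.\<close>

lemma wedge3_kernel:
  assumes "wedge2 P Q \<noteq> (\<lambda>X Y. 0)" "wedge3 P Q R = (\<lambda>X Y W. 0)" "P Y = 0" "Q Y = 0"
  shows "R Y = 0"
proof -
  obtain V W where VW: "wedge2 P Q V W \<noteq> 0" using assms(1) by (metis ext)
  have "wedge3 P Q R V W Y = R Y * wedge2 P Q V W"
    using assms(3,4) by (simp add: wedge3_def wedge2_def algebra_simps)
  then show ?thesis using VW assms(2) by simp
qed

text \<open>Modulo \<open>e4\<close> the forms live on a real space of dimension three, where
  \<open>wedge3\<close> is the determinant \<open>D\<close> of their coefficients times the
  determinant \<open>d\<close> of the coordinates. A nonzero real vector in the common kernel makes
  \<open>D\<close> vanish.\<close>

lemma wedge3_zero_if_common_kernel: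
  assumes P: "linear P" "P e4 = 0" "P K = 0" and Q: "linear Q" "Q e4 = 0" "Q K = 0"
    and R: "linear R" "R e4 = 0" "R K = 0" and K: "fst K \<noteq> 0 \<or> fst (snd K) \<noteq> 0"
  shows "wedge3 P Q R = (\<lambda>X Y W. 0)"
proof -
  define D where "D = P e1 * (Q e2 * R e3 - Q e3 * R e2) - P e2 * (Q e1 * R e3 - Q e3 * R e1)
    + P e3 * (Q e1 * R e2 - Q e2 * R e1)"
  note PE = linear_form_expand[OF P(1,2)] and QE = linear_form_expand[OF Q(1,2)]
    and RE = linear_form_expand[OF R(1,2)]
  \<comment> \<open>Cramer's rule: \<open>D\<close> times each coordinate of \<open>K\<close> is a
    combination of \<open>P K\<close>, \<open>Q K\<close> and \<open>R K\<close> with cofactors as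
    coefficients.\<close>
  have "of_real (Re (fst K)) * D = P K * (Q e2 * R e3 - Q e3 * R e2) - Q K * (P e2 * R e3 - P e3 * R e2)
      + R K * (P e2 * Q e3 - P e3 * Q e2)"
    unfolding D_def PE[of K] QE[of K] RE[of K] by (simp add: algebra_simps)
  moreover have "of_real (Im (fst K)) * D = - P K * (Q e1 * R e3 - Q e3 * R e1) + Q K * (P e1 * R e3 - P e3 * R e1)
      - R K * (P e1 * Q e3 - P e3 * Q e1)"
    unfolding D_def PE[of K] QE[of K] RE[of K] by (simp add: algebra_simps)
  moreover have "of_real (fst (snd K)) * D = P K * (Q e1 * R e2 - Q e2 * R e1) - Q K * (P e1 * R e2 - P e2 * R e1)
      + R K * (P e1 * Q e2 - P e2 * Q e1)"
    unfolding D_def PE[of K] QE[of K] RE[of K] by (simp add: algebra_simps)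
  ultimately have D: "D = 0"
    using K P(3) Q(3) R(3) by (auto simp: complex_eq_iff[of "fst K"])
  define d where "d X Y W = Re (fst X) * (Im (fst Y) * fst (snd W) - fst (snd Y) * Im (fst W))
    - Im (fst X) * (Re (fst Y) * fst (snd W) - fst (snd Y) * Re (fst W))
    + fst (snd X) * (Re (fst Y) * Im (fst W) - Im (fst Y) * Re (fst W))" for X Y W :: point
  have "wedge3 P Q R X Y W = D * of_real (d X Y W)" for X Y W
    unfolding wedge3_def wedge2_def D_def d_def
      PE[of X] PE[of Y] PE[of W] QE[of X] QE[of Y] QE[of W] RE[of X] RE[of Y] RE[of W]
    by (simp add: algebra_simps)
  then show ?thesis using D by (simp add: fun_eq_iff)
qed

text \<open>The coefficient vector of any form annihilating both \<open>K\<close> and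
  \<open>X\<close> is a multiple of the cross product (n1, n2, n3) of their projections, if this is
  nonzero. Then \<open>P\<close> and \<open>Q\<close> would have proportional coefficients and all
  minors would vanish.\<close>

lemma common_kernel_parallel:
  assumes P: "linear P" "P e4 = 0" "P K = 0" "P X = 0" and Q: "linear Q" "Q e4 = 0" "Q K = 0" "Q X = 0"
    and PQ: "wedge2 P Q \<noteq> (\<lambda>X Y. 0)" and K: "fst K \<noteq> 0 \<or> fst (snd K) \<noteq> 0"
  shows "\<exists>c. fst X = c *\<^sub>R fst K \<and> fst (snd X) = c * fst (snd K)"
proof -
  define k1 where k1: "k1 = Re (fst K)"
  define k2 where k2: "k2 = Im (fst K)"
  define k3 where k3: "k3 = fst (snd K)"
  note k = k1 k2 k3
  define x1 where x1: "x1 = Re (fst X)"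
  define x2 where x2: "x2 = Im (fst X)"
  define x3 where x3: "x3 = fst (snd X)"
  note x = x1 x2 x3
  define n1 where n1: "n1 = k2 * x3 - k3 * x2"
  define n2 where n2: "n2 = k3 * x1 - k1 * x3"
  define n3 where n3: "n3 = k1 * x2 - k2 * x1"
  note n = n1 n2 n3
  note PE = linear_form_expand[OF P(1,2)] and QE = linear_form_expand[OF Q(1,2)]
  have pr: "of_real n1 * G e2 = of_real n2 * G e1" "of_real n1 * G e3 = of_real n3 * G e1"
    "of_real n2 * G e3 = of_real n3 * G e2"
    if G: "linear G" "G e4 = 0" "G K = 0" "G X = 0" for G :: "point \<Rightarrow> complex"
  proof -
    have GK: "of_real k1 * G e1 + of_real k2 * G e2 + of_real k3 * G e3 = 0"
      using linear_form_expand[OF G(1,2), of K] G(3) by (simp add: k)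
    have GX: "of_real x1 * G e1 + of_real x2 * G e2 + of_real x3 * G e3 = 0"
      using linear_form_expand[OF G(1,2), of X] G(4) by (simp add: x)
    have "of_real n1 * G e2 - of_real n2 * G e1 =
        of_real x3 * (of_real k1 * G e1 + of_real k2 * G e2 + of_real k3 * G e3)
        - of_real k3 * (of_real x1 * G e1 + of_real x2 * G e2 + of_real x3 * G e3)"
      by (simp add: n algebra_simps)
    then show "of_real n1 * G e2 = of_real n2 * G e1" unfolding GK GX by simp
    have "of_real n1 * G e3 - of_real n3 * G e1 =
        of_real k2 * (of_real x1 * G e1 + of_real x2 * G e2 + of_real x3 * G e3)
        - of_real x2 * (of_real k1 * G e1 + of_real k2 * G e2 + of_real k3 * G e3)"
      by (simp add: n algebra_simps)
    then show "of_real n1 * G e3 = of_real n3 * G e1" unfolding GK GX by simp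
    have "of_real n2 * G e3 - of_real n3 * G e2 =
        of_real x1 * (of_real k1 * G e1 + of_real k2 * G e2 + of_real k3 * G e3)
        - of_real k1 * (of_real x1 * G e1 + of_real x2 * G e2 + of_real x3 * G e3)"
      by (simp add: n algebra_simps)
    then show "of_real n2 * G e3 = of_real n3 * G e2" unfolding GK GX by simp
  qed
  note p = pr[OF P] and q = pr[OF Q]
  define m12 where "m12 = P e1 * Q e2 - P e2 * Q e1"
  define m13 where "m13 = P e1 * Q e3 - P e3 * Q e1"
  define m23 where "m23 = P e2 * Q e3 - P e3 * Q e2"
  have minors: "m12 \<noteq> 0 \<or> m13 \<noteq> 0 \<or> m23 \<noteq> 0"
  proof (rule ccontr)
    assume 0: "\<not> ?thesis"
    have "wedge2 P Q V W = of_real (Re (fst V) * Im (fst W) - Im (fst V) * Re (fst W)) * m12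
      + of_real (Re (fst V) * fst (snd W) - fst (snd V) * Re (fst W)) * m13
      + of_real (Im (fst V) * fst (snd W) - fst (snd V) * Im (fst W)) * m23" for V W
      unfolding wedge2_def PE[of V] PE[of W] QE[of V] QE[of W] m12_def m13_def m23_def
      by (simp add: algebra_simps)
    then show False using PQ 0 by (simp add: fun_eq_iff)
  qed
  \<comment> \<open>If \<open>n\<close> is nonzero, \<open>Pj\<close> and \<open>Qj\<close> are the
    same multiple of \<open>Pi\<close> and \<open>Qi\<close>, and so are \<open>Pk\<close> and
    \<open>Qk\<close>; hence the minor is zero.\<close>
  have sq: "n = 0 \<or> Pj * Qk - Pk * Qj = 0"
    if "n * Pj = nj * Pi" "n * Pk = nk * Pi" "n * Qj = nj * Qi" "n * Qk = nk * Qi"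
    for n Pi Pj Pk Qi Qj Qk nj nk :: complex
  proof -
    have "n * n * (Pj * Qk - Pk * Qj) = (n * Pj) * (n * Qk) - (n * Pk) * (n * Qj)"
      by (simp add: algebra_simps)
    also have "\<dots> = 0" unfolding that by (simp add: algebra_simps)
    finally show ?thesis by simp
  qed
  \<comment> \<open>All nine combinations of a component of the cross product with one of the three
    minors.\<close>
  note s = sq[OF refl p(1) refl q(1)] sq[OF refl p(2) refl q(2)] sq[OF p(1,2) q(1,2)]
    sq[OF p(1)[symmetric] refl q(1)[symmetric] refl] sq[OF p(1)[symmetric] p(3) q(1)[symmetric] q(3)]
    sq[OF refl p(3) refl q(3)]
    sq[OF p(2)[symmetric] p(3)[symmetric] q(2)[symmetric] q(3)[symmetric]]
    sq[OF p(2)[symmetric] refl q(2)[symmetric] refl] sq[OF p(3)[symmetric] refl q(3)[symmetric] refl]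
  have "n1 = 0" "n2 = 0" "n3 = 0"
    using s minors unfolding m12_def m13_def m23_def by auto
  then have cr: "k2 * x3 = k3 * x2" "k3 * x1 = k1 * x3" "k1 * x2 = k2 * x1"
    using n by simp_all
  have "\<exists>c. x1 = c * k1 \<and> x2 = c * k2 \<and> x3 = c * k3"
  proof -
    consider "k1 \<noteq> 0" | "k2 \<noteq> 0" | "k3 \<noteq> 0"
      using K unfolding k complex_eq_iff[of "fst K"] by auto
    then show ?thesis
    proof cases
      case 1 then show ?thesis using cr by (intro exI[of _ "x1 / k1"]) (simp add: field_simps)
    next
      case 2 then show ?thesis using cr by (intro exI[of _ "x2 / k2"]) (simp add: field_simps)
    next
      case 3 then show ?thesis using cr by (intro exI[of _ "x3 / k3"]) (simp add: field_simps)
    qed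
  qed
  then show ?thesis by (auto simp: k x complex_eq_iff)
qed

text \<open>\<open>u\<close> is a real coordinate, so its derivative commutes with conjugation;
  \<open>H\<close> names the conjugate as a function to which \<open>zu_diff\<close>
  applies.\<close>

lemma pu_cnj:
  assumes "open S" "p \<in> S" "\<And>p. p \<in> S \<Longrightarrow> cnj (G p) = H p" "zu_diff G p" "zu_diff H p"
  shows "cnj (pu G p) = pu H p"
proof -
  have 1: "((\<lambda>p. cnj (G p)) has_derivative (\<lambda>X. cnj (pz G p * fst X + pu G p * of_real (fst (snd X))))) (at p)"
    by (intro has_derivative_cnj zu_diff_has_derivative assms)
  have 2: "((\<lambda>p. cnj (G p)) has_derivative (\<lambda>X. pz H p * fst X + pu H p * of_real (fst (snd X)))) (at p)"
    by (rule has_derivative_transform_within_open[OF zu_diff_has_derivative[OF assms(5)] assms(1,2)])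
      (simp add: assms(3))
  have "(\<lambda>X::point. cnj (pz G p * fst X + pu G p * of_real (fst (snd X)))) =
      (\<lambda>X. pz H p * fst X + pu H p * of_real (fst (snd X)))"
    using frechet_derivative_at[OF 1] frechet_derivative_at[OF 2] by simp
  from fun_cong[OF this, of e3] show ?thesis by simp
qed

lemma killing_on_lincomb:
  assumes X: "killing_on g V X" and Y: "killing_on g V Y" and V: "open V"
    and lin: "\<And>p W. p \<in> V \<Longrightarrow> linear (\<lambda>Y. g p Y W)" "\<And>p Y. p \<in> V \<Longrightarrow> linear (g p Y)"
    and dg: "\<And>p Y W. p \<in> V \<Longrightarrow> (\<lambda>q. g q Y W) differentiable (at p)"
  shows "killing_on g V (\<lambda>p. X p - c *\<^sub>R Y p)"
  unfolding killing_on_def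
proof (intro conjI ballI allI)
  have sm: "smooth_on X V" "smooth_on Y V" using X Y by (auto simp: killing_on_def)
  have "smooth_on (\<lambda>p. X p + (- c) *\<^sub>R Y p) V"
    by (intro smooth_on_add V sm smooth_on_bounded_linear[OF bounded_linear_scaleR_right])
  then show "smooth_on (\<lambda>p. X p - c *\<^sub>R Y p) V" by simp
  fix p A B assume p: "p \<in> V"
  have "((\<lambda>p. X p - c *\<^sub>R Y p) has_derivative
      (\<lambda>v. frechet_derivative X (at p) v - c *\<^sub>R frechet_derivative Y (at p) v)) (at p)"
    by (intro has_derivative_diff has_derivative_scaleR_right smooth_on_has_derivative[OF sm(1) p]
        smooth_on_has_derivative[OF sm(2) p])
  note D = frechet_derivative_at[OF this, symmetric]
  have "lie_derivative_metric g (\<lambda>p. X p - c *\<^sub>R Y p) p A B =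
      lie_derivative_metric g X p A B - c * lie_derivative_metric g Y p A B"
    unfolding lie_derivative_metric_def D
      linear_diff[OF linear_frechet_derivative[OF dg[OF p]]]
      linear_scale[OF linear_frechet_derivative[OF dg[OF p]]]
      linear_diff[OF lin(1)[OF p]] linear_scale[OF lin(1)[OF p]]
      linear_diff[OF lin(2)[OF p]] linear_scale[OF lin(2)[OF p]]
    by (simp add: algebra_simps)
  then show "lie_derivative_metric g (\<lambda>p. X p - c *\<^sub>R Y p) p A B = 0"
    using X Y p by (simp add: killing_on_def)
qed

section \<open>Existence of a second Killing field\<close>

locale pp_independent = pp_dependent +
  assumes indep: "\<And>p. p \<in> M \<Longrightarrow>
      wedge2 (differential al p) (differential mu p) \<noteq> (\<lambda>X Y. 0)"
begin

lemma linear_differentials: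
  assumes p: "p \<in> M"
  shows "linear (differential al p)" "linear (differential mu p)" "linear (differential nu p)"
    "differential al p e4 = 0" "differential mu p e4 = 0" "differential nu p e4 = 0"
proof -
  show "linear (differential al p)" "linear (differential mu p)" "linear (differential nu p)"
    unfolding differential_def
    by (intro linear_frechet_derivative; use al_differential[OF p] mu_differential[OF p] nu_differential[OF p]
        differentiable_def in blast)+
  show "differential al p e4 = 0" "differential mu p e4 = 0" "differential nu p e4 = 0"
    by (simp_all add: differentials p \<theta>_def)
qed

text \<open>A direction annihilating \<alpha> and \<mu> also annihilates \<nu>. This relation is the
  sum of a holomorphic and an antiholomorphic term, and the \<zeta>-derivative of the former is the
  differential equation for \<open>c\<close>.\<close>

lemma c_equation_of_wedge3:
  assumes w3: "\<And>p. p \<in> M \<Longrightarrow>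
      wedge3 (differential al p) (differential mu p) (differential nu p) = (\<lambda>X Y W. 0)"
    and B: "open B" "B \<subseteq> M" "p \<in> B" and \<kappa>: "\<And>p. p \<in> B \<Longrightarrow> \<kappa> p = k" and k: "k \<noteq> - 1"
  shows "pz q p * pu (pu (pz q)) p = 2 * (pu (pz q) p * pu (pz q) p)" "pz q p \<noteq> 0"
proof -
  define c where "c = pz q"
  define c' where "c' = pu c"
  have BM: "p \<in> M" if "p \<in> B" for p using that B by blast
  have zc: "zu_diff c p" "zu_diff c' p" "pz c p = 0" "pz c' p = 0"
    "pu c p = c' p" if "p \<in> B" for p
    using zd[OF BM[OF that]] partials_zero[OF BM[OF that]] by (simp_all add: c_def c'_def)
  have kk: "k * cnj k = 1" using \<kappa>_c_constraints(1)[OF BM[OF B(3)]] \<kappa>[OF B(3)] by simp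
  have k0: "k \<noteq> 0" using kk by auto
  have kc: "cnj k = 1 / k" using kk k0 by (simp add: field_simps)
  have cc: "cnj (c p) = - cnj k * c p" if "p \<in> B" for p
    using \<kappa>_c_constraints(2)[OF BM[OF that]] \<kappa>[OF that] by (simp add: c_def)
  have cc': "cnj (c' p) = - cnj k * c' p" if "p \<in> B" for p
  proof -
    have "cnj (pu c p) = pu (\<lambda>p. - cnj k * c p) p"
      by (rule pu_cnj[OF B(1) that cc]) (simp_all add: zu_simps zc that)
    then show ?thesis by (simp add: zu_simps zc that)
  qed
  \<comment> \<open>For the real choice \<open>\<i> * (1 + cnj k) * c p\<close> of \<xi>, this
    \<sigma> solves the two relations \<open>k * \<sigma> + c * \<xi> = cnj \<sigma>\<close> and
    \<open>c' * \<xi> = c * (\<sigma> + cnj \<sigma>)\<close>, and \<sigma>' is its conjugate. Here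
    \<sigma> may still vary with \<open>u\<close>.\<close>
  define \<sigma> where "\<sigma> = (\<lambda>p. \<i> * cnj k * (c' p - c p * c p))"
  define \<sigma>' where "\<sigma>' = (\<lambda>p. \<i> * (c' p + cnj k * (c p * c p)))"
  define \<xi> where "\<xi> = (\<lambda>p. \<i> * (1 + cnj k) * c p)"
  define A where "A = (\<lambda>p. m p * \<sigma> p + q p * \<xi> p)"
  have \<sigma>c: "cnj (\<sigma> p) = \<sigma>' p" "cnj (\<sigma>' p) = \<sigma> p" "cnj (\<xi> p) = \<xi> p"
    "k * \<sigma> p + c p * \<xi> p = \<sigma>' p" if "p \<in> B" for p
    using k0 unfolding \<sigma>_def \<sigma>'_def \<xi>_def
    by (simp_all add: cc cc' that kc field_simps)
  have \<xi>_of_real: "of_real (Re (\<xi> p)) = \<xi> p" if "p \<in> B" for p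
    using \<sigma>c(3)[OF that] by (simp add: complex_eq_iff)
  have \<theta>: "\<theta> p (A p, Re (\<xi> p), 0) = \<sigma> p" if "p \<in> B" for p
    using az[OF BM[OF that]] by (simp add: \<theta>_def A_def m_def \<xi>_of_real that)
  have zs: "zu_diff \<sigma> p" "zu_diff \<sigma>' p" "zu_diff \<xi> p" "pz \<sigma> p = 0" "pz \<sigma>' p = 0" "pz \<xi> p = 0"
    if "p \<in> B" for p
    unfolding \<sigma>_def \<sigma>'_def \<xi>_def by (simp_all add: zu_simps zc that)
  have zA: "zu_diff A p" "pz A p = pz m p * \<sigma> p + pz q p * \<xi> p" if "p \<in> B" for p
    unfolding A_def by (simp_all add: zu_simps zs zd BM that)
  \<comment> \<open>Up to an exponential factor the value of d\<nu> on the field is \<open>G\<close>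
    plus the conjugate of \<open>H\<close>, both holomorphic in \<zeta>.\<close>
  define G where "G = (\<lambda>p. - (\<sigma> p + 3 * \<sigma>' p) * n0 p + pz n0 p * A p + pu n0 p * \<xi> p)"
  define H where "H = (\<lambda>p. - (\<sigma>' p + 3 * \<sigma> p) * pz f p + pz (pz f) p * A p + pu (pz f) p * \<xi> p)"
  have GH: "G p + cnj (H p) = 0" if p: "p \<in> B" for p
  proof -
    note d = differentials[OF BM[OF p], of "(A p, Re (\<xi> p), 0)"]
    have al0: "differential al p (A p, Re (\<xi> p), 0) = 0"
      unfolding d(1) \<theta>[OF p]
      by (simp add: \<kappa> p \<xi>_of_real \<sigma>c)
        (simp add: \<sigma>_def \<sigma>'_def \<xi>_def c_def cc[OF p, unfolded c_def] algebra_simps)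
    have mu0: "differential mu p (A p, Re (\<xi> p), 0) = 0"
      unfolding d(2) \<theta>[OF p]
      by (simp add: p \<xi>_of_real \<sigma>c partials_zero BM)
        (simp add: \<sigma>_def \<sigma>'_def \<xi>_def c_def c'_def algebra_simps)
    have "differential nu p (A p, Re (\<xi> p), 0) = 0"
      by (rule wedge3_kernel[OF indep w3 al0 mu0]) (use BM p in auto)
    then have "- (\<sigma> p + 3 * \<sigma>' p) * (n0 p + cnj (pz f p)) + (pz n0 p * A p + pu n0 p * \<xi> p)
      + cnj (pz (pz f) p * A p + pu (pz f) p * \<xi> p) = 0"
      unfolding d(3) \<theta>[OF p] by (simp add: \<xi>_of_real p \<sigma>c)
    then show ?thesis unfolding G_def H_def by (simp add: \<sigma>c p algebra_simps)
  qed
  have zGH: "zu_diff G p" "zu_diff H p" if "p \<in> B" for p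
    unfolding G_def H_def by (simp_all add: zu_simps zs zA zd BM that)
  have ode: "c p * pu c' p = 2 * (c' p * c' p)" if p: "p \<in> B" for p
  proof -
    have km: "pz m p = k - 1"
      using \<kappa>[OF p] by (simp add: \<kappa>_def eq_diff_eq add.commute)
    have "pz G p = 0"
      by (rule pz_zero_if_add_cnj_zero(1)[OF B(1) p GH zGH[OF p]])
    then have "- (\<sigma> p + 3 * \<sigma>' p) * (c' p + c p * c p)
        + (c' p + c p * c p) * ((k - 1) * \<sigma> p + c p * \<xi> p)
        + (pu c' p + 2 * c p * c' p) * \<xi> p = 0"
      unfolding G_def
      by (simp add: zu_simps zs zA zd BM p n0_partials n0_second_partials c_def c'_def km)
    moreover have "(k - 1) * \<sigma> p + c p * \<xi> p = \<sigma>' p - \<sigma> p"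
      using \<sigma>c(4)[OF p] by (simp add: algebra_simps)
    ultimately have "- (\<sigma> p + 3 * \<sigma>' p) * (c' p + c p * c p)
        + (c' p + c p * c p) * (\<sigma>' p - \<sigma> p)
        + (pu c' p + 2 * c p * c' p) * \<xi> p = 0"
      by simp
    then have "(\<i> * (1 + cnj k)) * (c p * pu c' p - 2 * (c' p * c' p)) = 0"
      unfolding \<sigma>_def \<sigma>'_def \<xi>_def by (simp add: algebra_simps)
    moreover have "1 + cnj k \<noteq> 0"
      using k by (metis add_eq_0_iff complex_cnj_cnj complex_cnj_minus complex_cnj_one)
    ultimately show ?thesis by simp
  qed
  show "pz q p * pu (pu (pz q)) p = 2 * (pu (pz q) p * pu (pz q) p)"
    using ode[OF B(3)] by (simp add: c_def c'_def)
  \<comment> \<open>Otherwise the equation gives \<open>c' p = 0\<close> as well and the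
    differential of \<mu> vanishes, against \<open>indep\<close>.\<close>
  show "pz q p \<noteq> 0"
  proof
    assume 0: "pz q p = 0"
    then have "pu (pz q) p = 0" using ode[OF B(3)] by (simp add: c_def c'_def)
    then have "differential mu p X = 0" for X
      using 0 by (simp add: differentials BM B(3) partials_zero)
    then show False using indep[OF BM[OF B(3)]] by (simp add: wedge2_def)
  qed
qed

lemma killing_data_exists:
  assumes w3: "\<And>p. p \<in> M \<Longrightarrow>
      wedge3 (differential al p) (differential mu p) (differential nu p) = (\<lambda>X Y W. 0)"
    and B: "open B" "connected B" "B \<subseteq> M" "p0 \<in> B"
  shows "\<exists>A \<xi> \<sigma>. killing_data M F a B A \<xi> \<sigma> \<and> (A p0 \<noteq> 0 \<or> \<xi> p0 \<noteq> 0)"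
proof -
  have BM: "p \<in> M" if "p \<in> B" for p using that B by blast
  define k where "k = \<kappa> p0"
  have \<kappa>: "\<kappa> p = k" if "p \<in> B" for p
    unfolding k_def
    by (rule zero_partials_const[OF B(1,2) _ _ _ that B(4)]) (simp_all add: zd partials_zero BM)
  have km: "pz m p = k - 1" if "p \<in> B" for p
    using \<kappa>[OF that] unfolding \<kappa>_def by (simp add: algebra_simps)
  have hsB: "hol_smooth_on G B" if "hol_smooth_on G M" for G
    using that B hol_smooth_on_subset by blast
  show ?thesis
  proof (cases "k = - 1")
    case True
    \<comment> \<open>Here \<open>pz m\<close> is -2, so the field has \<zeta>-derivative
      \<open>- 2 * \<i>\<close>, which is \<open>cnj \<sigma> - \<sigma>\<close> for
      \<open>\<sigma> = \<i>\<close>.\<close>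
    have "killing_data M F a B (\<lambda>p. m p * \<i>) (\<lambda>p. 0) \<i>"
      by unfold_locales
        (use True in \<open>simp_all add: B hol_smooth_intros hsB hs zu_simps zd BM km\<close>)
    moreover have "m p0 * \<i> \<noteq> 0" using az[OF BM[OF B(4)]] by (simp add: m_def)
    ultimately show ?thesis by blast
  next
    case False
    define c where "c = pz q"
    define c' where "c' = pu c"
    have zc: "zu_diff c p" "zu_diff c' p" "pz c p = 0" "pz c' p = 0" "pu c p = c' p" if "p \<in> B" for p
      using zd[OF BM[OF that]] partials_zero[OF BM[OF that]] by (simp_all add: c_def c'_def)
    have ode: "c p * pu c' p = 2 * (c' p * c' p)" and c0: "c p \<noteq> 0" if "p \<in> B" for p
      using c_equation_of_wedge3[OF w3 B(1,3) that \<kappa> False] by (simp_all add: c_def c'_def)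
    have kk: "k * cnj k = 1" using \<kappa>_c_constraints(1)[OF BM[OF B(4)]] \<kappa>[OF B(4)] by simp
    have k0: "k \<noteq> 0" using kk by auto
    have kc: "cnj k = 1 / k" using kk k0 by (simp add: field_simps)
    have cc: "cnj (c p) = - cnj k * c p" if "p \<in> B" for p
      using \<kappa>_c_constraints(2)[OF BM[OF that]] \<kappa>[OF that] by (simp add: c_def)
    have cc': "cnj (c' p) = - cnj k * c' p" if "p \<in> B" for p
    proof -
      have "cnj (pu c p) = pu (\<lambda>p. - cnj k * c p) p"
        by (rule pu_cnj[OF B(1) that cc]) (simp_all add: zu_simps zc that)
      then show ?thesis by (simp add: zu_simps zc that)
    qed
    define s where "s = \<i> * (1 + cnj k)"
    have "1 + cnj k \<noteq> 0"
      using False by (metis add_eq_0_iff complex_cnj_cnj complex_cnj_minus complex_cnj_one)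
    then have s0: "s \<noteq> 0" unfolding s_def by (intro no_zero_divisors) simp_all
    have sc: "cnj s = - k * s" using k0 by (simp add: s_def kc field_simps)
    \<comment> \<open>The direction used in \<open>c_equation_of_wedge3\<close>, divided by the
      square of its \<xi>-component \<open>s * c p\<close>. With this factor \<xi> obeys the law for
      \<open>pu \<xi>\<close>, and \<open>g\<close> is constant because its only variable part is a
      multiple of the derivative of \<open>1 / c\<close>.\<close>
    define \<xi> where "\<xi> = (\<lambda>p. 1 / (s * c p))"
    define g where "g = (\<lambda>p. \<i> * cnj k / (s * s) * (c' p / (c p * c p) - 1))"
    define \<sigma> where "\<sigma> = g p0"
    have "g p = \<sigma>" if "p \<in> B" for p
      unfolding \<sigma>_def
    proof (rule zero_partials_const[OF B(1,2) _ _ _ that B(4)])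
      fix p assume p: "p \<in> B"
      show "zu_diff g p" "pz g p = 0"
        unfolding g_def using c0[OF p] s0 by (simp_all add: zu_simps zc p)
      have "pu g p = \<i> * cnj k / (s * s) * ((c p * pu c' p - 2 * (c' p * c' p)) / (c p * c p * c p))"
        unfolding g_def using c0[OF p] s0
        by (simp add: zu_simps zc p field_simps power2_eq_square)
      then show "pu g p = 0" using ode[OF p] by simp
    qed
    then have \<sigma>: "\<sigma> = \<i> * cnj k / (s * s) * (c' p / (c p * c p) - 1)" if "p \<in> B" for p
      using that by (simp add: g_def)
    have \<sigma>c: "cnj \<sigma> = \<i> / (s * s) * (c' p / (c p * c p) + cnj k)" if "p \<in> B" for p
      unfolding \<sigma>[OF that] using k0 s0 c0[OF that]
      by (simp add: cc cc' sc that kc field_simps)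
    have "killing_data M F a B (\<lambda>p. m p * \<sigma> + q p * \<xi> p) \<xi> \<sigma>"
    proof
      show \<xi>_hs: "hol_smooth_on \<xi> B"
        unfolding \<xi>_def c_def
        by (intro hol_smooth_intros B hsB hs) (use s0 c0 in \<open>simp add: c_def\<close>)
      show "hol_smooth_on (\<lambda>p. m p * \<sigma> + q p * \<xi> p) B"
        by (intro hol_smooth_intros B hsB hs \<xi>_hs)
      fix p assume p: "p \<in> B"
      show "cnj (\<xi> p) = \<xi> p"
        using k0 by (simp add: \<xi>_def cc sc p kc)
      have "\<sigma> + cnj \<sigma> = (\<i> * (1 + cnj k)) / (s * s) * (c' p / (c p * c p))"
        unfolding \<sigma>c[OF p] unfolding \<sigma>[OF p] by (simp add: algebra_simps add_divide_distrib)
      then have sum: "\<sigma> + cnj \<sigma> = s / (s * s) * (c' p / (c p * c p))"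
        by (simp only: s_def)
      show x: "pz \<xi> p = 0" "pu \<xi> p = - (\<sigma> + cnj \<sigma>)"
        unfolding sum \<xi>_def using s0 c0[OF p]
        by (simp_all add: zu_simps zc p power2_eq_square)
      have "pz (\<lambda>p. m p * \<sigma> + q p * \<xi> p) p = (k - 1) * \<sigma> + c p * \<xi> p"
        by (simp add: zu_simps zd BM p hol_smooth_on_zu_diff[OF \<xi>_hs p] x km c_def)
      also have "\<dots> = cnj \<sigma> - \<sigma>"
        unfolding \<sigma>c[OF p] using s0 c0[OF p] k0
        by (simp add: \<sigma>[OF p] \<xi>_def kc field_simps power2_eq_square) (simp add: s_def kc field_simps)
      finally show "pz (\<lambda>p. m p * \<sigma> + q p * \<xi> p) p = cnj \<sigma> - \<sigma>" .
    qed (use B in auto)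
    moreover have "\<xi> p0 \<noteq> 0" using s0 c0[OF B(4)] by (simp add: \<xi>_def)
    ultimately show ?thesis by blast
  qed
qed

end

section \<open>Linear combinations of Killing fields and the field along v\<close>

context pp_frame
begin

lemma pp_metric_expand:
  "pp_metric F p Y W = (2 * Re (fst Y * cnj (fst W)) - (fst (snd Y) * snd (snd W) + snd (snd Y) * fst (snd W)))
     + (- 4 * fst (snd Y) * fst (snd W)) * Re (f p)"
  by (cases p; cases Y; cases W) simp

lemma killing_on_lincomb_pp:
  assumes "killing_on (pp_metric F) V X" "killing_on (pp_metric F) V Y" "open V" "V \<subseteq> M"
  shows "killing_on (pp_metric F) V (\<lambda>p. X p - c *\<^sub>R Y p)"
proof (rule killing_on_lincomb[OF assms(1-3)])
  fix p Y W assume p: "p \<in> V"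
  show "linear (\<lambda>Y. pp_metric F p Y W)" "linear (pp_metric F p Y)"
    by (intro linearI; simp add: pp_metric_expand algebra_simps)+
  show "(\<lambda>q. pp_metric F q Y W) differentiable (at p)"
    unfolding pp_metric_expand
    by (intro differentiable_add differentiable_mult differentiable_const dd_zu(3) zd subsetD[OF assms(4) p])
qed

lemma killing_e4:
  assumes "open V" "V \<subseteq> M"
  shows "killing_on (pp_metric F) V (\<lambda>p. e4)"
  unfolding killing_on_def
proof (intro conjI ballI allI)
  show "smooth_on (\<lambda>p. e4) V" by (rule smooth_on_const[OF assms(1)])
  fix p Y W assume "p \<in> V"
  then have p: "p \<in> M" using assms by blast
  show "lie_derivative_metric (pp_metric F) (\<lambda>p. e4) p Y W = 0"
    using lie_derivative_pp_metric[OF zd(5)[OF p], of "\<lambda>p. 0" "\<lambda>V. 0" "\<lambda>p. 0" "\<lambda>V. 0" "\<lambda>p. 1" "\<lambda>V. 0"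
        "fst Y" "fst (snd Y)" "snd (snd Y)" "fst W" "fst (snd W)" "snd (snd W)"]
    by simp
qed

end

section \<open>The isometry dimension\<close>

context pp_independent
begin

lemma killing_kills:
  assumes K: "killing_on (pp_metric F) B X" and B: "open B" "connected B" "B \<subseteq> M" "p \<in> B"
  shows "differential al p (X p) = 0" "differential mu p (X p) = 0" "differential nu p (X p) = 0"
proof -
  obtain \<sigma> where k: "killing_data M F a B (\<lambda>p. fst (X p)) (\<lambda>p. of_real (fst (snd (X p)))) \<sigma>"
    "\<forall>p\<in>B. pz (pz f) p * fst (X p) + pu (pz f) p * of_real (fst (snd (X p)))
       - (cnj \<sigma> + 3 * \<sigma>) * pz f p + cnj (pu (pu (\<lambda>p. fst (X p))) p) = 0"
    by (rule killing_data_of_killing[OF K B])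
  interpret kd: killing_data M F a B "\<lambda>p. fst (X p)" "\<lambda>p. of_real (fst (snd (X p)))" \<sigma>
    by (rule k(1))
  show "differential al p (X p) = 0" "differential mu p (X p) = 0" "differential nu p (X p) = 0"
    using kd.invariants_killed[OF B(4), of "snd (snd (X p))"] k(2) B(4) by simp_all
qed

text \<open>If both basis fields projected to zero at \<open>p\<close>,
  \<open>killing_zero_projection\<close> would make them multiples of \<open>e4\<close> and thus
  dependent. So one of them is, at \<open>p\<close>, a common kernel vector of the three
  differentials transversal to \<open>e4\<close>.\<close>

lemma wedge3_zero_of_dimension_two:
  assumes dim: "isometry_dimension (pp_metric F) M p 2" and p: "p \<in> M"
  shows "wedge3 (differential al p) (differential mu p) (differential nu p) = (\<lambda>X Y W. 0)"
proof -
  obtain K :: "nat \<Rightarrow> point \<Rightarrow> point" where K': "\<forall>i<2. local_killing (pp_metric F) M p (K i)"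
    and ind': "\<forall>c. (\<forall>\<^sub>F q in nhds p. (\<Sum>i<2. c i *\<^sub>R K i q) = 0) \<longrightarrow> (\<forall>i<2. c i = (0::real))"
    using dim unfolding isometry_dimension_def by (elim exE conjE) (rule that)
  note K = K'[rule_format] and ind = ind'[THEN spec, THEN mp]
  obtain V0 V1 where V: "open V0" "p \<in> V0" "V0 \<subseteq> M" "killing_on (pp_metric F) V0 (K 0)"
    "open V1" "p \<in> V1" "V1 \<subseteq> M" "killing_on (pp_metric F) V1 (K 1)"
    using K[of 0] K[of 1] unfolding local_killing_def by auto
  have "p \<in> V0 \<inter> V1" using V by simp
  then obtain r where r: "r > 0" "ball p r \<subseteq> V0 \<inter> V1"
    using openE[OF open_Int[OF V(1,5)]] by blast
  define B where "B = ball p r"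
  have B: "open B" "connected B" "B \<subseteq> M" "p \<in> B"
    using r V by (auto simp: B_def)
  have kB: "killing_on (pp_metric F) B (K i)" if "i < 2" for i
    using that r V(4,8) killing_on_subset unfolding B_def
    by (cases "i = 0") (auto simp: less_2_cases_iff)
  have "\<exists>i<2. fst (K i p) \<noteq> 0 \<or> fst (snd (K i p)) \<noteq> 0"
  proof (rule ccontr)
    assume "\<not> ?thesis"
    then have "\<exists>c. \<forall>q\<in>B. K i q = c *\<^sub>R e4" if "i < 2" for i
      using killing_zero_projection[OF kB[OF that] B] that by blast
    then obtain c where c: "\<And>i q. i < 2 \<Longrightarrow> q \<in> B \<Longrightarrow> K i q = c i *\<^sub>R e4" by metis
    have ev: "\<forall>\<^sub>F q in nhds p. (\<Sum>i<2. d i *\<^sub>R K i q) = 0" if "d 0 * c 0 + d 1 * c 1 = 0" for d :: "nat \<Rightarrow> real"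
    proof (rule eventually_nhds_in_open[OF B(1,4), THEN eventually_mono])
      fix q assume "q \<in> B"
      then have "(\<Sum>i<2. d i *\<^sub>R K i q) = (d 0 * c 0 + d 1 * c 1) *\<^sub>R e4"
        using c[of 0 q] c[of 1 q] by (simp add: numeral_2_eq_2 algebra_simps)
      then show "(\<Sum>i<2. d i *\<^sub>R K i q) = 0" using that by (simp add: zero_prod_def)
    qed
    \<comment> \<open>The relation with coefficients \<open>c 1\<close> and \<open>- c 0\<close>
      forces \<open>c 1 = 0\<close>; then \<open>K 1\<close> vanishes near \<open>p\<close>, which
      is again a nontrivial relation.\<close>
    have "c 1 = 0"
      using ind[OF ev[of "\<lambda>i. if i = 0 then c 1 else - c 0"], THEN spec, of 0] by simp
    then show False
      using ind[OF ev[of "\<lambda>i. if i = 0 then 0 else 1"], THEN spec, of 1] by simp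
  qed
  then obtain i where i: "i < 2" "fst (K i p) \<noteq> 0 \<or> fst (snd (K i p)) \<noteq> 0" by blast
  show ?thesis
    using wedge3_zero_if_common_kernel[OF _ _ _ _ _ _ _ _ _ i(2)] linear_differentials[OF p]
      killing_kills[OF kB[OF i(1)] B] by blast
qed

text \<open>A basis consists of \<open>e4\<close> and the field from \<open>exists_killing\<close>.
  Any other Killing field is parallel to the latter at \<open>p\<close> modulo \<open>e4\<close>,
  since both lie in the common kernel of the independent differentials of \<alpha> and
  \<mu>.\<close>

lemma dimension_two_of_wedge3:
  assumes w3: "\<And>p. p \<in> M \<Longrightarrow>
      wedge3 (differential al p) (differential mu p) (differential nu p) = (\<lambda>X Y W. 0)"
    and p: "p \<in> M"
  shows "isometry_dimension (pp_metric F) M p 2"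
proof -
  obtain r where r: "r > 0" "ball p r \<subseteq> M" using openE[OF open_M p] .
  obtain A \<xi> \<sigma> where kd: "killing_data M F a (ball p r) A \<xi> \<sigma>" and ne: "A p \<noteq> 0 \<or> \<xi> p \<noteq> 0"
    using killing_data_exists[OF w3, of "ball p r" p] r by auto
  interpret kd: killing_data M F a "ball p r" A \<xi> \<sigma> by (rule kd)
  \<comment> \<open>The vanishing of d\<nu> on the field is the integrability condition required by
    \<open>exists_killing\<close>.\<close>
  have eq: "pz (pz f) q * A q + pu (pz f) q * \<xi> q - (cnj \<sigma> + 3 * \<sigma>) * pz f q + cnj (pu (pu A) q) = 0"
    if "q \<in> ball p r" for q
  proof -
    have "differential nu q (A q, Re (\<xi> q), 0) = 0"
      using wedge3_kernel[OF indep w3 kd.invariants_killed(1,2)[OF that]] kd.BM[OF that] by blast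
    then show ?thesis
      unfolding kd.invariants_killed(3)[OF that]
      by (simp only: mult_eq_0_iff exp_not_eq_zero complex_cnj_zero_iff simp_thms)
  qed
  obtain h where h: "killing_on (pp_metric F) (ball p (r / 2)) (\<lambda>p. (A p, Re (\<xi> p), h p))"
    using kd.exists_killing[OF refl r(1) eq] by blast
  define X1 where "X1 = (\<lambda>p. (A p, Re (\<xi> p), h p))"
  define K where "K i = (if i = 0 then (\<lambda>p. e4) else X1)" for i :: nat
  define B where "B = ball p (r / 2)"
  have B: "open B" "p \<in> B" "B \<subseteq> M" using r by (auto simp: B_def)
  have X1: "killing_on (pp_metric F) B X1" using h by (simp add: X1_def B_def)
  have X1p: "fst (X1 p) \<noteq> 0 \<or> fst (snd (X1 p)) \<noteq> 0"
    using ne kd.\<xi>_real[of p] r by (auto simp: X1_def complex_eq_iff)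
  have S: "(\<Sum>i<2. c i *\<^sub>R K i q) = c 0 *\<^sub>R e4 + c 1 *\<^sub>R X1 q" for c q
    by (simp add: K_def numeral_2_eq_2)
  show ?thesis
    unfolding isometry_dimension_def
  proof (intro exI[of _ K] conjI allI impI)
    show "local_killing (pp_metric F) M p (K i)" for i
      unfolding local_killing_def K_def using B X1 killing_e4[OF B(1,3)] by auto
    fix c :: "nat \<Rightarrow> real" and i :: nat
    assume "\<forall>\<^sub>F q in nhds p. (\<Sum>i<2. c i *\<^sub>R K i q) = 0" and i: "i < 2"
    then have 0: "c 0 *\<^sub>R e4 + c 1 *\<^sub>R X1 p = 0"
      using eventually_nhds_x_imp_x unfolding S by blast
    then have "c 1 = 0"
      using X1p by (auto simp: prod_eq_iff)
    then have "c 0 = 0" "c 1 = 0" using 0 by (simp_all add: zero_prod_def)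
    then show "c i = 0" using i by (auto simp: less_2_cases_iff)
  next
    fix X assume "local_killing (pp_metric F) M p X"
    then obtain V where V: "open V" "p \<in> V" "V \<subseteq> M" "killing_on (pp_metric F) V X"
      unfolding local_killing_def by blast
    have "p \<in> V \<inter> B" using V B by simp
    then obtain s where s: "s > 0" "ball p s \<subseteq> V \<inter> B"
      using openE[OF open_Int[OF V(1) B(1)]] by blast
    define C where "C = ball p s"
    have C: "open C" "connected C" "C \<subseteq> M" "p \<in> C" using s V by (auto simp: C_def)
    have k: "killing_on (pp_metric F) C X" "killing_on (pp_metric F) C X1"
      using killing_on_subset[OF V(4)] killing_on_subset[OF X1] s unfolding C_def by auto
    obtain c where c: "fst (X p) = c *\<^sub>R fst (X1 p)" "fst (snd (X p)) = c * fst (snd (X1 p))"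
      using common_kernel_parallel[OF linear_differentials(1,4)[OF p] killing_kills(1)[OF k(2) C]
          killing_kills(1)[OF k(1) C] linear_differentials(2,5)[OF p] killing_kills(2)[OF k(2) C]
          killing_kills(2)[OF k(1) C] indep[OF p] X1p] by blast
    \<comment> \<open>The difference projects to zero at \<open>p\<close>, hence is a multiple of
      \<open>e4\<close> on the whole ball.\<close>
    obtain d where d: "\<And>q. q \<in> C \<Longrightarrow> X q - c *\<^sub>R X1 q = d *\<^sub>R e4"
      using killing_zero_projection[OF killing_on_lincomb_pp[OF k C(1,3), of c] C] c by auto
    have "\<forall>\<^sub>F q in nhds p. X q = (\<Sum>i<2. (if i = 0 then d else c) *\<^sub>R K i q)"
    proof (rule eventually_nhds_in_open[OF C(1,4), THEN eventually_mono])
      fix q assume "q \<in> C"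
      from d[OF this] show "X q = (\<Sum>i<2. (if i = 0 then d else c) *\<^sub>R K i q)"
        unfolding S by (simp add: diff_eq_eq)
    qed
    then show "\<exists>c. \<forall>\<^sub>F q in nhds p. X q = (\<Sum>i<2. c i *\<^sub>R K i q)" by (rule exI[of _ "\<lambda>i. if i = 0 then d else c"])
  qed
qed

end

section \<open>Partial derivatives in the chart (a, u)\<close>

lemma d_u_eq:
  assumes "((\<lambda>(w, u). Z w u) has_derivative D) (at (w, u))"
  shows "d_u Z w u = D (0, 1)"
proof -
  have "((\<lambda>t. (\<lambda>(w, u). Z w u) (w, t)) has_derivative (\<lambda>t. D (0, t))) (at u)"
    by (rule has_derivative_compose[of "\<lambda>t. (w, t)" "\<lambda>t. (0, t)" u UNIV, OF _ assms])
      (auto intro!: derivative_eq_intros)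
  moreover have "(\<lambda>t. D (0, t)) = (\<lambda>t. t *\<^sub>R D (0, 1))"
  proof
    fix t
    show "D (0, t) = t *\<^sub>R D (0, 1)"
      using linear_scale[OF has_derivative_linear[OF assms], of t "(0, 1)"] by simp
  qed
  ultimately have "((\<lambda>t. Z w t) has_vector_derivative D (0, 1)) (at u)"
    unfolding has_vector_derivative_def by simp
  then show ?thesis by (simp add: d_u_def vector_derivative_at)
qed

lemma d_z_eq:
  assumes "((\<lambda>(w, u). Z w u) has_derivative D) (at (w, u))" "\<And>x. D (x, 0) = c * x"
  shows "d_z Z w u = c"
proof -
  have "((\<lambda>x. (\<lambda>(w, u). Z w u) (x, u)) has_derivative (\<lambda>x. D (x, 0))) (at w)"
    by (rule has_derivative_compose[of "\<lambda>x. (x, u)" "\<lambda>x. (x, 0)" w UNIV, OF _ assms(1)])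
      (auto intro!: derivative_eq_intros)
  then have "((\<lambda>x. Z x u) has_field_derivative c) (at w)"
    by (simp add: assms(2) has_field_derivative_def)
  then show ?thesis by (simp add: d_z_def DERIV_imp_deriv)
qed

text \<open>The coordinate fields of the chart \<open>(a, u)\<close> are \<open>m \<partial>\<^sub>\<zeta>\<close> and \<open>\<partial>\<^sub>u + q \<partial>\<^sub>\<zeta>\<close>.\<close>

lemma (in pp_frame) derivative_in_au_coordinates:
  assumes G: "(G has_derivative D) (at (a p, fst (snd p)))"
    and eq: "\<And>p. p \<in> M \<Longrightarrow> G (a p, fst (snd p)) = h p" and h: "zu_diff h p" and p: "p \<in> M"
  shows "D (0, 1) = pz h p * q p + pu h p" "D (x, 0) = pz h p * m p * x"
proof -
  have "((\<lambda>p. (a p, fst (snd p))) has_derivative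
      (\<lambda>V. (pz a p * fst V + pu a p * of_real (fst (snd V)), fst (snd V)))) (at p)"
    by (intro has_derivative_Pair zu_diff_has_derivative zd p has_derivative_fst has_derivative_snd
        has_derivative_ident)
  from has_derivative_compose[OF this, of G D] G
  have 1: "((\<lambda>p. G (a p, fst (snd p))) has_derivative
      (\<lambda>V. D (pz a p * fst V + pu a p * of_real (fst (snd V)), fst (snd V)))) (at p)" by simp
  have 2: "((\<lambda>p. G (a p, fst (snd p))) has_derivative
      (\<lambda>V. pz h p * fst V + pu h p * of_real (fst (snd V)))) (at p)"
    by (rule has_derivative_transform_within_open[OF zu_diff_has_derivative[OF h] open_M p]) (simp add: eq)
  have e: "(\<lambda>V::point. D (pz a p * fst V + pu a p * of_real (fst (snd V)), fst (snd V))) =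
      (\<lambda>V. pz h p * fst V + pu h p * of_real (fst (snd V)))"
    using frechet_derivative_at[OF 1] frechet_derivative_at[OF 2] by simp
  show "D (0, 1) = pz h p * q p + pu h p"
    using fun_cong[OF e, of "(q p, 1, 0)"] by (simp add: pu_a p)
  show "D (x, 0) = pz h p * m p * x"
    using fun_cong[OF e, of "(m p * x, 0, 0)"] az[OF p] by (simp add: m_def)
qed

section \<open>The normalized coordinates \<open>(a, u)\<close>\<close>

lemma frechet_slice_field_derivative:
  assumes G: "((\<lambda>(z, u). G z u) has_derivative D) (at (z, u))"
    and g: "((\<lambda>w. G w u) has_field_derivative c) (at z)"
  shows "D (x, 0) = c * x"
proof -
  have 1: "((\<lambda>w. (\<lambda>(z, u). G z u) (w, u)) has_derivative (\<lambda>x. D (x, 0))) (at z)"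
    by (rule has_derivative_compose[of "\<lambda>w. (w, u)" "\<lambda>x. (x, 0)" z UNIV, OF _ G])
      (auto intro!: derivative_eq_intros)
  have 2: "((\<lambda>w. (\<lambda>(z, u). G z u) (w, u)) has_derivative (*) c) (at z)"
    using g by (simp add: has_field_derivative_def)
  show ?thesis
    using fun_cong[OF trans[OF frechet_derivative_at[OF 1] frechet_derivative_at[OF 2, symmetric]], of x] .
qed

lemma vacuum_lift:
  assumes "vacuum_pp_wave M f"
  shows "open M" "hol_smooth_on (lift f) M"
    "\<And>z u v. (z, u, v) \<in> M \<Longrightarrow> d_z f z u = pz (lift f) (z, u, v)"
    "hol_smooth_on (lift (d_z f)) M"
    "\<And>z u v. (z, u, v) \<in> M \<Longrightarrow> d_z (d_z f) z u = pz (pz (lift f)) (z, u, v)"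
proof -
  have M: "open M" and sm: "smooth_on (\<lambda>(z, u). f z u) (zu_domain M)"
    and hol: "\<And>u. (\<lambda>z. f z u) holomorphic_on {z. (z, u) \<in> zu_domain M}"
    using assms by (auto simp: vacuum_pp_wave_def)
  show "open M" by (rule M)
  show hs: "hol_smooth_on (lift f) M"
  proof (rule hol_smooth_on_lift[OF M sm])
    fix z u assume zu: "(z, u) \<in> zu_domain M"
    have "open ((\<lambda>w. (w, u)) -` zu_domain M)"
      by (rule open_vimage[OF open_zu_domain[OF M]]) (intro continuous_intros)
    moreover have "(\<lambda>w. (w, u)) -` zu_domain M = {z. (z, u) \<in> zu_domain M}" by auto
    ultimately have "(\<lambda>w. f w u) field_differentiable (at z)"
      using holomorphic_on_imp_differentiable_at[OF hol] zu by auto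
    then obtain c where "((\<lambda>w. f w u) has_field_derivative c) (at z)"
      by (auto simp: field_differentiable_def)
    then show "\<exists>c. \<forall>x. frechet_derivative (\<lambda>(z, u). f z u) (at (z, u)) (x, 0) = c * x"
      using frechet_slice_field_derivative[OF smooth_on_has_derivative[OF sm zu]] by blast
  qed
  show 1: "d_z f z u = pz (lift f) (z, u, v)" if "(z, u, v) \<in> M" for z u v
    by (rule lift_field_derivatives[OF hol_smooth_on_zu_diff[OF hs that]])
  show hs1: "hol_smooth_on (lift (d_z f)) M"
    by (rule hol_smooth_on_cong[OF hol_smooth_on_partials(1)[OF hs M] M]) (auto simp: 1)
  show "d_z (d_z f) z u = pz (pz (lift f)) (z, u, v)" if "(z, u, v) \<in> M" for z u v
  proof -
    have "d_z (d_z f) z u = pz (lift (d_z f)) (z, u, v)"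
      by (rule lift_field_derivatives[OF hol_smooth_on_zu_diff[OF hs1 that]])
    also have "\<dots> = pz (pz (lift f)) (z, u, v)"
      by (rule partials_cong[OF hs1 M _ that]) (auto simp: 1)
    finally show ?thesis .
  qed
qed

text \<open>The branch \<open>a\<close> is only assumed smooth; differentiating
  \<open>exp (4 * a z u)\<close>, which is holomorphic in \<zeta>, shows that the \<zeta>-derivative
  of \<open>a\<close> is complex linear.\<close>

lemma log_lift:
  assumes vac: "vacuum_pp_wave M f" and sm: "smooth_on (\<lambda>(z, u). a z u) (zu_domain M)"
    and exp: "\<And>z u. (z, u) \<in> zu_domain M \<Longrightarrow> exp (4 * a z u) = d_z (d_z f) z u"
  shows "hol_smooth_on (lift a) M"
proof (rule hol_smooth_on_lift[OF vacuum_lift(1)[OF vac] sm])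
  note V = vacuum_lift[OF vac]
  fix z u assume zu: "(z, u) \<in> zu_domain M"
  then obtain v where p: "(z, u, v) \<in> M" by (auto simp: zu_domain_def)
  define D where "D = frechet_derivative (\<lambda>(z, u). a z u) (at (z, u))"
  have D: "((\<lambda>(z, u). a z u) has_derivative D) (at (z, u))"
    unfolding D_def by (rule smooth_on_has_derivative[OF sm zu])
  have hs2: "hol_smooth_on (lift (d_z (d_z f))) M"
    by (rule hol_smooth_on_cong[OF hol_smooth_on_partials(1)[OF hol_smooth_on_partials(1)[OF V(2,1)] V(1)] V(1)])
      (auto simp: V(5))
  obtain c where c: "((\<lambda>w. d_z (d_z f) w u) has_field_derivative c) (at z)"
    using lift_field_derivatives(1)[OF hol_smooth_on_zu_diff[OF hs2 p]] by blast
  have "((\<lambda>w. (\<lambda>(z, u). a z u) (w, u)) has_derivative (\<lambda>x. D (x, 0))) (at z)"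
    by (rule has_derivative_compose[of "\<lambda>w. (w, u)" "\<lambda>x. (x, 0)" z UNIV, OF _ D])
      (auto intro!: derivative_eq_intros)
  then have "((\<lambda>w. 4 * a w u) has_derivative (\<lambda>x. 4 * D (x, 0))) (at z)"
    by (auto intro!: has_derivative_mult_right)
  from has_derivative_compose[OF this DERIV_exp[unfolded has_field_derivative_def]]
  have 1: "((\<lambda>w. exp (4 * a w u)) has_derivative (\<lambda>x. exp (4 * a z u) * (4 * D (x, 0)))) (at z)" .
  have "open ((\<lambda>w. (w, u)) -` zu_domain M)"
    by (rule open_vimage[OF open_zu_domain[OF V(1)]]) (intro continuous_intros)
  then have 2: "((\<lambda>w. exp (4 * a w u)) has_derivative (*) c) (at z)"
    by (rule has_derivative_transform_within_open[OF c[unfolded has_field_derivative_def]])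
      (use zu in \<open>auto simp: exp\<close>)
  have "exp (4 * a z u) * (4 * D (x, 0)) = c * x" for x
    using fun_cong[OF trans[OF frechet_derivative_at[OF 1] frechet_derivative_at[OF 2, symmetric]], of x] .
  then have "D (x, 0) = c / (4 * exp (4 * a z u)) * x" for x
    by (simp add: field_simps)
  then show "\<exists>c. \<forall>x. frechet_derivative (\<lambda>(z, u). a z u) (at (z, u)) (x, 0) = c * x"
    unfolding D_def by blast
qed

text \<open>Invariance of domain for the map (\<zeta>, u) \<mapsto> (a, u), which is injective
  because \<open>Z\<close> inverts it.\<close>

lemma open_au_domain:
  assumes "open M" "smooth_on (\<lambda>(z, u). a z u) (zu_domain M)"
    "\<And>z u. (z, u) \<in> zu_domain M \<Longrightarrow> Z (a z u) u = z"
  shows "open (au_domain M a)"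
  unfolding au_domain_def
proof (rule invariance_of_domain[OF _ open_zu_domain[OF assms(1)]])
  have "continuous_on (zu_domain M) (\<lambda>p. ((\<lambda>(z, u). a z u) p, snd p))"
    by (intro continuous_intros smooth_on_imp_continuous_on assms)
  then show "continuous_on (zu_domain M) (\<lambda>(z, u). (a z u, u))"
    by (simp add: case_prod_unfold)
  show "inj_on (\<lambda>(z, u). (a z u, u)) (zu_domain M)"
    using assms(3) by (auto intro!: inj_onI) metis
qed

locale pp_normalized =
  fixes M :: "point set" and f a Z L :: "complex \<Rightarrow> real \<Rightarrow> complex"
  assumes vac: "vacuum_pp_wave M f" and norm: "normalized_coordinates M f a Z L"
    and alpha: "\<And>p. p \<in> M \<Longrightarrow> np_alpha a p \<noteq> 0"
begin

lemma a_sm: "smooth_on (\<lambda>(z, u). a z u) (zu_domain M)"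
  and a_exp: "(z, u) \<in> zu_domain M \<Longrightarrow> exp (4 * a z u) = d_z (d_z f) z u"
  and Z_sm: "smooth_on (\<lambda>(w, u). Z w u) (au_domain M a)"
  and Z_inv: "(z, u) \<in> zu_domain M \<Longrightarrow> Z (a z u) u = z"
  and L_sm: "smooth_on (\<lambda>(w, u). L w u) (au_domain M a)"
  and L_exp: "(w, u) \<in> au_domain M a \<Longrightarrow> exp (L w u) = d_z Z w u"
  using norm by (auto simp: normalized_coordinates_def)

lemma zu: "(z, u, v) \<in> M \<Longrightarrow> (z, u) \<in> zu_domain M"
  using zu_domainI[of "(z, u, v)" M] by simp

lemma au: "(z, u, v) \<in> M \<Longrightarrow> (a z u, u) \<in> au_domain M a"
  using zu by (force simp: au_domain_def)

lemma a_hs: "hol_smooth_on (lift a) M"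
  by (rule log_lift[OF vac a_sm a_exp])

lemma d_z_a: "(z, u, v) \<in> M \<Longrightarrow> d_z a z u = pz (lift a) (z, u, v)"
  by (rule lift_field_derivatives[OF hol_smooth_on_zu_diff[OF a_hs]])

sublocale pp_frame M f "lift a"
proof
  show "open M" "hol_smooth_on (lift f) M" by (rule vacuum_lift[OF vac])+
  show "hol_smooth_on (lift a) M" by (rule a_hs)
  fix p assume "p \<in> M"
  moreover obtain z u v where p: "p = (z, u, v)" by (cases p)
  ultimately have M: "(z, u, v) \<in> M" by simp
  show "pz (pz (lift f)) p = exp (4 * lift a p)"
    using vacuum_lift(5)[OF vac M] a_exp[OF zu[OF M]] by (simp add: p)
  show "pz (lift a) p \<noteq> 0"
    using alpha[OF M] d_z_a[OF M] by (simp add: p)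
qed

lemma Z_derivatives:
  assumes M: "(z, u, v) \<in> M"
  shows "d_u Z (a z u) u = q (z, u, v)" "d_z Z (a z u) u = m (z, u, v)"
proof -
  note D = smooth_on_has_derivative[OF Z_sm au[OF M]]
  have eq: "(\<lambda>(w, u). Z w u) (lift a p, fst (snd p)) = fst p" if "p \<in> M" for p
    using Z_inv[OF zu_domainI[OF that]] by simp
  note d = derivative_in_au_coordinates[of _ _ "(z, u, v)", OF _ eq zu_fst(3) M]
  show "d_u Z (a z u) u = q (z, u, v)"
    using d(1) D d_u_eq[OF D] by (simp add: zu_fst)
  show "d_z Z (a z u) u = m (z, u, v)"
    by (rule d_z_eq[OF D]) (use d(2) D in \<open>simp add: zu_fst\<close>)
qed

text \<open>\<open>exp L\<close> is \<open>m\<close> in the chart, so \<open>L_u\<close> is the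
  chart derivative of \<open>m\<close> divided by \<open>m\<close>, which \<open>pu_m\<close>
  evaluates.\<close>

lemma d_u_L:
  assumes M: "(z, u, v) \<in> M"
  shows "d_u L (a z u) u = pz q (z, u, v)"
proof -
  note D = smooth_on_has_derivative[OF L_sm au[OF M]]
  let ?D = "frechet_derivative (\<lambda>(w, u). L w u) (at (a z u, u))"
  have "((\<lambda>x. exp ((\<lambda>(w, u). L w u) x)) has_derivative (\<lambda>V. exp (L (a z u) u) * ?D V)) (at (a z u, u))"
    using has_derivative_compose[OF D DERIV_exp[unfolded has_field_derivative_def]] by simp
  moreover have "exp ((\<lambda>(w, u). L w u) (lift a p, fst (snd p))) = m p" if "p \<in> M" for p
  proof -
    obtain z u v where p: "p = (z, u, v)" by (cases p)
    show ?thesis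
      using L_exp[OF au] Z_derivatives(2) that by (simp add: p)
  qed
  ultimately have "exp (L (a z u) u) * ?D (0, 1) = pz m (z, u, v) * q (z, u, v) + pu m (z, u, v)"
    using derivative_in_au_coordinates(1)[of _ _ "(z, u, v)" m] zd(1)[OF M] M by simp
  moreover have "exp (L (a z u) u) = m (z, u, v)"
    using L_exp[OF au[OF M]] Z_derivatives(2)[OF M] by simp
  ultimately have "m (z, u, v) * ?D (0, 1) = m (z, u, v) * pz q (z, u, v)"
    using pu_m[OF M] by (simp add: algebra_simps)
  moreover have "m (z, u, v) \<noteq> 0" using az[OF M] by (simp add: m_def)
  ultimately show ?thesis using d_u_eq[OF D] by simp
qed

lemma d_u_d_u_Z:
  assumes M: "(z, u, v) \<in> M"
  shows "d_u (d_u Z) (a z u) u = n0 (z, u, v)"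
proof -
  let ?g = "\<lambda>p. frechet_derivative (\<lambda>(w, u). Z w u) (at p) (0, 1)"
  \<comment> \<open>\<open>d_u Z\<close> is known to agree with the Frechet derivative only on the
    chart domain, so differentiating it once more relies on that domain being open.\<close>
  have W: "open (au_domain M a)"
    by (rule open_au_domain[OF open_M a_sm Z_inv])
  have g: "?g (w, t) = d_u Z w t" if "(w, t) \<in> au_domain M a" for w t
    by (rule d_u_eq[OF smooth_on_has_derivative[OF Z_sm that], symmetric])
  note Dg = smooth_on_has_derivative[OF smooth_on_frechet_derivative[OF Z_sm, of "(0, 1)"] au[OF M]]
  have D: "((\<lambda>(w, u). d_u Z w u) has_derivative frechet_derivative ?g (at (a z u, u))) (at (a z u, u))"
    by (rule has_derivative_transform_within_open[OF Dg W au[OF M]]) (auto simp: g)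
  have eq: "?g (lift a p, fst (snd p)) = q p" if "p \<in> M" for p
  proof -
    obtain z u v where p: "p = (z, u, v)" by (cases p)
    show ?thesis using g[OF au] Z_derivatives(1) that by (simp add: p)
  qed
  have "frechet_derivative ?g (at (a z u, u)) (0, 1) = pz q (z, u, v) * q (z, u, v) + pu q (z, u, v)"
    using derivative_in_au_coordinates(1)[of ?g _ "(z, u, v)" q, OF _ eq zd(2)[OF M] M] Dg by simp
  then show ?thesis using d_u_eq[OF D] by (simp add: n0_def)
qed

lemma np_eq:
  assumes "p \<in> M"
  shows "np_alpha a p = al p" "np_mu a L p = mu p" "np_nu f a Z p = nu p"
proof -
  obtain z u v where p: "p = (z, u, v)" by (cases p)
  have M: "(z, u, v) \<in> M" using assms p by simp
  show "np_alpha a p = al p" "np_mu a L p = mu p" "np_nu f a Z p = nu p"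
    using d_z_a[OF M] d_u_L[OF M] d_u_d_u_Z[OF M] vacuum_lift(3)[OF vac M]
    by (simp_all add: p al_def mu_def nu_def)
qed

lemma np_differential:
  assumes p: "p \<in> M"
  shows "differential (np_alpha a) p = differential al p"
    "differential (\<lambda>q. cnj (np_alpha a q)) p = differential (\<lambda>q. cnj (al q)) p"
    "differential (np_mu a L) p = differential mu p"
    "differential (np_nu f a Z) p = differential nu p"
proof -
  have *: "differential G p = differential H p"
    if "(H has_derivative D) (at p)" "\<And>q. q \<in> M \<Longrightarrow> G q = H q" for G H D
  proof -
    have "(G has_derivative D) (at p)"
      by (rule has_derivative_transform_within_open[OF that(1) open_M p]) (simp add: that(2))
    then show ?thesis
      unfolding differential_def
      using frechet_derivative_at[OF that(1)] frechet_derivative_at by metis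
  qed
  show "differential (np_alpha a) p = differential al p"
    by (rule *[OF al_differential[OF p] np_eq(1)])
  show "differential (\<lambda>q. cnj (np_alpha a q)) p = differential (\<lambda>q. cnj (al q)) p"
    by (rule *[OF has_derivative_cnj[OF al_differential[OF p]]]) (simp add: np_eq)
  show "differential (np_mu a L) p = differential mu p"
    by (rule *[OF mu_differential[OF p] np_eq(2)])
  show "differential (np_nu f a Z) p = differential nu p"
    by (rule *[OF nu_differential[OF p] np_eq(3)])
qed

end

theorem proposition6p2:
  fixes M :: "point set" and f a Z L :: "complex \<Rightarrow> real \<Rightarrow> complex"
  assumes "vacuum_pp_wave M f"
    and "\<And>p. p \<in> M \<Longrightarrow> np_alpha a p \<noteq> 0"
    and "normalized_coordinates M f a Z L"
    and "constant_invariant_rank M f a Z L"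
    and "\<And>p. p \<in> M \<Longrightarrow>
           wedge2 (differential (np_alpha a) p) (differential (\<lambda>q. cnj (np_alpha a q)) p) = (\<lambda>X Y. 0)"
    and "\<And>p. p \<in> M \<Longrightarrow>
           wedge2 (differential (np_alpha a) p) (differential (np_mu a L) p) \<noteq> (\<lambda>X Y. 0)"
  shows "(\<forall>p\<in>M. isometry_dimension (pp_metric f) M p 2) \<longleftrightarrow>
         (\<forall>p\<in>M. wedge3 (differential (np_alpha a) p) (differential (np_mu a L) p)
                        (differential (np_nu f a Z) p) = (\<lambda>X Y W. 0))"
proof -
  interpret pp_normalized M f a Z L
    by unfold_locales (rule assms(1,3) | erule assms(2))+
  interpret pp_independent M f "lift a"
    by unfold_locales (use assms(5,6) in \<open>simp_all add: np_differential\<close>)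
  \<comment> \<open>The implication from left to right is pointwise in \<open>p\<close>; the
    converse uses the vanishing of \<open>wedge3\<close> on all of \<open>M\<close>.\<close>
  show ?thesis
    using wedge3_zero_of_dimension_two dimension_two_of_wedge3 by (auto simp: np_differential)
qed

end
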